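(* Let $1\le p_1<p_0\le\infty$, $m\in\mathbb{N}$, $n\in\mathbb{Z}_+$, $n\le m/2$, let $k$ be an integer with $1\le k\le m$, and put $\nu=k^{1/p_1-1/p_0}$. Write $d_n:=d_n(B_{p_0}^m\cap\nu B_{p_1}^m,\,l_q^m)$ for the Kolmogorov $n$-width. Below, $\asymp$ denotes two-sided inequality up to positive constants depending only on $p_0,p_1,q$. 1. Let $1\le p_1<2<p_0<q<\infty$. Then $$d_n\asymp\begin{cases}1, & n\le m^{2/q},\\ (n^{-1/2}m^{1/q})^{\frac{1/p_0-1/q}{1/2-1/q}}, & m^{2/q}\le n\le k^{1-2/q}m^{2/q},\\ k^{1/2-1/p_0}\,n^{-1/2}m^{1/q}, & k^{1-2/q}m^{2/q}\le n\le m/2.\end{cases}$$ 2. Let $2\le p_1<p_0<q<\infty$. Then $$d_n\asymp\begin{cases}1, & n\le m^{2/q},\\ (n^{-1/2}m^{1/q})^{\frac{1/p_0-1/q}{1/2-1/q}}, & m^{2/q}\le n\le k^{1-2/q}m^{2/q},\\ k^{1/p_1-1/p_0}\,(n^{-1/2}m^{1/q})^{\frac{1/p_1-1/q}{1/2-1/q}}, & k^{1-2/q}m^{2/q}\le n\le m/2.\end{cases}$$ 3. Let $2\le p_1\le q\le p_0$. Then $$d_n\asymp\begin{cases}k^{1/q-1/p_0}, & n\le k^{1-2/q}m^{2/q},\\ k^{1/p_1-1/p_0}\,(n^{-1/2}m^{1/q})^{\frac{1/p_1-1/q}{1/2-1/q}}, & k^{1-2/q}m^{2/q}\le n\le m/2.\end{cases}$$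 4. Let $1\le p_1<2<q\le p_0$. Then $$d_n\asymp\begin{cases}k^{1/q-1/p_0}, & n\le k^{1-2/q}m^{2/q},\\ k^{1/2-1/p_0}\,n^{-1/2}m^{1/q}, & k^{1-2/q}m^{2/q}\le n\le m/2.\end{cases}$$ 5. Let $q\le 2$, $1\le p_1<q<p_0$. Then $d_n\asymp k^{1/q-1/p_0}$. 6. Let $1\le q\le p_1<p_0\le\infty$. Then $d_n\asymp k^{1/p_1-1/p_0}\,m^{1/q-1/p_1}$.
   Context: For $1\le p\le\infty$, $l_p^m$ is $\mathbb{R}^m$ with the norm $\|x\|_{l_p^m}=\left(\sum_{j=1}^m|x_j|^p\right)^{1/p}$ for $p<\infty$ and $\|x\|_{l_\infty^m}=\max_{1\le j\le m}|x_j|$ for $p=\infty$; $B_p^m$ is the unit ball of $l_p^m$, and $\nu B_p^m=\{\nu x: x\in B_p^m\}$. By convention $1/\infty=0$. $\mathbb{Z}_+$ denotes the nonnegative integers. For a normed space $X$, a set $M\subset X$ and $n\in\mathbb{Z}_+$, the Kolmogorov $n$-width of $M$ in $X$ is $$d_n(M,X)=\inf_{L\in\mathcal{L}_n(X)}\ \sup_{x\in M}\ \inf_{y\in L}\|x-y\|,$$ where $\mathcal{L}_n(X)$ is the family of linear subspaces of $X$ of dimension at most $n$. For nonnegative quantities $f,g$ depending on $(m,n,k)$ and on the parameters $p_0,p_1,q$, $f\asymp g$ means: for every admissible $(p_0,p_1,q)$ there are constants $c,C>0$ depending only on $p_0,p_1,q$ such that $c\,g\le f\le C\,g$ for all admissible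 $m,n,k$ (in the stated range).
   Formalization: Items 3 and 4 are stated for q < ∞ only; at q = p_0 = ∞ the claim fails: for k = 1 the set contains e_1,…,e_m, whose n-width in l_∞^m stays bounded below as m grows with n fixed, contradicting the bound C n^{-min(1/p_1,1/2)}. *)

theory Defs
  imports "HOL-Analysis.Analysis" "HOL-Analysis.Finite_Function_Topology"
begin

text \<open>
  The dimension m varies under the quantifiers, so \<open>\<real>\<^sup>m\<close> is the space of finitely supported
  sequences vanishing outside \<open>{..<m}\<close> (coordinates are numbered from 0). The library makes
  the finitely supported sequences a real vector space, which provides
  \<^const>\<open>subspace\<close>, \<^const>\<open>span\<close> and \<^const>\<open>dim\<close>.
  The library's own norm on this type is not used.
\<close>

definition Rn :: "nat \<Rightarrow> (nat \<Rightarrow>\<^sub>0 real) set"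
  where "Rn m = {x. Poly_Mapping.keys x \<subseteq> {..<m}}"

text \<open>Exponents range over \<open>[1,\<infinity>]\<close> inside \<^typ>\<open>ereal\<close>; the reciprocal of \<open>\<infinity>\<close> is 0.\<close>

definition recip :: "ereal \<Rightarrow> real"
  where "recip p = real_of_ereal (1 / p)"

lemma recip_PInf: "recip \<infinity> = 0"
  by (simp add: recip_def)

lemma recip_ereal: "r \<noteq> 0 \<Longrightarrow> recip (ereal r) = 1 / r"
  by (simp add: recip_def one_ereal_def)

text \<open>Only meaningful for \<open>m \<ge> 1\<close> and x in \<open>Rn m\<close>.\<close>

definition lnorm :: "nat \<Rightarrow> ereal \<Rightarrow> (nat \<Rightarrow>\<^sub>0 real) \<Rightarrow> real"
  where "lnorm m p x =
    (if p = \<infinity> then Max ((\<lambda>j. \<bar>Poly_Mapping.lookup x j\<bar>) ` {..<m})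
     else (\<Sum>j<m. \<bar>Poly_Mapping.lookup x j\<bar> powr real_of_ereal p) powr (1 / real_of_ereal p))"

definition lball :: "nat \<Rightarrow> ereal \<Rightarrow> (nat \<Rightarrow>\<^sub>0 real) set"
  where "lball m p = {x \<in> Rn m. lnorm m p x \<le> 1}"

text \<open>
  The Kolmogorov n-width of M in the normed space with carrier X and norm N. It is taken in
  \<^typ>\<open>ereal\<close>, where all suprema and infima exist. Finite dimensionality of L is required
  explicitly, since \<^const>\<open>dim\<close> is 0 on infinite-dimensional subspaces.
\<close>

definition kolmogorov_width ::
    "nat \<Rightarrow> 'a::real_vector set \<Rightarrow> 'a set \<Rightarrow> ('a \<Rightarrow> real) \<Rightarrow> ereal"
  where "kolmogorov_width n M X N =
    (INF L\<in>{L. subspace L \<and> L \<subseteq> X \<and> (\<exists>B. finite B \<and> span B = L) \<and> dim L \<le> n}.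
       SUP x\<in>M. INF y\<in>L. ereal (N (x - y)))"

definition inter_width :: "ereal \<Rightarrow> ereal \<Rightarrow> ereal \<Rightarrow> nat \<Rightarrow> nat \<Rightarrow> nat \<Rightarrow> ereal"
  where "inter_width p0 p1 q m n k =
    (let \<nu> = real k powr (recip p1 - recip p0)
     in kolmogorov_width n (lball m p0 \<inter> (\<lambda>x. \<nu> *\<^sub>R x) ` lball m p1) (Rn m) (lnorm m q))"

definition admissible :: "nat \<Rightarrow> nat \<Rightarrow> nat \<Rightarrow> bool"
  where "admissible m n k \<longleftrightarrow> real n \<le> real m / 2 \<and> 1 \<le> k \<and> k \<le> m"

definition between_multiples :: "real \<Rightarrow> real \<Rightarrow> ereal \<Rightarrow> real \<Rightarrow> bool"
  where "between_multiples c C f g \<longleftrightarrow> ereal (c * g) \<le> f \<and> f \<le> ereal (C * g)"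

end

theory Submission
  imports Defs
begin

text \<open>
  Lower bounds. Multiples of the vectors with \<open>l\<close> entries \<open>\<plusminus>1\<close> and zeros elsewhere lie in the
  intersection. For a subspace \<open>L\<close> with orthogonal projection \<open>P\<close>, choose a support \<open>S\<close> of size \<open>l\<close>
  on which the diagonal of \<open>P\<close> is at most average, and let \<open>v\<close> be a random sign vector on \<open>S\<close>. Pairing
  \<open>v - y\<close> (\<open>y \<in> L\<close>) with \<open>w = v - P v\<close> gives \<open>|w|\<^sub>2\<^sup>2 \<le> \<parallel>v - y\<parallel>\<^sub>q \<parallel>w\<parallel>\<^sub>q\<^sub>'\<close>; the left side is at least \<open>l/2\<close>
  on average, and the moments of \<open>w\<close> are controlled by the trace of \<open>P\<close> (\<open>q \<ge> 2\<close>) or by Khintchine's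
  inequality (\<open>1 < q \<le> 2\<close>). For \<open>q \<le> p\<^sub>1\<close> the extreme points of the unit cube of the annihilator of \<open>L\<close>
  give the bound in \<open>l\<^sub>1\<close>, hence in \<open>l\<^sub>q\<close>.

  Upper bounds. All follow from \<open>d\<^sub>n(B\<^sub>2, l\<^sub>q) \<le> C n\<^sup>-\<^sup>1\<^sup>/\<^sup>2 m\<^sup>1\<^sup>/\<^sup>q\<close>: split a vector into large and small
  coordinates to pass from \<open>B\<^sub>2\<close> to \<open>B\<^sub>p\<close>, or interpolate between \<open>p\<^sub>1\<close> and \<open>p\<^sub>0\<close>. The estimate itself is dual
  to a low \<open>M\<^sup>*\<close> estimate: a random \<open>n \<times> m\<close> sign matrix has a kernel on which
  \<open>|x|\<^sub>2 \<le> C n\<^sup>-\<^sup>1\<^sup>/\<^sup>2 m\<^sup>1\<^sup>/\<^sup>q \<parallel>x\<parallel>\<^sub>q\<^sub>'\<close>, by symmetrization and contraction.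
\<close>

section \<open>Averages over signs\<close>

text \<open>Origin of the regimes. Let \<open>q > 2\<close> and \<open>s = n^(-1/2) m^(1/q)\<close>.
  Some vector of \<open>l\<close> signs has, up to a constant, \<open>l_q\<close>-distance at least
  \<open>min(l^(1/q), l^(1/2) s)\<close> from \<open>L\<close>, and the scale putting it into the
  intersection is \<open>min(l^(-1/p0), \<nu> l^(-1/p1))\<close>, which switches at
  \<open>l = k\<close>. The first minimum switches at \<open>l0 = s^(-1/(1/2-1/q))\<close>;
  \<open>l0 = 1\<close> and \<open>l0 = k\<close> are exactly the thresholds
  \<open>n = m^(2/q)\<close> and \<open>n = k^(1-2/q) m^(2/q)\<close>. The product is piecewise a
  power of \<open>l\<close>, so its maximum sits at \<open>l = 1\<close>, \<open>l0\<close>,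
  \<open>k\<close> or \<open>m\<close>, depending on the signs of the exponents: this choice of
  \<open>l\<close> is the case distinction of the theorem. For \<open>1 < q <= 2\<close> the
  distance is of order \<open>l^(1/q)\<close>, and the best \<open>l\<close> is \<open>k\<close> or
  \<open>m\<close>. Hoelder's inequality mostly gives way to Young's inequality or a comparison of
  powers, whose q-th powers can be averaged term by term.\<close>

text \<open>A choice of signs indexed by \<open>I\<close> is encoded by the subset of \<open>I\<close> carrying the sign \<open>+1\<close>, so an
  expectation over independent random signs is an average over \<open>Pow I\<close>.\<close>

definition rsign :: "'a set \<Rightarrow> 'a \<Rightarrow> real"
  where "rsign A i = (if i \<in> A then 1 else -1)"

definition sign_avg :: "'a set \<Rightarrow> ('a set \<Rightarrow> real) \<Rightarrow> real"
  where "sign_avg I F = (\<Sum>A\<in>Pow I. F A) / 2 ^ card I"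

lemma sign_avg_add: "sign_avg I (\<lambda>A. F A + G A) = sign_avg I F + sign_avg I G"
  by (simp add: sign_avg_def sum.distrib add_divide_distrib)

lemma sign_avg_cmult: "sign_avg I (\<lambda>A. c * F A) = c * sign_avg I F"
  by (simp add: sign_avg_def flip: sum_distrib_left)

lemma sign_avg_divide: "sign_avg I (\<lambda>A. F A / c) = sign_avg I F / c"
  using sign_avg_cmult[of I "1 / c" F] by simp

lemma sign_avg_diff: "sign_avg I (\<lambda>A. F A - G A) = sign_avg I F - sign_avg I G"
  using sign_avg_add[of I F "\<lambda>A. - 1 * G A"] sign_avg_cmult[of I "- 1" G] by simp

lemma sign_avg_const: "finite I \<Longrightarrow> sign_avg I (\<lambda>A. c) = c"
  by (simp add: sign_avg_def card_Pow)

lemma sign_avg_sum: "sign_avg I (\<lambda>A. \<Sum>j\<in>J. F j A) = (\<Sum>j\<in>J. sign_avg I (F j))"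
  unfolding sign_avg_def by (subst sum.swap) (simp add: sum_divide_distrib)

lemma sign_avg_mono: "(\<And>A. A \<subseteq> I \<Longrightarrow> F A \<le> G A) \<Longrightarrow> sign_avg I F \<le> sign_avg I G"
  unfolding sign_avg_def by (intro divide_right_mono sum_mono) auto

lemma sign_avg_cong: "(\<And>A. A \<subseteq> I \<Longrightarrow> F A = G A) \<Longrightarrow> sign_avg I F = sign_avg I G"
  unfolding sign_avg_def by (metis (no_types, lifting) PowD sum.cong)

lemma sign_avg_empty: "sign_avg {} F = F {}"
  by (simp add: sign_avg_def)

lemma sign_avg_insert:
  assumes "finite I" "i \<notin> I"
  shows "sign_avg (insert i I) F = (sign_avg I (\<lambda>A. F (insert i A)) + sign_avg I F) / 2"
proof -
  have "(\<Sum>A\<in>Pow (insert i I). F A) = (\<Sum>A\<in>Pow I. F A) + (\<Sum>A\<in>insert i ` Pow I. F A)"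
    unfolding Pow_insert using assms by (intro sum.union_disjoint) auto
  also have "(\<Sum>A\<in>insert i ` Pow I. F A) = (\<Sum>A\<in>Pow I. F (insert i A))"
    using assms by (subst sum.reindex) (auto simp: inj_on_def)
  finally show ?thesis
    using assms by (simp add: sign_avg_def field_simps)
qed

text \<open>Fubini for independent signs; it allows the rows of a random matrix to be averaged one
  at a time.\<close>

lemma sign_avg_union:
  assumes "finite I" "finite J" "I \<inter> J = {}"
  shows "sign_avg (I \<union> J) F = sign_avg I (\<lambda>A. sign_avg J (\<lambda>B. F (A \<union> B)))"
  using assms(2,3)
proof (induction J arbitrary: F rule: finite_induct)
  case empty
  then show ?case by (simp add: sign_avg_empty)
next
  case (insert j J)
  have *: "sign_avg (I \<union> insert j J) F
      = (sign_avg (I \<union> J) (\<lambda>A. F (insert j A)) + sign_avg (I \<union> J) F) / 2"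
    using insert assms(1) by (simp add: sign_avg_insert)
  have "sign_avg (I \<union> J) (\<lambda>A. F (insert j A))
      = sign_avg I (\<lambda>A. sign_avg J (\<lambda>B. F (insert j (A \<union> B))))"
    using insert by (subst insert.IH) auto
  moreover have "sign_avg (I \<union> J) F = sign_avg I (\<lambda>A. sign_avg J (\<lambda>B. F (A \<union> B)))"
    using insert by (subst insert.IH) auto
  ultimately show ?case
    using insert unfolding * sign_avg_insert[OF insert.hyps]
    by (simp add: add_divide_distrib sign_avg_add sign_avg_divide)
qed

text \<open>Complementation flips all signs at once, so this is the symmetry of the sign
  distribution.\<close>

lemma sign_avg_compl: "sign_avg I F = sign_avg I (\<lambda>A. F (I - A))"
proof -
  have "(\<Sum>A\<in>Pow I. F (I - A)) = (\<Sum>A\<in>Pow I. F A)"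
    by (rule sum.reindex_bij_witness[of _ "\<lambda>A. I - A" "\<lambda>A. I - A"]) auto
  then show ?thesis by (simp add: sign_avg_def)
qed

lemma rsign_compl: "i \<in> I \<Longrightarrow> rsign (I - A) i = - rsign A i"
  by (simp add: rsign_def)

lemma abs_rsign [simp]: "\<bar>rsign A i\<bar> = 1"
  by (simp add: rsign_def)

text \<open>Common induction step of the moment bounds below: odd powers of \<open>a i\<close>
  cancel in the polynomial moments, and a factor \<open>cosh (a i)\<close> splits off in the
  exponential one.\<close>

lemma sign_avg_insert_linear:
  assumes "finite I" "i \<notin> I"
  shows "sign_avg (insert i I) (\<lambda>A. \<phi> (\<Sum>k\<in>insert i I. a k * rsign A k))
    = sign_avg I (\<lambda>A. (\<phi> ((\<Sum>k\<in>I. a k * rsign A k) + a i)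
        + \<phi> ((\<Sum>k\<in>I. a k * rsign A k) - a i)) / 2)"
proof -
  have 1: "(\<Sum>k\<in>insert i I. a k * rsign (insert i A) k) = (\<Sum>k\<in>I. a k * rsign A k) + a i" for A
  proof -
    have "(\<Sum>k\<in>I. a k * rsign (insert i A) k) = (\<Sum>k\<in>I. a k * rsign A k)"
      using assms by (intro sum.cong) (auto simp: rsign_def)
    then show ?thesis using assms by (simp add: rsign_def)
  qed
  have 2: "(\<Sum>k\<in>insert i I. a k * rsign A k) = (\<Sum>k\<in>I. a k * rsign A k) - a i"
    if "A \<subseteq> I" for A
    using assms that by (auto simp: rsign_def)
  have "sign_avg I (\<lambda>A. \<phi> (\<Sum>k\<in>insert i I. a k * rsign A k))
      = sign_avg I (\<lambda>A. \<phi> ((\<Sum>k\<in>I. a k * rsign A k) - a i))"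
    by (rule sign_avg_cong) (simp only: 2)
  then show ?thesis
    unfolding sign_avg_insert[OF assms] 1
    by (simp add: add_divide_distrib sign_avg_add sign_avg_divide)
qed

section \<open>Moments of sign sums and Khintchine's inequalities\<close>

lemma sign_avg_square:
  assumes "finite I"
  shows "sign_avg I (\<lambda>A. (\<Sum>i\<in>I. a i * rsign A i)\<^sup>2) = (\<Sum>i\<in>I. (a i)\<^sup>2)"
  using assms
proof (induction I rule: finite_induct)
  case (insert i I)
  have "((x + a i)\<^sup>2 + (x - a i)\<^sup>2) / 2 = x\<^sup>2 + (a i)\<^sup>2" for x
    by (simp add: power2_eq_square algebra_simps)
  then show ?case
    using insert sign_avg_insert_linear[OF insert.hyps, of "\<lambda>x. x\<^sup>2" a]
    by (simp only: sign_avg_add sign_avg_const sum.insert) simp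
qed (simp add: sign_avg_empty)

text \<open>The mixed term of the expansion has coefficient 6, and
  \<open>3 (v + t)^2 = 3 v^2 + 6 v t + 3 t^2\<close> reproduces it exactly, with \<open>v\<close>
  the old variance and \<open>t\<close> the new square; hence the constant 3 survives the
  induction.\<close>

lemma sign_avg_power4:
  assumes "finite I"
  shows "sign_avg I (\<lambda>A. (\<Sum>i\<in>I. a i * rsign A i) ^ 4) \<le> 3 * (\<Sum>i\<in>I. (a i)\<^sup>2)\<^sup>2"
  using assms
proof (induction I rule: finite_induct)
  case (insert i I)
  let ?X = "\<lambda>A. \<Sum>i\<in>I. a i * rsign A i"
  have "((x + a i) ^ 4 + (x - a i) ^ 4) / 2 = x ^ 4 + 6 * (a i)\<^sup>2 * x\<^sup>2 + (a i) ^ 4" for x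
    by (simp add: power4_eq_xxxx power2_eq_square algebra_simps)
  then have "sign_avg (insert i I) (\<lambda>A. (\<Sum>i\<in>insert i I. a i * rsign A i) ^ 4)
      = sign_avg I (\<lambda>A. ?X A ^ 4) + 6 * (a i)\<^sup>2 * (\<Sum>i\<in>I. (a i)\<^sup>2) + (a i) ^ 4"
    using insert sign_avg_insert_linear[OF insert.hyps, of "\<lambda>x. x ^ 4" a]
    by (simp only: sign_avg_add sign_avg_const sign_avg_cmult sign_avg_square)
  also have "\<dots> \<le> 3 * (\<Sum>i\<in>I. (a i)\<^sup>2)\<^sup>2 + 6 * (a i)\<^sup>2 * (\<Sum>i\<in>I. (a i)\<^sup>2) + 3 * (a i) ^ 4"
    using add_mono[OF insert.IH, of 0 "2 * a i ^ 4"] by simp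
  also have "\<dots> = 3 * ((\<Sum>i\<in>I. (a i)\<^sup>2) + (a i)\<^sup>2)\<^sup>2"
    by (simp add: power2_eq_square power4_eq_xxxx algebra_simps)
  finally show ?case using insert by (simp add: add.commute)
qed (simp add: sign_avg_empty)

text \<open>On \<open>[0, 1]\<close> the two exponentials are at most \<open>1 + y + y^2\<close> and
  \<open>1 - y + y^2\<close>; beyond 1 each is at most \<open>exp (y^2)\<close>. The sharper
  exponent \<open>x^2 / 2\<close> would only improve constants.\<close>

lemma exp_add_exp_minus_le:
  fixes x :: real
  shows "(exp x + exp (- x)) / 2 \<le> exp (x\<^sup>2)"
proof -
  have *: "(exp y + exp (- y)) / 2 \<le> exp (y\<^sup>2)" if "y \<ge> 0" for y :: real
  proof (cases "y \<le> 1")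
    case True
    have "exp (- y) \<le> 1 / (1 + y)"
      using exp_ge_add_one_self[of y] that by (simp add: exp_minus field_simps)
    also have "\<dots> \<le> 1 - y + y\<^sup>2"
    proof -
      have "1 \<le> (1 - y + y\<^sup>2) * (1 + y)"
        using that by (simp add: algebra_simps power2_eq_square)
      then show ?thesis using that by (simp add: pos_divide_le_eq)
    qed
    finally have "(exp y + exp (- y)) / 2 \<le> 1 + y\<^sup>2"
      using exp_bound[OF that True] by simp
    also have "\<dots> \<le> exp (y\<^sup>2)" by simp
    finally show ?thesis .
  next
    case False
    then have "y \<le> y\<^sup>2" by (simp add: power2_eq_square)
    then have "y \<le> y\<^sup>2" "- y \<le> y\<^sup>2" using that by linarith+
    then have "exp y \<le> exp (y\<^sup>2)" "exp (- y) \<le> exp (y\<^sup>2)" by simp_all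
    from add_mono[OF this] show ?thesis by (simp del: exp_le_cancel_iff)
  qed
  show ?thesis using *[of "\<bar>x\<bar>"] by (cases "x \<ge> 0") (auto simp: add.commute)
qed

lemma sign_avg_exp:
  assumes "finite I"
  shows "sign_avg I (\<lambda>A. exp (\<Sum>i\<in>I. a i * rsign A i)) \<le> exp (\<Sum>i\<in>I. (a i)\<^sup>2)"
  using assms
proof (induction I rule: finite_induct)
  case (insert i I)
  have "(exp (x + a i) + exp (x - a i)) / 2 = ((exp (a i) + exp (- a i)) / 2) * exp x" for x
    by (simp add: exp_add exp_diff exp_minus field_simps)
  then have "sign_avg (insert i I) (\<lambda>A. exp (\<Sum>i\<in>insert i I. a i * rsign A i))
      = ((exp (a i) + exp (- a i)) / 2) * sign_avg I (\<lambda>A. exp (\<Sum>i\<in>I. a i * rsign A i))"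
    using sign_avg_insert_linear[OF insert.hyps, of exp a] by (simp only: sign_avg_cmult)
  also have "\<dots> \<le> exp ((a i)\<^sup>2) * exp (\<Sum>i\<in>I. (a i)\<^sup>2)"
    using insert.IH exp_add_exp_minus_le[of "a i"]
    by (intro mult_mono) (auto simp: sign_avg_def intro!: sum_nonneg divide_nonneg_nonneg)
  finally show ?case using insert by (simp add: exp_add)
qed (simp add: sign_avg_empty)

text \<open>Apply \<open>u <= exp u\<close> to \<open>u = |t| / r\<close> and raise to the power
  \<open>r\<close>. This passes from exponential moments to moments of any real order and is the
  source of the factor \<open>r powr r\<close> in the constants.\<close>

lemma abs_powr_le_exp:
  fixes t r :: real
  assumes "r > 0"
  shows "\<bar>t\<bar> powr r \<le> r powr r * (exp t + exp (- t))"
proof -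
  have "\<bar>t\<bar> / r \<le> exp (\<bar>t\<bar> / r)"
    using exp_ge_add_one_self[of "\<bar>t\<bar> / r"] by linarith
  then have "\<bar>t\<bar> powr r \<le> (r * exp (\<bar>t\<bar> / r)) powr r"
    using assms by (intro powr_mono2) (auto simp: field_simps)
  also have "\<dots> = r powr r * exp \<bar>t\<bar>"
    using assms by (simp add: powr_mult exp_powr_real)
  also have "exp \<bar>t\<bar> \<le> exp t + exp (- t)"
    by (cases "t \<ge> 0") auto
  finally show ?thesis by (simp add: mult_left_mono)
qed

text \<open>Subgaussian argument: after scaling the variance to 1, both \<open>exp (X / s)\<close>
  and \<open>exp (- X / s)\<close> have mean at most \<open>exp 1\<close>, and together they
  dominate the power by \<open>abs_powr_le_exp\<close>.\<close>

lemma khintchine_upper: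
  assumes "finite I" "r > 0"
  shows "sign_avg I (\<lambda>A. \<bar>\<Sum>i\<in>I. a i * rsign A i\<bar> powr r)
    \<le> 2 * exp 1 * r powr r * (\<Sum>i\<in>I. (a i)\<^sup>2) powr (r / 2)"
proof (cases "(\<Sum>i\<in>I. (a i)\<^sup>2) = 0")
  case True
  then have "\<forall>i\<in>I. a i = 0" using assms by (simp add: sum_nonneg_eq_0_iff)
  then show ?thesis by (simp add: sign_avg_def)
next
  case False
  define v where "v = (\<Sum>i\<in>I. (a i)\<^sup>2)"
  define s where "s = sqrt v"
  have "v \<ge> 0" by (simp add: v_def sum_nonneg)
  then have v: "v > 0" using False by (simp add: v_def)
  then have s: "s > 0" "s\<^sup>2 = v" by (simp_all add: s_def)
  let ?X = "\<lambda>A. \<Sum>i\<in>I. a i * rsign A i"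
  have X: "?X A / s = (\<Sum>i\<in>I. (a i / s) * rsign A i)"
      "- (?X A / s) = (\<Sum>i\<in>I. (- a i / s) * rsign A i)" for A
    by (simp_all add: sum_divide_distrib flip: sum_negf)
  have one: "(\<Sum>i\<in>I. (a i / s)\<^sup>2) = 1" "(\<Sum>i\<in>I. (- a i / s)\<^sup>2) = 1"
    using s v by (simp_all add: power_divide v_def flip: sum_divide_distrib)
  have "\<bar>?X A\<bar> powr r \<le> s powr r * r powr r * (exp (?X A / s) + exp (- (?X A / s)))" for A
  proof -
    have "\<bar>?X A\<bar> powr r = s powr r * \<bar>?X A / s\<bar> powr r"
      using s by (simp add: abs_divide powr_divide)
    also have "\<dots> \<le> s powr r * (r powr r * (exp (?X A / s) + exp (- (?X A / s))))"
      using assms by (intro mult_left_mono abs_powr_le_exp) auto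
    finally show ?thesis by (simp add: mult.assoc)
  qed
  then have "sign_avg I (\<lambda>A. \<bar>?X A\<bar> powr r)
      \<le> sign_avg I (\<lambda>A. s powr r * r powr r * (exp (?X A / s) + exp (- (?X A / s))))"
    by (intro sign_avg_mono)
  also have "\<dots> = s powr r * r powr r
      * (sign_avg I (\<lambda>A. exp (?X A / s)) + sign_avg I (\<lambda>A. exp (- (?X A / s))))"
    by (simp only: sign_avg_cmult sign_avg_add)
  also have "\<dots> \<le> s powr r * r powr r * (exp 1 + exp 1)"
    unfolding X using sign_avg_exp[OF assms(1), of "\<lambda>i. a i / s"]
      sign_avg_exp[OF assms(1), of "\<lambda>i. - a i / s"]
    unfolding one by (intro mult_left_mono add_mono) (auto simp: sum_negf)
  also have "s powr r = v powr (r / 2)"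
    using v by (simp add: s_def powr_half_sqrt[symmetric] powr_powr)
  finally show ?thesis unfolding v_def by (simp add: mult_ac)
qed

text \<open>First moment from the second and fourth: for \<open>u = |X| / s\<close> the pointwise
  bound \<open>u^2 - u^4 / 6 <= u\<close> has a left side of mean at least
  \<open>1 - 3 / 6 = 1 / 2\<close>.\<close>

lemma khintchine_lower:
  assumes "finite I"
  shows "sqrt (\<Sum>i\<in>I. (a i)\<^sup>2) / 2 \<le> sign_avg I (\<lambda>A. \<bar>\<Sum>i\<in>I. a i * rsign A i\<bar>)"
proof (cases "(\<Sum>i\<in>I. (a i)\<^sup>2) = 0")
  case True
  then have "\<forall>i\<in>I. a i = 0" using assms by (simp add: sum_nonneg_eq_0_iff)
  then show ?thesis by (simp add: sign_avg_def)
next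
  case False
  define v where "v = (\<Sum>i\<in>I. (a i)\<^sup>2)"
  define s where "s = sqrt v"
  have "v \<ge> 0" by (simp add: v_def sum_nonneg)
  then have v: "v > 0" using False by (simp add: v_def)
  then have s: "s > 0" "s\<^sup>2 = v" by (simp_all add: s_def)
  let ?X = "\<lambda>A. \<Sum>i\<in>I. a i * rsign A i"
  have poly: "u\<^sup>2 - u ^ 4 / 6 \<le> u" if "u \<ge> 0" for u :: real
  proof -
    \<comment> \<open>The cubic \<open>4/27 u^3 - u + 1\<close> has a double root at
      \<open>3/2\<close>; \<open>4/27\<close> is then enlarged to the convenient
      \<open>1/6\<close>.\<close>
    have "0 \<le> (u - 3/2)\<^sup>2 * (u + 3)" using that by (intro mult_nonneg_nonneg) auto
    also have "\<dots> = u ^ 3 - 27/4 * u + 27/4"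
      by (simp add: power2_eq_square power3_eq_cube algebra_simps)
    finally have a: "4/27 * u ^ 3 - u + 1 \<ge> 0" by simp
    have "4/27 * u ^ 3 \<le> 1/6 * u ^ 3" using that by (intro mult_right_mono) auto
    with a have "0 \<le> 1 - u + u ^ 3 / 6" by linarith
    then have "0 \<le> u * (1 - u + u ^ 3 / 6)" using that by simp
    then show ?thesis by (simp add: algebra_simps power2_eq_square power3_eq_cube power4_eq_xxxx)
  qed
  have "(1 / s) * (?X A)\<^sup>2 - (1 / (6 * s ^ 3)) * (?X A) ^ 4 \<le> \<bar>?X A\<bar>" for A
  proof -
    define u where "u = \<bar>?X A\<bar> / s"
    have "u \<ge> 0" using s by (simp add: u_def)
    then have "s * (u\<^sup>2 - u ^ 4 / 6) \<le> s * u" using poly s by (intro mult_left_mono) auto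
    moreover have "\<bar>?X A\<bar> = s * u" using s by (simp add: u_def)
    moreover have "(?X A)\<^sup>2 = s\<^sup>2 * u\<^sup>2" "(?X A) ^ 4 = s ^ 4 * u ^ 4"
      using s(1) by (simp_all add: u_def power_divide power_even_abs)
    ultimately show ?thesis
      using s(1) by (simp add: algebra_simps power2_eq_square power3_eq_cube power4_eq_xxxx)
  qed
  then have "sign_avg I (\<lambda>A. (1 / s) * (?X A)\<^sup>2 - (1 / (6 * s ^ 3)) * (?X A) ^ 4)
      \<le> sign_avg I (\<lambda>A. \<bar>?X A\<bar>)"
    by (intro sign_avg_mono)
  then have "(1 / s) * v - (1 / (6 * s ^ 3)) * sign_avg I (\<lambda>A. (?X A) ^ 4)
      \<le> sign_avg I (\<lambda>A. \<bar>?X A\<bar>)"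
    unfolding sign_avg_diff sign_avg_cmult sign_avg_square[OF assms] v_def .
  moreover have "(1 / (6 * s ^ 3)) * sign_avg I (\<lambda>A. (?X A) ^ 4) \<le> (1 / (6 * s ^ 3)) * (3 * v\<^sup>2)"
    using sign_avg_power4[OF assms, of a] s unfolding v_def by (intro mult_left_mono) auto
  moreover have "(1 / s) * v - (1 / (6 * s ^ 3)) * (3 * v\<^sup>2) = s / 2"
    using s(1) unfolding s(2)[symmetric] by (simp add: field_simps power2_eq_square power3_eq_cube)
  ultimately show ?thesis unfolding s_def v_def by linarith
qed

section \<open>Kernels of sign matrices\<close>

lemma sign_avg_swap:
  "sign_avg I (\<lambda>A. sign_avg J (\<lambda>B. F A B)) = sign_avg J (\<lambda>B. sign_avg I (\<lambda>A. F A B))"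
  unfolding sign_avg_def sum_divide_distrib[symmetric]
  by (subst sum.swap) (simp add: mult.commute)

lemma MAX_le:
  fixes f :: "'a \<Rightarrow> real"
  assumes "finite F" "F \<noteq> {}" "\<And>x. x \<in> F \<Longrightarrow> f x \<le> b"
  shows "(MAX x\<in>F. f x) \<le> b"
  using assms by (intro Max.boundedI) auto

text \<open>Symmetrization and contraction for one row. With \<open>g\<close> the absolute value of the linear form \<open>f\<close> and
  \<open>g'\<close> an independent copy, \<open>\<mu> - g\<close> is at most the expectation of \<open>g' - g\<close>, and
  \<open>max (a + g' - g) \<le> \<onehalf> max (a + 2g') + \<onehalf> max (a - 2g)\<close>; for one sample, the sum of the last two
  maxima does not decrease when \<open>g\<close> is replaced by \<open>f\<close>, which is symmetric.\<close>

lemma abs_linear_symmetrization: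
  fixes a :: "'x \<Rightarrow> real" and b :: "'x \<Rightarrow> 'i \<Rightarrow> real"
  assumes "finite J" "finite F" "F \<noteq> {}"
    and \<mu>: "\<And>x. x \<in> F \<Longrightarrow> \<mu> \<le> sign_avg J (\<lambda>B. \<bar>\<Sum>p\<in>J. b x p * rsign B p\<bar>)"
  shows "sign_avg J (\<lambda>B. MAX x\<in>F. a x + (\<mu> - \<bar>\<Sum>p\<in>J. b x p * rsign B p\<bar>))
    \<le> sign_avg J (\<lambda>B. MAX x\<in>F. a x + 2 * (\<Sum>p\<in>J. b x p * rsign B p))"
proof -
  define L where "L x B = (\<Sum>p\<in>J. b x p * rsign B p)" for x B
  define U where "U B = (MAX x\<in>F. a x + 2 * \<bar>L x B\<bar>)" for B
  define V where "V B = (MAX x\<in>F. a x - 2 * \<bar>L x B\<bar>)" for B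
  define P where "P B = (MAX x\<in>F. a x + 2 * L x B)" for B
  define N where "N B = (MAX x\<in>F. a x - 2 * L x B)" for B
  have le: "f x \<le> (MAX x\<in>F. f x)" if "x \<in> F" for f :: "'x \<Rightarrow> real" and x
    using that assms by (intro Max_ge) auto
  have "(MAX x\<in>F. a x + (\<mu> - \<bar>L x B\<bar>)) \<le> sign_avg J (\<lambda>B'. (U B' + V B) / 2)" for B
  proof (rule MAX_le[OF assms(2,3)])
    fix x assume x: "x \<in> F"
    have "a x + (\<mu> - \<bar>L x B\<bar>) \<le> a x + (sign_avg J (\<lambda>B'. \<bar>L x B'\<bar>) - \<bar>L x B\<bar>)"
      using \<mu>[OF x] by (simp add: L_def)
    also have "\<dots> = sign_avg J (\<lambda>B'. ((a x + 2 * \<bar>L x B'\<bar>) + (a x - 2 * \<bar>L x B\<bar>)) / 2)"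
      using assms(1) by (simp add: sign_avg_divide sign_avg_add sign_avg_diff sign_avg_const sign_avg_cmult)
    also have "\<dots> \<le> sign_avg J (\<lambda>B'. (U B' + V B) / 2)"
      unfolding U_def V_def by (intro sign_avg_mono divide_right_mono add_mono le x) auto
    finally show "a x + (\<mu> - \<bar>L x B\<bar>) \<le> sign_avg J (\<lambda>B'. (U B' + V B) / 2)" .
  qed
  then have "sign_avg J (\<lambda>B. MAX x\<in>F. a x + (\<mu> - \<bar>L x B\<bar>))
      \<le> sign_avg J (\<lambda>B. sign_avg J (\<lambda>B'. (U B' + V B) / 2))"
    by (intro sign_avg_mono)
  also have "\<dots> = sign_avg J (\<lambda>B. (U B + V B) / 2)"
    using assms(1) by (simp add: sign_avg_divide sign_avg_add sign_avg_const)
  also have "\<dots> \<le> sign_avg J (\<lambda>B. (P B + N B) / 2)"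
  proof (intro sign_avg_mono divide_right_mono)
    fix B
    have "U B \<in> (\<lambda>x. a x + 2 * \<bar>L x B\<bar>) ` F" "V B \<in> (\<lambda>x. a x - 2 * \<bar>L x B\<bar>) ` F"
      unfolding U_def V_def using assms by (auto intro!: Max_in)
    then obtain x y where xy: "x \<in> F" "y \<in> F" "U B = a x + 2 * \<bar>L x B\<bar>" "V B = a y - 2 * \<bar>L y B\<bar>"
      by auto
    \<comment> \<open>According to the sign of \<open>L x B\<close>, the value \<open>U B\<close> is
      bounded by \<open>P B\<close> or by \<open>N B\<close>; the other of the two then bounds
      \<open>V B\<close>, because \<open>- 2 |L y B|\<close> lies below both \<open>2 L y B\<close>
      and \<open>- 2 L y B\<close>.\<close>
    have "a x + 2 * L x B \<le> P B" "a y + 2 * L y B \<le> P B"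
      "a x - 2 * L x B \<le> N B" "a y - 2 * L y B \<le> N B"
      unfolding P_def N_def by (rule le; use xy in simp)+
    then show "U B + V B \<le> P B + N B" using xy by linarith
  qed auto
  also have "\<dots> = sign_avg J P"
  proof -
    have "L x (J - B) = - L x B" for x B
      unfolding L_def sum_negf[symmetric] by (intro sum.cong) (auto simp: rsign_compl)
    then have "sign_avg J N = sign_avg J P"
      by (subst sign_avg_compl) (simp add: P_def[abs_def] N_def)
    then show ?thesis by (simp add: sign_avg_divide sign_avg_add)
  qed
  finally show ?thesis by (simp add: L_def P_def[abs_def])
qed

definition sign_row :: "nat \<Rightarrow> (nat \<Rightarrow> real) \<Rightarrow> (nat \<times> nat) set \<Rightarrow> nat \<Rightarrow> real"
  where "sign_row m x A i = (\<Sum>j<m. x j * rsign A (i, j))"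

lemma sign_row_eq: "sign_row m x A i = (\<Sum>p\<in>{i} \<times> {..<m}. x (snd p) * rsign A p)"
proof -
  have "{i} \<times> {..<m} = Pair i ` {..<m}" by auto
  then show ?thesis by (simp add: sign_row_def sum.reindex inj_on_def)
qed

text \<open>Induction over the rows. With the other rows fixed, their contribution is part of
  \<open>a\<close> and \<open>abs_linear_symmetrization\<close> treats row \<open>n\<close>; after
  swapping the averages the new linear term joins \<open>a\<close> for the induction hypothesis,
  which is why \<open>a\<close> is arbitrary. The factor 2 in front of \<open>\<mu>\<close> is the
  loss in \<open>khintchine_lower\<close>.\<close>

lemma rows_symmetrization:
  fixes a :: "(nat \<Rightarrow> real) \<Rightarrow> real"
  assumes F: "finite F" "F \<noteq> {}"
    and \<mu>: "\<And>x. x \<in> F \<Longrightarrow> 2 * \<mu> \<le> sqrt (\<Sum>j<m. (x j)\<^sup>2)"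
  shows "sign_avg ({..<n} \<times> {..<m}) (\<lambda>A. MAX x\<in>F. a x + (\<Sum>i<n. \<mu> - \<bar>sign_row m x A i\<bar>))
    \<le> sign_avg ({..<n} \<times> {..<m}) (\<lambda>A. MAX x\<in>F. a x + (\<Sum>i<n. 2 * sign_row m x A i))"
proof (induction n arbitrary: a)
  case 0
  then show ?case by simp
next
  case (Suc n)
  define I where "I = {..<n} \<times> {..<m}"
  define J where "J = {n} \<times> {..<m}"
  have IJ: "{..<Suc n} \<times> {..<m} = I \<union> J" "I \<inter> J = {}" "finite I" "finite J"
    by (auto simp: I_def J_def less_Suc_eq)
  have RI: "sign_row m x (A \<union> B) i = sign_row m x A i" if "B \<subseteq> J" "i < n" for x A B i
    using that unfolding sign_row_def by (intro sum.cong) (auto simp: rsign_def J_def)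
  have RJ: "sign_row m x (A \<union> B) n = sign_row m x B n" if "A \<subseteq> I" for x A B
    using that unfolding sign_row_def by (intro sum.cong) (auto simp: rsign_def I_def)
  have \<mu>': "\<mu> \<le> sign_avg J (\<lambda>B. \<bar>\<Sum>p\<in>J. x (snd p) * rsign B p\<bar>)" if "x \<in> F" for x
  proof -
    have "(\<Sum>p\<in>J. (x (snd p))\<^sup>2) = (\<Sum>j<m. (x j)\<^sup>2)"
      unfolding J_def
      by (rule sum.reindex_bij_witness[of _ "\<lambda>j. (n, j)" snd]) auto
    then show ?thesis
      using \<mu>[OF that] khintchine_lower[OF IJ(4), of "\<lambda>p. x (snd p)"] by simp
  qed
  have "sign_avg ({..<Suc n} \<times> {..<m}) (\<lambda>A. MAX x\<in>F. a x + (\<Sum>i<Suc n. \<mu> - \<bar>sign_row m x A i\<bar>))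
      = sign_avg I (\<lambda>A. sign_avg J (\<lambda>B. MAX x\<in>F.
          a x + (\<Sum>i<n. \<mu> - \<bar>sign_row m x A i\<bar>) + (\<mu> - \<bar>sign_row m x B n\<bar>)))"
    unfolding IJ(1) sign_avg_union[OF IJ(3,4,2)]
    by (intro sign_avg_cong) (simp add: RI RJ add_ac)
  also have "\<dots> \<le> sign_avg I (\<lambda>A. sign_avg J (\<lambda>B. MAX x\<in>F.
          a x + (\<Sum>i<n. \<mu> - \<bar>sign_row m x A i\<bar>) + 2 * sign_row m x B n))"
    unfolding sign_row_eq[of m _ _ n, folded J_def]
    by (intro sign_avg_mono abs_linear_symmetrization IJ F \<mu>')
  also have "\<dots> = sign_avg J (\<lambda>B. sign_avg I (\<lambda>A. MAX x\<in>F.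
          a x + 2 * sign_row m x B n + (\<Sum>i<n. \<mu> - \<bar>sign_row m x A i\<bar>)))"
    by (subst sign_avg_swap) (simp add: add_ac)
  also have "\<dots> \<le> sign_avg J (\<lambda>B. sign_avg I (\<lambda>A. MAX x\<in>F.
          a x + 2 * sign_row m x B n + (\<Sum>i<n. 2 * sign_row m x A i)))"
    unfolding I_def by (intro sign_avg_mono Suc.IH)
  also have "\<dots> = sign_avg I (\<lambda>A. sign_avg J (\<lambda>B. MAX x\<in>F.
          a x + (\<Sum>i<Suc n. 2 * sign_row m x (A \<union> B) i)))"
    by (subst sign_avg_swap, intro sign_avg_cong) (simp add: RI RJ add_ac)
  also have "\<dots> = sign_avg ({..<Suc n} \<times> {..<m}) (\<lambda>A. MAX x\<in>F. a x + (\<Sum>i<Suc n. 2 * sign_row m x A i))"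
    unfolding IJ(1) sign_avg_union[OF IJ(3,4,2)] ..
  finally show ?case .
qed

lemma young_sum:
  fixes p q :: real
  assumes "p > 1" "q > 1" "1 / p + 1 / q = 1" "a \<ge> 0" "b \<ge> 0"
  shows "a * b \<le> a powr p + b powr q"
proof -
  have "a powr p / p \<le> a powr p / 1" "b powr q / q \<le> b powr q / 1"
    using assms by (intro divide_left_mono; simp)+
  then show ?thesis using Youngs_inequality[of p q a b] assms by linarith
qed

text \<open>This is \<open>4 * (C + 1) + 1\<close> for the Khintchine constant
  \<open>C = 2 * exp 1 * q powr q\<close>; the final 1 makes the contradiction in
  \<open>exists_sign_matrix_kernel\<close> strict.\<close>

definition width_const :: "real \<Rightarrow> real"
  where "width_const q = 8 * exp 1 * q powr q + 5"

lemma width_const_pos: "width_const q > 0"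
  by (simp add: width_const_def add_nonneg_pos)

text \<open>If every sign matrix \<open>A\<close> had a bad kernel vector \<open>f A\<close>, then \<open>rows_symmetrization\<close> over the finite
  set of all \<open>f A\<close> would give a contradiction: on the left the rows vanish at \<open>f A\<close>, on the right the
  maximum is bounded by the mean \<open>l\<^sub>q\<close>-norm of the sum of the rows.\<close>

lemma exists_sign_matrix_kernel:
  fixes q q' :: real
  assumes q: "q > 1" "q' > 1" "1 / q + 1 / q' = 1" and n: "n > 0" "m > 0"
  shows "\<exists>A\<subseteq>{..<n} \<times> {..<m}. \<forall>x. (\<forall>i<n. sign_row m x A i = 0) \<and> (\<Sum>j<m. \<bar>x j\<bar> powr q') \<le> 1
    \<longrightarrow> sqrt (\<Sum>j<m. (x j)\<^sup>2) \<le> width_const q * (real n powr (-1/2) * real m powr (1 / q))"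
proof (rule ccontr)
  define I where "I = {..<n} \<times> {..<m}"
  define s where "s = width_const q * (real n powr (-1/2) * real m powr (1 / q))"
  assume "\<not> ?thesis"
  then have "\<forall>A. \<exists>x. A \<subseteq> I \<longrightarrow> (\<forall>i<n. sign_row m x A i = 0) \<and> (\<Sum>j<m. \<bar>x j\<bar> powr q') \<le> 1
      \<and> s < sqrt (\<Sum>j<m. (x j)\<^sup>2)"
    unfolding s_def I_def by (metis linorder_not_le)
  then obtain f where f: "\<And>A i. A \<subseteq> I \<Longrightarrow> i < n \<Longrightarrow> sign_row m (f A) A i = 0"
      "\<And>A. A \<subseteq> I \<Longrightarrow> (\<Sum>j<m. \<bar>f A j\<bar> powr q') \<le> 1"
      "\<And>A. A \<subseteq> I \<Longrightarrow> s < sqrt (\<Sum>j<m. (f A j)\<^sup>2)"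
    by metis
  define F where "F = f ` Pow I"
  define C where "C = 2 * exp 1 * q powr q"
  \<comment> \<open>\<open>\<beta>\<close> is the order of the \<open>l_q\<close>-norm of the vector
    \<open>Y A\<close> of column sums: each column sum has size about \<open>sqrt n\<close>.\<close>
  define \<beta> where "\<beta> = real m powr (1 / q) * sqrt (real n)"
  define Y where "Y A j = (\<Sum>i<n. rsign A (i, j))" for A and j :: nat
  have I: "finite I" by (simp add: I_def)
  have F: "finite F" "F \<noteq> {}" using I by (auto simp: F_def)
  have \<beta>: "\<beta> > 0" using n by (simp add: \<beta>_def)
  have \<beta>q: "\<beta> powr q = real m * real n powr (q / 2)"
    using n q by (simp add: \<beta>_def powr_mult powr_powr powr_half_sqrt[symmetric])
  have "real n * (s / 2) = sign_avg I (\<lambda>A. real n * (s / 2))"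
    using I by (simp add: sign_avg_const)
  also have "\<dots> \<le> sign_avg I (\<lambda>A. MAX x\<in>F. 0 + (\<Sum>i<n. s / 2 - \<bar>sign_row m x A i\<bar>))"
  proof (rule sign_avg_mono)
    fix A assume A: "A \<subseteq> I"
    have "0 + (\<Sum>i<n. s / 2 - \<bar>sign_row m (f A) A i\<bar>)
        \<le> (MAX x\<in>F. 0 + (\<Sum>i<n. s / 2 - \<bar>sign_row m x A i\<bar>))"
      using F A by (intro Max_ge) (auto simp: F_def)
    then show "real n * (s / 2) \<le> (MAX x\<in>F. 0 + (\<Sum>i<n. s / 2 - \<bar>sign_row m x A i\<bar>))"
      using f(1)[OF A] by simp
  qed
  also have "\<dots> \<le> sign_avg I (\<lambda>A. MAX x\<in>F. 0 + (\<Sum>i<n. 2 * sign_row m x A i))"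
    unfolding I_def
  proof (rule rows_symmetrization[OF F])
    show "2 * (s / 2) \<le> sqrt (\<Sum>j<m. (x j)\<^sup>2)" if "x \<in> F" for x
      using that f(3) by (auto simp: F_def intro: less_imp_le)
  qed
  also have "\<dots> \<le> sign_avg I (\<lambda>A. 2 * \<beta> * (1 / \<beta> powr q * (\<Sum>j<m. \<bar>Y A j\<bar> powr q) + 1))"
  proof (rule sign_avg_mono, rule MAX_le[OF F])
    fix A x assume x: "x \<in> F"
    have "(\<Sum>i<n. 2 * sign_row m x A i) = 2 * \<beta> * (\<Sum>j<m. Y A j / \<beta> * x j)"
    proof -
      have "(\<Sum>i<n. sign_row m x A i) = (\<Sum>j<m. Y A j * x j)"
        unfolding sign_row_def Y_def sum_distrib_right by (subst sum.swap) (simp add: mult.commute)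
      moreover have "2 * \<beta> * (\<Sum>j<m. Y A j / \<beta> * x j) = 2 * (\<Sum>j<m. Y A j * x j)"
        unfolding sum_distrib_left using \<beta> by (intro sum.cong) auto
      ultimately show ?thesis by (simp flip: sum_distrib_left)
    qed
    \<comment> \<open>Young's inequality at scale \<open>\<beta>\<close> leaves \<open>Y\<close> to
      the power \<open>q\<close>, whose average Khintchine's inequality bounds directly; the
      \<open>q'\<close>-sum of \<open>x\<close> is at most 1.\<close>
    also have "\<dots> \<le> 2 * \<beta> * (\<Sum>j<m. 1 / \<beta> powr q * \<bar>Y A j\<bar> powr q + \<bar>x j\<bar> powr q')"
    proof (intro mult_left_mono sum_mono)
      fix j
      have "Y A j / \<beta> * x j \<le> \<bar>Y A j / \<beta>\<bar> * \<bar>x j\<bar>" by (metis abs_ge_self abs_mult)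
      also have "\<dots> \<le> \<bar>Y A j / \<beta>\<bar> powr q + \<bar>x j\<bar> powr q'"
        using q by (intro young_sum) auto
      finally show "Y A j / \<beta> * x j \<le> 1 / \<beta> powr q * \<bar>Y A j\<bar> powr q + \<bar>x j\<bar> powr q'"
        using \<beta> by (simp add: abs_divide powr_divide)
    qed (use \<beta> in auto)
    also have "\<dots> \<le> 2 * \<beta> * (1 / \<beta> powr q * (\<Sum>j<m. \<bar>Y A j\<bar> powr q) + 1)"
      unfolding sum.distrib sum_distrib_left[symmetric]
      using \<beta> x f(2) by (intro mult_left_mono add_mono) (auto simp: F_def)
    finally show "0 + (\<Sum>i<n. 2 * sign_row m x A i)
        \<le> 2 * \<beta> * (1 / \<beta> powr q * (\<Sum>j<m. \<bar>Y A j\<bar> powr q) + 1)" by simp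
  qed
  also have "\<dots> = 2 * \<beta> * (1 / \<beta> powr q * (\<Sum>j<m. sign_avg I (\<lambda>A. \<bar>Y A j\<bar> powr q)) + 1)"
    using I by (simp only: sign_avg_cmult sign_avg_add sign_avg_sum sign_avg_const)
  also have "\<dots> \<le> 2 * \<beta> * (1 / \<beta> powr q * (\<Sum>j<m. C * real n powr (q / 2)) + 1)"
  proof (intro mult_left_mono add_mono sum_mono)
    fix j assume j: "j \<in> {..<m}"
    define a :: "nat \<times> nat \<Rightarrow> real" where "a p = (if snd p = j then 1 else 0)" for p
    have "(\<Sum>p\<in>I. a p * rsign A p) = Y A j" for A
    proof -
      have "(\<Sum>p\<in>I. a p * rsign A p) = (\<Sum>i<n. \<Sum>k<m. (if k = j then rsign A (i, k) else 0))"
        unfolding I_def a_def by (subst sum.cartesian_product) (auto intro!: sum.cong)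
      also have "\<dots> = Y A j" using j by (simp add: Y_def sum.delta')
      finally show ?thesis .
    qed
    moreover have "(\<Sum>p\<in>I. (a p)\<^sup>2) = real n"
    proof -
      have "(\<Sum>p\<in>I. (a p)\<^sup>2) = (\<Sum>i<n. \<Sum>k<m. (if k = j then 1 else 0))"
        unfolding I_def a_def by (subst sum.cartesian_product) (auto intro!: sum.cong)
      also have "\<dots> = real n" using j by simp
      finally show ?thesis .
    qed
    ultimately show "sign_avg I (\<lambda>A. \<bar>Y A j\<bar> powr q) \<le> C * real n powr (q / 2)"
      using khintchine_upper[OF I, of q a] q by (simp add: C_def)
  qed (use \<beta> in auto)
  also have "\<dots> = 2 * \<beta> * (C + 1)"
    using n by (simp add: \<beta>q)
  finally have "real n * s \<le> 4 * (C + 1) * \<beta>" by (simp add: algebra_simps)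
  moreover have "real n * s = (4 * (C + 1) + 1) * \<beta>"
  proof -
    have *: "real n * real n powr (-1/2) = sqrt (real n)"
      using n by (simp add: powr_minus powr_half_sqrt field_simps)
    have "real n * s = width_const q * real m powr (1 / q) * (real n * real n powr (-1/2))"
      by (simp only: s_def mult_ac)
    then show ?thesis unfolding * by (simp add: \<beta>_def C_def width_const_def algebra_simps)
  qed
  ultimately show False using \<beta> by simp
qed

section \<open>Orthogonal projections and duality\<close>

abbreviation coord :: "(nat \<Rightarrow>\<^sub>0 real) \<Rightarrow> nat \<Rightarrow> real"
  where "coord \<equiv> Poly_Mapping.lookup"

definition vec_of :: "nat \<Rightarrow> (nat \<Rightarrow> real) \<Rightarrow> nat \<Rightarrow>\<^sub>0 real"
  where "vec_of m f = Abs_poly_mapping (\<lambda>j. if j < m then f j else 0)"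

lemma coord_vec_of: "coord (vec_of m f) j = (if j < m then f j else 0)"
proof -
  have "finite {j. (if j < m then f j else 0) \<noteq> 0}"
    by (rule finite_subset[of _ "{..<m}"]) auto
  then show ?thesis unfolding vec_of_def by simp
qed

lemma coord_scaleR: "coord (c *\<^sub>R x) j = c * coord x j"
proof -
  have "finite {j. c *\<^sub>R coord x j \<noteq> 0}"
    by (rule finite_subset[OF _ finite_lookup[of x]]) auto
  then show ?thesis unfolding scaleR_poly_mapping_def by simp
qed

lemmas coord_simps = coord_vec_of coord_scaleR lookup_add lookup_minus

lemma Rn_iff: "x \<in> Rn m \<longleftrightarrow> (\<forall>j\<ge>m. coord x j = 0)"
  unfolding Rn_def by (auto simp: in_keys_iff subset_iff not_less[symmetric])

lemma vec_of_in_Rn: "vec_of m f \<in> Rn m"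
  by (simp add: Rn_iff coord_vec_of)

lemma subspace_Rn: "subspace (Rn m)"
  by (auto simp: subspace_def Rn_iff coord_simps)

lemma Rn_eqI: "x \<in> Rn m \<Longrightarrow> y \<in> Rn m \<Longrightarrow> (\<And>j. j < m \<Longrightarrow> coord x j = coord y j) \<Longrightarrow> x = y"
  by (rule poly_mapping_eqI) (metis Rn_iff not_less)

text \<open>Kept as a matrix rather than an operator because the lower bounds use its entries:
  trace, diagonal and row norms.\<close>

definition orth_proj :: "nat \<Rightarrow> (nat \<Rightarrow> nat \<Rightarrow> real) \<Rightarrow> (nat \<Rightarrow>\<^sub>0 real) set \<Rightarrow> bool"
  where "orth_proj m P L \<longleftrightarrow>
    (\<forall>i j. P i j = P j i) \<and>
    (\<forall>i<m. \<forall>j<m. (\<Sum>l<m. P i l * P l j) = P i j) \<and>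
    (\<forall>y\<in>L. \<forall>i<m. (\<Sum>j<m. P i j * coord y j) = coord y i) \<and>
    (\<forall>f. vec_of m (\<lambda>i. \<Sum>j<m. P i j * f j) \<in> L)"

lemma
  assumes "orth_proj m P L"
  shows orth_proj_sym: "P i j = P j i"
    and orth_proj_square: "i < m \<Longrightarrow> j < m \<Longrightarrow> (\<Sum>l<m. P i l * P l j) = P i j"
    and orth_proj_fix: "y \<in> L \<Longrightarrow> i < m \<Longrightarrow> (\<Sum>j<m. P i j * coord y j) = coord y i"
    and orth_proj_range: "vec_of m (\<lambda>i. \<Sum>j<m. P i j * f j) \<in> L"
  using assms unfolding orth_proj_def by blast+

lemma orth_proj_idem:
  assumes "orth_proj m P L" "i < m"
  shows "(\<Sum>l<m. P i l * (\<Sum>j<m. P l j * f j)) = (\<Sum>j<m. P i j * f j)"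
proof -
  have "(\<Sum>l<m. P i l * (\<Sum>j<m. P l j * f j)) = (\<Sum>j<m. (\<Sum>l<m. P i l * P l j) * f j)"
    unfolding sum_distrib_left sum_distrib_right by (subst sum.swap) (simp add: mult_ac)
  also have "\<dots> = (\<Sum>j<m. P i j * f j)"
    by (intro sum.cong) (simp_all add: orth_proj_square[OF assms])
  finally show ?thesis .
qed

lemma orth_proj_self_adjoint:
  assumes "orth_proj m P L"
  shows "(\<Sum>i<m. g i * (\<Sum>j<m. P i j * f j)) = (\<Sum>i<m. (\<Sum>j<m. P i j * g j) * f i)"
proof -
  have s: "P i j = P j i" for i j by (rule orth_proj_sym[OF assms])
  have "(\<Sum>i<m. g i * (\<Sum>j<m. P i j * f j)) = (\<Sum>j<m. \<Sum>i<m. g i * (P i j * f j))"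
    unfolding sum_distrib_left by (rule sum.swap)
  also have "\<dots> = (\<Sum>i<m. (\<Sum>j<m. P i j * g j) * f i)"
    unfolding sum_distrib_right by (intro sum.cong) (auto simp: s)
  finally show ?thesis .
qed

lemma orth_proj_residual:
  assumes "orth_proj m P L" "y \<in> L"
  shows "(\<Sum>i<m. (f i - (\<Sum>j<m. P i j * f j)) * coord y i) = 0"
proof -
  have "(\<Sum>i<m. (\<Sum>j<m. P i j * f j) * coord y i) = (\<Sum>i<m. f i * (\<Sum>j<m. P i j * coord y j))"
    by (rule orth_proj_self_adjoint[OF assms(1), symmetric])
  also have "\<dots> = (\<Sum>i<m. f i * coord y i)"
    by (intro sum.cong) (simp_all add: orth_proj_fix[OF assms])
  finally show ?thesis by (simp add: left_diff_distrib sum_subtractf)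
qed

text \<open>Gram-Schmidt step: \<open>w\<close> is the residual of \<open>b\<close>, and the
  rank-one projection onto its line is added.\<close>

lemma orth_proj_extend:
  assumes P: "orth_proj m P (span B)" and N: "N \<noteq> 0"
    and w: "\<And>i. w i = coord b i - (\<Sum>j<m. P i j * coord b j)"
    and N_def: "N = (\<Sum>i<m. (w i)\<^sup>2)" and b: "b \<in> Rn m"
  shows "orth_proj m (\<lambda>i j. P i j + w i * w j / N) (span (insert b B))"
proof -
  have s: "P i j = P j i" for i j by (rule orth_proj_sym[OF P])
  have Pw: "(\<Sum>j<m. P i j * w j) = 0" if "i < m" for i
    using orth_proj_idem[OF P that, of "coord b"]
    by (simp add: w right_diff_distrib sum_subtractf)
  have wP: "(\<Sum>j<m. w j * P j i) = 0" if "i < m" for i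
    using Pw[OF that] by (simp add: s mult.commute)
  have ww: "(\<Sum>j<m. w j * w j) = N" by (simp add: N_def power2_eq_square)
  have wz: "(\<Sum>j<m. w j * coord z j) = 0" if "z \<in> span B" for z
    using orth_proj_residual[OF P that, of "coord b"] by (simp add: w)
  have wb: "(\<Sum>j<m. w j * coord b j) = N"
  proof -
    have "(\<Sum>j<m. w j * coord b j) = (\<Sum>j<m. w j * w j + w j * (\<Sum>l<m. P j l * coord b l))"
      by (intro sum.cong refl) (simp add: w algebra_simps)
    also have "\<dots> = N + (\<Sum>i<m. (\<Sum>j<m. P i j * w j) * coord b i)"
      unfolding sum.distrib ww orth_proj_self_adjoint[OF P] ..
    also have "\<dots> = N" by (simp add: Pw)
    finally show ?thesis .
  qed
  have app: "(\<Sum>j<m. (P i j + w i * w j / N) * f j)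
      = (\<Sum>j<m. P i j * f j) + w i / N * (\<Sum>j<m. w j * f j)" for i f
    unfolding sum_distrib_left sum.distrib[symmetric] by (intro sum.cong) (auto simp: distrib_right)
  show ?thesis
    unfolding orth_proj_def
  proof (intro conjI allI impI ballI)
    fix i j show "P i j + w i * w j / N = P j i + w j * w i / N" using s by simp
  next
    fix i j assume ij: "i < m" "j < m"
    have "(\<Sum>l<m. (P i l + w i * w l / N) * (P l j + w l * w j / N))
        = (\<Sum>l<m. P i l * (P l j + w l * w j / N)) + w i / N * (\<Sum>l<m. w l * (P l j + w l * w j / N))"
      by (rule app)
    also have "(\<Sum>l<m. P i l * (P l j + w l * w j / N)) = P i j + (\<Sum>l<m. P i l * w l) * (w j / N)"
      unfolding sum_distrib_right orth_proj_square[OF P ij, symmetric] sum.distrib[symmetric]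
      by (intro sum.cong) (simp_all add: distrib_left)
    also have "(\<Sum>l<m. w l * (P l j + w l * w j / N)) = (\<Sum>l<m. w l * P l j) + (\<Sum>l<m. w l * w l) * (w j / N)"
      unfolding sum_distrib_right sum.distrib[symmetric]
      by (intro sum.cong) (simp_all add: distrib_left)
    finally show "(\<Sum>l<m. (P i l + w i * w l / N) * (P l j + w l * w j / N)) = P i j + w i * w j / N"
      using N by (simp add: Pw[OF ij(1)] wP[OF ij(2)] ww)
  next
    fix y i assume y: "y \<in> span (insert b B)" and i: "i < m"
    obtain k where z: "y - k *\<^sub>R b \<in> span B" using y unfolding span_breakdown_eq by blast
    define z where "z = y - k *\<^sub>R b"
    have yz: "coord y j = k * coord b j + coord z j" for j by (simp add: z_def coord_simps)
    have "(\<Sum>j<m. w j * coord y j) = k * (\<Sum>j<m. w j * coord b j) + (\<Sum>j<m. w j * coord z j)"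
      by (simp add: yz distrib_left sum.distrib sum_distrib_left mult_ac)
    then have 1: "(\<Sum>j<m. w j * coord y j) = k * N" using wb wz z by (simp add: z_def)
    have "(\<Sum>j<m. P i j * coord y j) = k * (\<Sum>j<m. P i j * coord b j) + (\<Sum>j<m. P i j * coord z j)"
      by (simp add: yz distrib_left sum.distrib sum_distrib_left mult_ac)
    moreover have "(\<Sum>j<m. P i j * coord z j) = coord z i"
      using orth_proj_fix[OF P _ i] z by (simp add: z_def)
    ultimately show "(\<Sum>j<m. (P i j + w i * w j / N) * coord y j) = coord y i"
      unfolding app 1 using N by (simp add: yz w) (simp add: algebra_simps)
  next
    fix f
    have "vec_of m (\<lambda>i. \<Sum>j<m. (P i j + w i * w j / N) * f j)
      = vec_of m (\<lambda>i. \<Sum>j<m. P i j * f j)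
        + ((\<Sum>j<m. w j * f j) / N) *\<^sub>R (b - vec_of m (\<lambda>i. \<Sum>j<m. P i j * coord b j))"
      using b by (intro poly_mapping_eqI) (auto simp: coord_simps app Rn_iff simp flip: w)
    moreover have "vec_of m (\<lambda>i. \<Sum>j<m. P i j * g j) \<in> span (insert b B)" for g
      using orth_proj_range[OF P] span_mono[of B "insert b B"] by blast
    ultimately show "vec_of m (\<lambda>i. \<Sum>j<m. (P i j + w i * w j / N) * f j) \<in> span (insert b B)"
      using span_base[of b "insert b B"] by (simp add: span_add span_scale span_diff)
  qed
qed

text \<open>Each vector outside the span of the previous ones adds exactly
  \<open>(\<Sum>i<m. (w i)^2) / N = 1\<close> to the trace; redundant vectors add nothing.\<close>

lemma orth_proj_exists:
  assumes "finite B" "B \<subseteq> Rn m"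
  shows "\<exists>P. orth_proj m P (span B) \<and> (\<Sum>i<m. P i i) \<le> real (card B)"
  using assms
proof (induction B rule: finite_induct)
  case empty
  have "vec_of m (\<lambda>i. 0) = 0" by (rule poly_mapping_eqI) (simp add: coord_simps)
  then show ?case
    by (intro exI[of _ "\<lambda>i j. 0"]) (auto simp: orth_proj_def)
next
  case (insert b B)
  then obtain P where P: "orth_proj m P (span B)" "(\<Sum>i<m. P i i) \<le> real (card B)" by auto
  define w where "w i = coord b i - (\<Sum>j<m. P i j * coord b j)" for i
  define N where "N = (\<Sum>i<m. (w i)\<^sup>2)"
  have b: "b \<in> Rn m" using insert by simp
  show ?case
  proof (cases "N = 0")
    case True
    then have "w i = 0" if "i < m" for i using that by (simp add: N_def sum_nonneg_eq_0_iff)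
    then have "b = vec_of m (\<lambda>i. \<Sum>j<m. P i j * coord b j)"
      using b by (intro Rn_eqI[of _ m]) (auto simp: vec_of_in_Rn coord_simps w_def)
    then have "b \<in> span B" using orth_proj_range[OF P(1), of "coord b"] by (simp only:)
    then show ?thesis using P insert by (intro exI[of _ P]) (auto simp: span_redundant)
  next
    case False
    have "(\<Sum>i<m. P i i + w i * w i / N) = (\<Sum>i<m. P i i) + (\<Sum>i<m. (w i)\<^sup>2) / N"
      by (simp add: sum.distrib sum_divide_distrib power2_eq_square)
    then have "(\<Sum>i<m. P i i + w i * w i / N) \<le> real (card (insert b B))"
      using P(2) insert False by (simp flip: N_def)
    then show ?thesis
      using orth_proj_extend[OF P(1) False w_def N_def b] by blast
  qed
qed

section \<open>Best approximation and duality in \<open>l_q\<close>\<close>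

lemma has_real_derivative_abs_powr:
  fixes q t :: real
  assumes "q > 1"
  shows "((\<lambda>t. \<bar>t\<bar> powr q) has_real_derivative q * \<bar>t\<bar> powr (q - 1) * sgn t) (at t)"
proof (cases "t = 0")
  case True
  \<comment> \<open>The difference quotient at 0 has modulus \<open>|h|^(q-1)\<close>, which tends
    to 0 because \<open>q > 1\<close>; stationarity below needs the derivative at vanishing
    coordinates as well.\<close>
  have "((\<lambda>h. \<bar>h\<bar> powr (q - 1)) \<longlongrightarrow> \<bar>0::real\<bar> powr (q - 1)) (at 0)"
    using assms by (intro tendsto_powr' tendsto_intros) auto
  then have *: "((\<lambda>h. \<bar>h::real\<bar> powr (q - 1)) \<longlongrightarrow> 0) (at 0)" using assms by simp
  have "((\<lambda>h. \<bar>h\<bar> powr q / h) \<longlongrightarrow> (0::real)) (at 0)"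
  proof (rule Lim_null_comparison[OF _ *], rule always_eventually, intro allI)
    fix h :: real
    have "\<bar>h\<bar> powr q = \<bar>h\<bar> powr (q - 1) * \<bar>h\<bar>" if "h \<noteq> 0"
      using that powr_add[of "\<bar>h\<bar>" "q - 1" 1] by simp
    then show "norm (\<bar>h\<bar> powr q / h) \<le> \<bar>h\<bar> powr (q - 1)"
      by (cases "h = 0") (simp_all add: abs_divide)
  qed
  then show ?thesis using True assms by (simp add: has_field_derivative_iff)
next
  case False
  show ?thesis
  proof (cases "t > 0")
    case True
    have "((\<lambda>t. t powr q) has_real_derivative q * t powr (q - 1)) (at t)"
      using True by (auto intro!: derivative_eq_intros)
    moreover have "eventually (\<lambda>t. t powr q = \<bar>t\<bar> powr q) (nhds t)"
      using eventually_nhds_in_open[of "{0<..}" t] True by (auto elim!: eventually_mono)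
    ultimately show ?thesis using True by (subst (asm) DERIV_cong_ev[OF refl _ refl]) auto
  next
    case F: False
    have "((\<lambda>t. (- t) powr q) has_real_derivative - (q * (- t) powr (q - 1))) (at t)"
      using F False by (auto intro!: derivative_eq_intros)
    moreover have "eventually (\<lambda>t. (- t) powr q = \<bar>t\<bar> powr q) (nhds t)"
      using eventually_nhds_in_open[of "{..<0}" t] F False by (auto elim!: eventually_mono)
    ultimately show ?thesis using F False by (subst (asm) DERIV_cong_ev[OF refl _ refl]) auto
  qed
qed

text \<open>Tychonoff's theorem; the minimization below runs over coordinate functions with the
  product topology.\<close>

lemma compact_box_fun:
  fixes S :: "'i \<Rightarrow> real set"
  assumes "\<And>i. compact (S i)"
  shows "compact (PiE UNIV S)"
  using compactin_PiE[of "\<lambda>i. euclidean" UNIV S] assms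
  by (simp add: euclidean_product_topology)

text \<open>A minimizer exists by compactness, and the derivative of the q-th power sum vanishes
  there in every direction \<open>h\<close> of \<open>L\<close>.\<close>

lemma lq_best_approximation:
  fixes q :: real
  assumes P: "orth_proj m P L" and L: "subspace L" and x: "x \<in> Rn m" and q: "q > 1"
  shows "\<exists>y\<in>L. \<forall>h\<in>L. (\<Sum>j<m. \<bar>coord x j - coord y j\<bar> powr (q - 1) * sgn (coord x j - coord y j) * coord h j) = 0"
proof -
  define \<Phi> :: "(nat \<Rightarrow> real) \<Rightarrow> real" where "\<Phi> u = (\<Sum>j<m. \<bar>u j\<bar> powr q)" for u
  define R where "R = \<Phi> (coord x) powr (1 / q)"
  define B where "B = PiE UNIV (\<lambda>j. if j < m then cball 0 R else {0::real})"
  \<comment> \<open>The variable is the residual \<open>u\<close>. That \<open>x - u\<close> lies in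
    \<open>L\<close> is expressed by the closed condition that the projection fixes it.\<close>
  define A where "A = (\<Inter>i\<in>{..<m}. {u. (\<Sum>j<m. P i j * (coord x j - u j)) = coord x i - u i})"
  have \<Phi>0: "\<Phi> u \<ge> 0" for u by (simp add: \<Phi>_def sum_nonneg)
  have box: "\<bar>u j\<bar> \<le> R" if "\<Phi> u \<le> \<Phi> (coord x)" "j < m" for u j
  proof -
    have "\<bar>u j\<bar> powr q \<le> \<Phi> u" unfolding \<Phi>_def using that by (intro member_le_sum) auto
    then have "(\<bar>u j\<bar> powr q) powr (1 / q) \<le> R"
      unfolding R_def using that q by (intro powr_mono2) auto
    then show ?thesis using q by (simp add: powr_powr)
  qed
  have "compact B" unfolding B_def by (intro compact_box_fun) auto
  moreover have "closed A" unfolding A_def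
    by (intro closed_INT ballI closed_Collect_eq continuous_intros continuous_on_product_coordinates)
  ultimately have "compact (B \<inter> A)" by (rule compact_Int_closed)
  moreover have xm: "coord x \<in> B \<inter> A"
    using x box[of "coord x"] by (auto simp: B_def A_def Rn_iff PiE_def Pi_def)
  moreover have "continuous_on (B \<inter> A) \<Phi>" unfolding \<Phi>_def
    by (intro continuous_intros continuous_on_powr' continuous_on_rabs
          continuous_on_subset[OF continuous_on_product_coordinates]) (use q in auto)
  ultimately obtain u where u: "u \<in> B \<inter> A" "\<And>v. v \<in> B \<inter> A \<Longrightarrow> \<Phi> u \<le> \<Phi> v"
    using continuous_attains_inf[of "B \<inter> A" \<Phi>] by blast
  define y where "y = vec_of m (\<lambda>i. \<Sum>j<m. P i j * (coord x j - u j))"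
  have y: "y \<in> L" unfolding y_def by (rule orth_proj_range[OF P])
  have yu: "coord x j - coord y j = u j" if "j < m" for j
    using u(1) that by (simp add: y_def coord_simps A_def)
  have "(\<Sum>j<m. \<bar>u j\<bar> powr (q - 1) * sgn (u j) * coord h j) = 0" if h: "h \<in> L" for h
  proof -
    \<comment> \<open>A competitor with a larger sum than \<open>x\<close> may leave the box, but
      then comparing \<open>u\<close> with \<open>x\<close> itself suffices.\<close>
    have min: "\<Phi> u \<le> \<Phi> (\<lambda>j. u j + t * coord h j)" for t
    proof (cases "\<Phi> (\<lambda>j. u j + t * coord h j) \<le> \<Phi> (coord x)")
      case True
      \<comment> \<open>The box contains only 0 in the coordinates from \<open>m\<close> on, so the
        perturbation is cut off there.\<close>
      define v where "v j = (if j < m then u j + t * coord h j else 0)" for j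
      have "\<Phi> v = \<Phi> (\<lambda>j. u j + t * coord h j)" by (simp add: \<Phi>_def v_def)
      moreover have "v \<in> B"
        using box[OF True] by (auto simp: v_def B_def PiE_def Pi_def)
      moreover have "v \<in> A"
        unfolding A_def
      proof (intro INT_I CollectI)
        fix i assume i: "i \<in> {..<m}"
        have "(\<Sum>j<m. P i j * (coord x j - v j))
            = (\<Sum>j<m. P i j * (coord x j - u j)) - t * (\<Sum>j<m. P i j * coord h j)"
          by (simp add: v_def algebra_simps sum.distrib sum_subtractf sum_distrib_left)
        also have "\<dots> = (coord x i - u i) - t * coord h i"
          using u(1) i orth_proj_fix[OF P h] by (simp add: A_def)
        finally show "(\<Sum>j<m. P i j * (coord x j - v j)) = coord x i - v i"
          using i by (simp add: v_def)
      qed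
      ultimately show ?thesis using u(2)[of v] by simp
    next
      case False
      then show ?thesis using u(2)[OF xm] by simp
    qed
    have "((\<lambda>t. \<Phi> (\<lambda>j. u j + t * coord h j)) has_real_derivative
        (\<Sum>j<m. q * \<bar>u j + 0 * coord h j\<bar> powr (q - 1) * sgn (u j + 0 * coord h j) * coord h j)) (at 0)"
      unfolding \<Phi>_def
      by (intro DERIV_sum DERIV_chain2[OF has_real_derivative_abs_powr[OF q]])
         (auto intro!: derivative_eq_intros)
    then have "(\<Sum>j<m. q * \<bar>u j + 0 * coord h j\<bar> powr (q - 1) * sgn (u j + 0 * coord h j) * coord h j) = 0"
      by (rule DERIV_local_min[of _ _ _ 1]) (use min in auto)
    then have "q * (\<Sum>j<m. \<bar>u j\<bar> powr (q - 1) * sgn (u j) * coord h j) = 0"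
      by (simp add: sum_distrib_left mult.assoc)
    then show ?thesis using q by simp
  qed
  then show ?thesis using y yu by (intro bexI[of _ y]) auto
qed

text \<open>The stationarity condition for the best approximation exhibits a norming functional of the residual
  that annihilates \<open>L\<close>, which makes the Hahn--Banach theorem unnecessary.\<close>

lemma lq_distance_le:
  fixes q q' s :: real
  assumes P: "orth_proj m P L" and L: "subspace L" and x: "x \<in> Rn m"
    and q: "q > 1" "q' > 1" "1 / q + 1 / q' = 1"
    and ker: "\<And>f. (\<And>h. h \<in> L \<Longrightarrow> (\<Sum>j<m. f j * coord h j) = 0)
      \<Longrightarrow> (\<Sum>j<m. \<bar>f j\<bar> powr q') \<le> 1 \<Longrightarrow> sqrt (\<Sum>j<m. (f j)\<^sup>2) \<le> s"
  shows "\<exists>y\<in>L. (\<Sum>j<m. \<bar>coord x j - coord y j\<bar> powr q) powr (1 / q) \<le> s * sqrt (\<Sum>j<m. (coord x j)\<^sup>2)"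
proof -
  obtain y where y: "y \<in> L"
    "\<And>h. h \<in> L \<Longrightarrow> (\<Sum>j<m. \<bar>coord x j - coord y j\<bar> powr (q - 1) * sgn (coord x j - coord y j) * coord h j) = 0"
    using lq_best_approximation[OF P L x q(1)] by blast
  define u where "u j = coord x j - coord y j" for j
  define U where "U = (\<Sum>j<m. \<bar>u j\<bar> powr q)"
  have U0: "U \<ge> 0" by (simp add: U_def sum_nonneg)
  have s0: "s \<ge> 0" using ker[of "\<lambda>_. 0"] by simp
  have "U powr (1 / q) \<le> s * sqrt (\<Sum>j<m. (coord x j)\<^sup>2)"
  proof (cases "U = 0")
    case True
    then show ?thesis using s0 by (simp add: sum_nonneg)
  next
    case False
    then have U: "U > 0" using U0 by simp
    have qq: "(q - 1) * q' = q" using q by (simp add: field_simps)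
    \<comment> \<open>The derivative of the power sum at the residual, normalized in
      \<open>l_q'\<close> by means of \<open>(q - 1) q' = q\<close>; its pairing with
      \<open>u\<close> is the \<open>l_q\<close>-norm of \<open>u\<close>.\<close>
    define f where "f j = \<bar>u j\<bar> powr (q - 1) * sgn (u j) / U powr (1 / q')" for j
    have f: "(\<Sum>j<m. f j * coord h j) = 0" if "h \<in> L" for h
    proof -
      have "(\<Sum>j<m. f j * coord h j) = (\<Sum>j<m. \<bar>u j\<bar> powr (q - 1) * sgn (u j) * coord h j) / U powr (1 / q')"
        unfolding sum_divide_distrib by (intro sum.cong) (auto simp: f_def)
      then show ?thesis using y(2)[OF that] by (simp add: u_def)
    qed
    have "\<bar>f j\<bar> powr q' = \<bar>u j\<bar> powr q / U" for j
    proof (cases "u j = 0")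
      case False
      then have "\<bar>f j\<bar> = \<bar>u j\<bar> powr (q - 1) / U powr (1 / q')"
        by (simp add: f_def abs_mult abs_divide abs_sgn_eq)
      then show ?thesis using q U by (simp add: powr_divide powr_powr qq)
    qed (simp add: f_def)
    then have "(\<Sum>j<m. \<bar>f j\<bar> powr q') = 1"
      using U by (simp add: U_def flip: sum_divide_distrib)
    then have fs: "sqrt (\<Sum>j<m. (f j)\<^sup>2) \<le> s" using ker[of f] f by simp
    have Ueq: "U = (\<Sum>j<m. \<bar>u j\<bar> powr (q - 1) * sgn (u j) * u j)"
      unfolding U_def
    proof (intro sum.cong refl)
      fix j
      show "\<bar>u j\<bar> powr q = \<bar>u j\<bar> powr (q - 1) * sgn (u j) * u j"
        using powr_add[of "\<bar>u j\<bar>" "q - 1" 1] by (simp add: mult.assoc abs_sgn[symmetric] mult.commute[of "sgn _"])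
    qed
    have "U powr (1 / q) = U / U powr (1 / q')"
    proof -
      have "U powr (1 / q) * U powr (1 / q') = U" using q U by (simp flip: powr_add)
      then show ?thesis using U by (simp add: field_simps)
    qed
    also have "\<dots> = (\<Sum>j<m. f j * u j)"
    proof -
      have "(\<Sum>j<m. f j * u j) = (\<Sum>j<m. \<bar>u j\<bar> powr (q - 1) * sgn (u j) * u j) / U powr (1 / q')"
        unfolding sum_divide_distrib by (intro sum.cong) (auto simp: f_def)
      then show ?thesis using Ueq by simp
    qed
    also have "\<dots> = (\<Sum>j<m. f j * coord x j)"
      using f[OF y(1)] by (simp add: u_def right_diff_distrib sum_subtractf)
    also have "\<dots> \<le> sqrt ((\<Sum>j<m. (f j)\<^sup>2) * (\<Sum>j<m. (coord x j)\<^sup>2))"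
      by (intro real_le_rsqrt Cauchy_Schwarz_ineq_sum)
    also have "\<dots> \<le> s * sqrt (\<Sum>j<m. (coord x j)\<^sup>2)"
      unfolding real_sqrt_mult by (intro mult_right_mono fs) (simp add: sum_nonneg)
    finally show ?thesis .
  qed
  then show ?thesis using y(1) by (auto simp: U_def u_def)
qed

definition subspace_of_dim :: "nat \<Rightarrow> nat \<Rightarrow> (nat \<Rightarrow>\<^sub>0 real) set \<Rightarrow> bool"
  where "subspace_of_dim m n L \<longleftrightarrow> subspace L \<and> L \<subseteq> Rn m \<and> (\<exists>B. finite B \<and> span B = L) \<and> dim L \<le> n"

text \<open>\<open>L\<close> is the row space of the matrix from
  \<open>exists_sign_matrix_kernel\<close>: it has at most \<open>n\<close> dimensions, and the
  functionals annihilating it are the kernel vectors.\<close>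

lemma exists_subspace_l2_lq:
  fixes q :: real
  assumes q: "q > 1" and n: "n > 0" "m > 0"
  shows "\<exists>L. subspace_of_dim m n L \<and> (\<forall>x\<in>Rn m. \<exists>y\<in>L.
    (\<Sum>j<m. \<bar>coord x j - coord y j\<bar> powr q) powr (1 / q)
      \<le> width_const q * (real n powr (-1/2) * real m powr (1 / q)) * sqrt (\<Sum>j<m. (coord x j)\<^sup>2))"
proof -
  define q' where "q' = q / (q - 1)"
  have q': "q' > 1" "1 / q + 1 / q' = 1" using q by (auto simp: q'_def field_simps)
  define s where "s = width_const q * (real n powr (-1/2) * real m powr (1 / q))"
  obtain A where A: "\<And>f. (\<And>i. i < n \<Longrightarrow> sign_row m f A i = 0) \<Longrightarrow> (\<Sum>j<m. \<bar>f j\<bar> powr q') \<le> 1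
      \<Longrightarrow> sqrt (\<Sum>j<m. (f j)\<^sup>2) \<le> s"
    using exists_sign_matrix_kernel[OF q q' n] unfolding s_def by blast
  define r where "r i = vec_of m (\<lambda>j. rsign A (i, j))" for i
  define B where "B = r ` {..<n}"
  have B: "finite B" "B \<subseteq> Rn m" by (auto simp: B_def r_def vec_of_in_Rn)
  obtain P where P: "orth_proj m P (span B)" using orth_proj_exists[OF B] by blast
  have "dim (span B) \<le> card B" using B by (intro dim_le_card) auto
  also have "\<dots> \<le> n" unfolding B_def using card_image_le[of "{..<n}" r] by simp
  finally have "subspace_of_dim m n (span B)"
    using B by (auto simp: subspace_of_dim_def intro: span_minimal[OF _ subspace_Rn, THEN subsetD])
  moreover have "\<exists>y\<in>span B. (\<Sum>j<m. \<bar>coord x j - coord y j\<bar> powr q) powr (1 / q) \<le> s * sqrt (\<Sum>j<m. (coord x j)\<^sup>2)"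
    if "x \<in> Rn m" for x
  proof (rule lq_distance_le[OF P subspace_span that q q'])
    fix f assume f: "\<And>h. h \<in> span B \<Longrightarrow> (\<Sum>j<m. f j * coord h j) = 0" "(\<Sum>j<m. \<bar>f j\<bar> powr q') \<le> 1"
    have "sign_row m f A i = 0" if "i < n" for i
      using f(1)[of "r i"] that by (auto simp: sign_row_def r_def coord_simps B_def intro: span_base)
    then show "sqrt (\<Sum>j<m. (f j)\<^sup>2) \<le> s" using A f(2) by blast
  qed
  ultimately show ?thesis unfolding s_def by blast
qed

section \<open>Sign vectors far from a subspace\<close>

lemma lnorm_ereal: "lnorm m (ereal r) x = (\<Sum>j<m. \<bar>coord x j\<bar> powr r) powr (1 / r)"
  by (simp add: lnorm_def)

text \<open>Discarding an element of largest value never raises the average.\<close>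

lemma subset_sum_le_average:
  fixes a :: "'a \<Rightarrow> real"
  assumes "finite U" "k \<le> card U"
  shows "\<exists>S\<subseteq>U. card S = k \<and> real (card U) * sum a S \<le> real k * sum a U"
  using assms
proof (induction "card U" arbitrary: U)
  case 0
  then show ?case by (intro exI[of _ "{}"]) auto
next
  case (Suc m)
  show ?case
  proof (cases "k = card U")
    case True
    then show ?thesis by (intro exI[of _ U]) auto
  next
    case False
    then have km: "k \<le> m" using Suc by simp
    show ?thesis
    proof (cases "m = 0")
      case True
      then show ?thesis using km by (intro exI[of _ "{}"]) auto
    next
      case m: False
      have ne: "U \<noteq> {}" using Suc by auto
      have "Max (a ` U) \<in> a ` U" using ne Suc.prems(1) by (intro Max_in) auto
      then obtain x where "x \<in> U" "a x = Max (a ` U)" by auto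
      then have x: "x \<in> U" "\<And>y. y \<in> U \<Longrightarrow> a y \<le> a x"
        using Suc.prems(1) by auto
      have U': "card (U - {x}) = m" "finite (U - {x})" using x Suc by auto
      then obtain S where S: "S \<subseteq> U - {x}" "card S = k" "real m * sum a S \<le> real k * sum a (U - {x})"
        using Suc.hyps(1)[of "U - {x}"] km by auto
      have "sum a U \<le> real (card U) * a x"
        using sum_bounded_above[of U a "a x"] x by simp
      moreover have "sum a U = a x + sum a (U - {x})"
        using x Suc.prems by (simp add: sum.remove)
      moreover have "real (card U) = real m + 1" using Suc.hyps(2) by simp
      ultimately have "real (Suc m) * sum a (U - {x}) \<le> real m * sum a U"
        by (simp add: algebra_simps)
      then have *: "real k * (real (Suc m) * sum a (U - {x})) \<le> real k * (real m * sum a U)"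
        by (intro mult_left_mono) auto
      have "real m * (real (Suc m) * sum a S) = real (Suc m) * (real m * sum a S)"
        by (simp only: mult_ac)
      also have "\<dots> \<le> real (Suc m) * (real k * sum a (U - {x}))"
        using S by (intro mult_left_mono) auto
      also have "\<dots> = real k * (real (Suc m) * sum a (U - {x}))"
        by (simp only: mult_ac)
      also note *
      also have "real k * (real m * sum a U) = real m * (real k * sum a U)"
        by (simp only: mult_ac)
      finally have "real m * (real (Suc m) * sum a S) \<le> real m * (real k * sum a U)" .
      then have "real (Suc m) * sum a S \<le> real k * sum a U"
        using m by (subst (asm) mult_le_cancel_left_pos) auto
      then show ?thesis using S Suc.hyps(2) by (intro exI[of _ S]) auto
    qed
  qed
qed

section \<open>Distance of sparse sign vectors from a subspace\<close>

definition sign_vec :: "nat \<Rightarrow> nat set \<Rightarrow> nat set \<Rightarrow> nat \<Rightarrow>\<^sub>0 real"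
  where "sign_vec m S A = vec_of m (\<lambda>j. if j \<in> S then rsign A j else 0)"

lemma coord_sign_vec: "S \<subseteq> {..<m} \<Longrightarrow> coord (sign_vec m S A) j = (if j \<in> S then rsign A j else 0)"
  by (auto simp: sign_vec_def coord_simps)

lemma sum_proj_sign_vec:
  assumes "S \<subseteq> {..<m}"
  shows "(\<Sum>j<m. P i j * coord (sign_vec m S A) j) = (\<Sum>j\<in>S. P i j * rsign A j)"
  using assms by (intro sum.mono_neutral_cong_right) (auto simp: coord_sign_vec)

lemma sum_powr_sign_vec:
  assumes "S \<subseteq> {..<m}"
  shows "(\<Sum>j<m. \<bar>coord (sign_vec m S A) j\<bar> powr r) = card S"
proof -
  have "(\<Sum>j<m. \<bar>coord (sign_vec m S A) j\<bar> powr r) = (\<Sum>j\<in>S. 1)"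
    using assms by (intro sum.mono_neutral_cong_right) (auto simp: coord_sign_vec)
  then show ?thesis by simp
qed

text \<open>Orthogonality of the signs turns the second moments into squared entries, and the
  columns of a symmetric idempotent matrix have squared norm \<open>P j j\<close>.\<close>

lemma orth_proj_sign_avg_square:
  assumes P: "orth_proj m P L" and S: "S \<subseteq> {..<m}"
  shows "(\<Sum>i<m. sign_avg S (\<lambda>A. (\<Sum>j\<in>S. P i j * rsign A j)\<^sup>2)) = (\<Sum>j\<in>S. P j j)"
proof -
  have fS: "finite S" using S finite_subset by blast
  have "(\<Sum>i<m. sign_avg S (\<lambda>A. (\<Sum>j\<in>S. P i j * rsign A j)\<^sup>2)) = (\<Sum>i<m. \<Sum>j\<in>S. (P i j)\<^sup>2)"
    using fS by (simp add: sign_avg_square)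
  also have "\<dots> = (\<Sum>j\<in>S. \<Sum>i<m. P j i * P i j)"
    by (subst sum.swap) (simp add: power2_eq_square orth_proj_sym[OF P, of _ "_"] cong: sum.cong)
  also have "\<dots> = (\<Sum>j\<in>S. P j j)"
    using S by (intro sum.cong) (auto simp: orth_proj_square[OF P])
  finally show ?thesis .
qed

text \<open>The pairing of \<open>w\<close> with \<open>v - y\<close> equals
  \<open>card S - |P v|^2\<close>. Young's inequality for \<open>|v - y| / D\<close> and
  \<open>|w| / M\<close> leaves the average over signs on a sum of \<open>q'\<close>-th powers,
  where \<open>M\<close> controls it; the weights \<open>1/q + 1/q' = 1\<close> then return
  \<open>D * M\<close> without loss.\<close>

lemma distance_from_sign_vecs:
  fixes q q' D M :: real
  assumes P: "orth_proj m P L" and S: "S \<subseteq> {..<m}"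
    and q: "q > 1" "q' > 1" "1 / q + 1 / q' = 1"
    and M: "M > 0" "sign_avg S (\<lambda>A. \<Sum>i<m. \<bar>coord (sign_vec m S A) i - (\<Sum>j\<in>S. P i j * rsign A j)\<bar> powr q') \<le> M powr q'"
    and D: "D > 0" "\<And>A. A \<subseteq> S \<Longrightarrow> \<exists>y\<in>L. (\<Sum>i<m. \<bar>coord (sign_vec m S A) i - coord y i\<bar> powr q) \<le> D powr q"
  shows "real (card S) - (\<Sum>j\<in>S. P j j) \<le> D * M"
proof -
  have fS: "finite S" using S finite_subset by blast
  define v where "v A = coord (sign_vec m S A)" for A
  define Pv where "Pv A i = (\<Sum>j\<in>S. P i j * rsign A j)" for A i
  define w where "w A i = v A i - Pv A i" for A i
  have Pv: "Pv A i = (\<Sum>j<m. P i j * v A j)" for A i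
    using S by (simp add: Pv_def v_def sum_proj_sign_vec)
  obtain y where y: "\<And>A. A \<subseteq> S \<Longrightarrow> y A \<in> L"
    "\<And>A. A \<subseteq> S \<Longrightarrow> (\<Sum>i<m. \<bar>v A i - coord (y A) i\<bar> powr q) \<le> D powr q"
    using D(2) unfolding v_def by metis
  have eq: "(\<Sum>i<m. w A i * (v A i - coord (y A) i)) = real (card S) - (\<Sum>i<m. (Pv A i)\<^sup>2)" if "A \<subseteq> S" for A
  proof -
    have "(\<Sum>i<m. v A i * Pv A i) = (\<Sum>i<m. v A i * (\<Sum>l<m. P i l * Pv A l))"
      unfolding Pv by (intro sum.cong) (auto simp: orth_proj_idem[OF P])
    also have "\<dots> = (\<Sum>i<m. (\<Sum>l<m. P i l * v A l) * Pv A i)"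
      by (rule orth_proj_self_adjoint[OF P])
    finally have 1: "(\<Sum>i<m. v A i * Pv A i) = (\<Sum>i<m. (Pv A i)\<^sup>2)"
      by (simp add: Pv power2_eq_square)
    have "(\<Sum>i<m. (v A i)\<^sup>2) = (\<Sum>j<m. \<bar>v A j\<bar> powr 2)" by simp
    also have "\<dots> = real (card S)"
      unfolding v_def by (rule sum_powr_sign_vec[OF S])
    finally have 2: "(\<Sum>i<m. v A i * v A i) = real (card S)" by (simp add: power2_eq_square)
    have "(\<Sum>i<m. w A i * coord (y A) i) = 0"
      unfolding w_def Pv by (rule orth_proj_residual[OF P y(1)[OF that]])
    then have "(\<Sum>i<m. w A i * (v A i - coord (y A) i)) = (\<Sum>i<m. w A i * v A i)"
      by (simp add: right_diff_distrib sum_subtractf)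
    also have "\<dots> = (\<Sum>i<m. v A i * v A i) - (\<Sum>i<m. v A i * Pv A i)"
      unfolding sum_subtractf[symmetric] w_def by (intro sum.cong) (simp_all add: algebra_simps)
    finally show ?thesis using 1 2 by simp
  qed
  have "real (card S) - (\<Sum>j\<in>S. P j j) = sign_avg S (\<lambda>A. real (card S) - (\<Sum>i<m. (Pv A i)\<^sup>2))"
    unfolding sign_avg_diff sign_avg_sum sign_avg_const[OF fS] Pv_def orth_proj_sign_avg_square[OF P S] ..
  also have "\<dots> = sign_avg S (\<lambda>A. \<Sum>i<m. w A i * (v A i - coord (y A) i))"
    by (intro sign_avg_cong) (simp add: eq)
  also have "\<dots> \<le> sign_avg S (\<lambda>A. D * M * (1 / q + 1 / (q' * M powr q') * (\<Sum>i<m. \<bar>w A i\<bar> powr q')))"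
  proof (rule sign_avg_mono)
    fix A assume A: "A \<subseteq> S"
    have "(\<Sum>i<m. w A i * (v A i - coord (y A) i))
        \<le> (\<Sum>i<m. D * M * (1 / (q * D powr q) * \<bar>v A i - coord (y A) i\<bar> powr q + 1 / (q' * M powr q') * \<bar>w A i\<bar> powr q'))"
    proof (rule sum_mono)
      fix i
      define u where "u = v A i - coord (y A) i"
      have "w A i * u \<le> \<bar>u\<bar> * \<bar>w A i\<bar>" by (metis abs_ge_self abs_mult mult.commute)
      also have "\<dots> = D * M * ((\<bar>u\<bar> / D) * (\<bar>w A i\<bar> / M))" using D M by simp
      also have "\<dots> \<le> D * M * ((\<bar>u\<bar> / D) powr q / q + (\<bar>w A i\<bar> / M) powr q' / q')"
        using D M q by (intro mult_left_mono Youngs_inequality) auto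
      finally show "w A i * u \<le> D * M * (1 / (q * D powr q) * \<bar>u\<bar> powr q + 1 / (q' * M powr q') * \<bar>w A i\<bar> powr q')"
        using D M by (simp add: powr_divide mult.commute)
    qed
    also have "\<dots> = D * M * (1 / (q * D powr q) * (\<Sum>i<m. \<bar>v A i - coord (y A) i\<bar> powr q)
        + 1 / (q' * M powr q') * (\<Sum>i<m. \<bar>w A i\<bar> powr q'))"
      by (simp only: sum_distrib_left[symmetric] sum.distrib)
    also have "\<dots> \<le> D * M * (1 / (q * D powr q) * D powr q + 1 / (q' * M powr q') * (\<Sum>i<m. \<bar>w A i\<bar> powr q'))"
      using D M q y(2)[OF A] by (intro mult_left_mono add_right_mono) auto
    finally show "(\<Sum>i<m. w A i * (v A i - coord (y A) i))
        \<le> D * M * (1 / q + 1 / (q' * M powr q') * (\<Sum>i<m. \<bar>w A i\<bar> powr q'))"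
      using D by simp
  qed
  also have "\<dots> = D * M * (1 / q + 1 / (q' * M powr q') * sign_avg S (\<lambda>A. \<Sum>i<m. \<bar>w A i\<bar> powr q'))"
    using fS by (simp only: sign_avg_cmult sign_avg_add sign_avg_const)
  also have "\<dots> \<le> D * M * (1 / q + 1 / (q' * M powr q') * M powr q')"
    using D M q by (intro mult_left_mono add_left_mono) (auto simp: w_def v_def Pv_def)
  also have "\<dots> = D * M" using M q by simp
  finally show ?thesis .
qed

lemma abs_diff_powr_le:
  fixes a b r :: real
  assumes "r > 0"
  shows "\<bar>a - b\<bar> powr r \<le> 2 powr r * (\<bar>a\<bar> powr r + \<bar>b\<bar> powr r)"
proof -
  have "\<bar>a - b\<bar> powr r \<le> (2 * max \<bar>a\<bar> \<bar>b\<bar>) powr r"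
    using assms by (intro powr_mono2) auto
  also have "\<dots> = 2 powr r * max \<bar>a\<bar> \<bar>b\<bar> powr r" by (simp add: powr_mult)
  also have "\<dots> \<le> 2 powr r * (\<bar>a\<bar> powr r + \<bar>b\<bar> powr r)"
    by (intro mult_left_mono) (auto simp: max_def)
  finally show ?thesis .
qed

lemma residual_moment_le:
  assumes S: "S \<subseteq> {..<m}" and r: "r > 0"
    and X: "(\<Sum>i<m. sign_avg S (\<lambda>A. \<bar>\<Sum>j\<in>S. P i j * rsign A j\<bar> powr r)) \<le> X"
  shows "sign_avg S (\<lambda>A. \<Sum>i<m. \<bar>coord (sign_vec m S A) i - (\<Sum>j\<in>S. P i j * rsign A j)\<bar> powr r)
    \<le> 2 powr r * (real (card S) + X)"
proof -
  have fS: "finite S" using S finite_subset by blast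
  have "sign_avg S (\<lambda>A. \<Sum>i<m. \<bar>coord (sign_vec m S A) i - (\<Sum>j\<in>S. P i j * rsign A j)\<bar> powr r)
      \<le> sign_avg S (\<lambda>A. 2 powr r * (real (card S) + (\<Sum>i<m. \<bar>\<Sum>j\<in>S. P i j * rsign A j\<bar> powr r)))"
  proof (rule sign_avg_mono)
    fix A assume "A \<subseteq> S"
    have "(\<Sum>i<m. \<bar>coord (sign_vec m S A) i - (\<Sum>j\<in>S. P i j * rsign A j)\<bar> powr r)
        \<le> (\<Sum>i<m. 2 powr r * (\<bar>coord (sign_vec m S A) i\<bar> powr r + \<bar>\<Sum>j\<in>S. P i j * rsign A j\<bar> powr r))"
      by (intro sum_mono abs_diff_powr_le r)
    then show "(\<Sum>i<m. \<bar>coord (sign_vec m S A) i - (\<Sum>j\<in>S. P i j * rsign A j)\<bar> powr r)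
        \<le> 2 powr r * (real (card S) + (\<Sum>i<m. \<bar>\<Sum>j\<in>S. P i j * rsign A j\<bar> powr r))"
      unfolding sum_distrib_left[symmetric] sum.distrib sum_powr_sign_vec[OF S] .
  qed
  also have "\<dots> \<le> 2 powr r * (real (card S) + X)"
    using X fS by (simp add: sign_avg_cmult sign_avg_add sign_avg_const sign_avg_sum)
  finally show ?thesis .
qed

lemma subspace_of_dim_orth_proj:
  assumes "subspace_of_dim m n L"
  obtains P where "orth_proj m P L" "(\<Sum>i<m. P i i) \<le> real n"
proof -
  obtain B0 where B0: "finite B0" "span B0 = L" and L: "L \<subseteq> Rn m" "dim L \<le> n" "subspace L"
    using assms unfolding subspace_of_dim_def by blast
  obtain B where B: "B \<subseteq> L" "independent B" "L \<subseteq> span B" "card B = dim L"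
    by (rule basis_exists)
  have "finite B" using independent_span_bound[OF B0(1) B(2)] B B0 by simp
  moreover have "span B = L" using B L(3) by (simp add: span_minimal subset_antisym)
  ultimately show ?thesis
    using orth_proj_exists[of B m] B L that by (metis dual_order.trans of_nat_mono)
qed

lemma exists_sign_support:
  assumes "subspace_of_dim m n L" "k \<le> m" "m > 0"
  obtains P S where "orth_proj m P L" "S \<subseteq> {..<m}" "card S = k"
    "real m * (\<Sum>j\<in>S. P j j) \<le> real k * real n"
proof -
  obtain P where P: "orth_proj m P L" "(\<Sum>i<m. P i i) \<le> real n"
    using subspace_of_dim_orth_proj[OF assms(1)] .
  obtain S where S: "S \<subseteq> {..<m}" "card S = k" "real m * (\<Sum>j\<in>S. P j j) \<le> real k * (\<Sum>i<m. P i i)"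
    using subset_sum_le_average[of "{..<m}" k "\<lambda>j. P j j"] assms by auto
  have "real k * (\<Sum>i<m. P i i) \<le> real k * real n" using P by (intro mult_left_mono) auto
  then show ?thesis using that P S by fastforce
qed

text \<open>This is where \<open>n <= m/2\<close> enters: the trace over \<open>S\<close> is at most
  \<open>k/2\<close>, so if every sign vector were close to \<open>L\<close>, then
  \<open>k/2 <= d * M <= k/4\<close>.\<close>

lemma sign_vec_far_from_subspace:
  fixes q q' M d :: real
  assumes P: "orth_proj m P L" and S: "S \<subseteq> {..<m}" "card S = k" "real m * (\<Sum>j\<in>S. P j j) \<le> real k * real n"
    and k: "1 \<le> k" and n: "real n \<le> real m / 2" "m > 0"
    and q: "q > 1" "q' > 1" "1 / q + 1 / q' = 1"
    and M: "M > 0" "sign_avg S (\<lambda>A. \<Sum>i<m. \<bar>coord (sign_vec m S A) i - (\<Sum>j\<in>S. P i j * rsign A j)\<bar> powr q') \<le> M powr q'"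
    and d: "d > 0" "4 * d * M \<le> real k"
  shows "\<exists>A\<subseteq>S. \<forall>y\<in>L. d \<le> lnorm m (ereal q) (sign_vec m S A - y)"
proof (rule ccontr)
  assume neg: "\<not> ?thesis"
  have "real (card S) - (\<Sum>j\<in>S. P j j) \<le> d * M"
  proof (rule distance_from_sign_vecs[OF P S(1) q M d(1)])
    fix A assume "A \<subseteq> S"
    then obtain y where y: "y \<in> L" "lnorm m (ereal q) (sign_vec m S A - y) < d"
      using neg by (auto simp: not_le)
    let ?s = "\<Sum>i<m. \<bar>coord (sign_vec m S A) i - coord y i\<bar> powr q"
    have "(?s powr (1 / q)) powr q \<le> d powr q"
      using y(2) q by (intro powr_mono2) (auto simp: lnorm_ereal lookup_minus)
    then have "?s \<le> d powr q" using q by (simp add: powr_powr sum_nonneg)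
    then show "\<exists>y\<in>L. (\<Sum>i<m. \<bar>coord (sign_vec m S A) i - coord y i\<bar> powr q) \<le> d powr q"
      using y(1) by blast
  qed
  moreover have "(\<Sum>j\<in>S. P j j) \<le> real k / 2"
  proof -
    have "real m * (\<Sum>j\<in>S. P j j) \<le> real k * (real m / 2)"
      using S(3) n(1) by (meson dual_order.trans mult_left_mono of_nat_0_le_iff)
    then have "real m * (\<Sum>j\<in>S. P j j) \<le> real m * (real k / 2)" by (simp add: mult_ac)
    then show ?thesis using n(2) by (subst (asm) mult_le_cancel_left_pos) auto
  qed
  ultimately show False using S(2) d k by simp
qed

text \<open>\<open>N\<close> stands for \<open>n\<close>, or for 1 when \<open>n = 0\<close>. Since
  \<open>q' <= 2\<close>, the \<open>q'\<close>-th moments of \<open>P v\<close> follow from its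
  second moment, that is, from the trace.\<close>

lemma sign_vec_far_q_ge_2:
  fixes q N :: real
  assumes L: "subspace_of_dim m n L" and q: "2 \<le> q" and n: "real n \<le> real m / 2"
    and N: "real n \<le> N" "1 \<le> N" and k: "1 \<le> k" "k \<le> m"
  shows "\<exists>S A. S \<subseteq> {..<m} \<and> card S = k \<and> (\<forall>y\<in>L.
    1 / 24 * min (real k powr (1 / q)) (real k powr (1 / 2) * (N powr (-1/2) * real m powr (1 / q)))
      \<le> lnorm m (ereal q) (sign_vec m S A - y))"
proof -
  have m: "m > 0" using k by simp
  obtain P S where P: "orth_proj m P L" and S: "S \<subseteq> {..<m}" "card S = k"
    and tr: "real m * (\<Sum>j\<in>S. P j j) \<le> real k * real n"
    using exists_sign_support[OF L k(2) m] .
  define q' where "q' = q / (q - 1)"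
  have q1: "q > 1" using q by simp
  have q': "q' > 1" "1 / q + 1 / q' = 1" "q' \<le> 2" using q by (auto simp: q'_def field_simps)
  \<comment> \<open>Bound for the root mean square of a coordinate of \<open>P v\<close>: the
    squared Euclidean norm has mean at most \<open>k N / m\<close>, spread over \<open>m\<close>
    coordinates.\<close>
  define \<beta> where "\<beta> = sqrt (real k * N) / real m"
  have \<beta>: "\<beta> > 0" using k N m by (simp add: \<beta>_def)
  define X where "X = real m powr (1 / q') * \<beta>"
  have X: "X > 0" using \<beta> m by (simp add: X_def)
  have Xq: "X powr q' = real m * \<beta> powr q'"
    using \<beta> m q' by (simp add: X_def powr_mult powr_powr)
  \<comment> \<open>The sizes in \<open>l_q'\<close> of \<open>v\<close> and of \<open>P v\<close>;
    dividing \<open>k\<close> by them gives the two terms of the minimum.\<close>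
  define M0 where "M0 = max (real k powr (1 / q')) X"
  have M0: "M0 > 0" using X by (simp add: M0_def)
  have kM: "real k \<le> M0 powr q'"
  proof -
    have "(real k powr (1 / q')) powr q' \<le> M0 powr q'"
      using q' by (intro powr_mono2) (auto simp: M0_def)
    then show ?thesis using q' k by (simp add: powr_powr)
  qed
  have XM: "X powr q' \<le> M0 powr q'" using q' X by (intro powr_mono2) (auto simp: M0_def)
  have fS: "finite S" using S finite_subset by blast
  have b: "\<bar>t\<bar> powr q' \<le> \<beta> powr q' * (1 + t\<^sup>2 / \<beta>\<^sup>2)" for t
  proof -
    have "(\<bar>t\<bar> / \<beta>) powr q' \<le> 1 + (\<bar>t\<bar> / \<beta>) powr 2"
    proof (cases "\<bar>t\<bar> / \<beta> \<le> 1")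
      case True
      then have "(\<bar>t\<bar> / \<beta>) powr q' \<le> 1 powr q'" using q' \<beta> by (intro powr_mono2) auto
      then show ?thesis by (simp add: add_increasing2)
    next
      case False
      then have "(\<bar>t\<bar> / \<beta>) powr q' \<le> (\<bar>t\<bar> / \<beta>) powr 2" using q' by (intro powr_mono) auto
      then show ?thesis by simp
    qed
    then have "\<beta> powr q' * (\<bar>t\<bar> / \<beta>) powr q' \<le> \<beta> powr q' * (1 + (\<bar>t\<bar> / \<beta>)\<^sup>2)"
      using \<beta> by (intro mult_left_mono) (auto simp flip: powr_numeral)
    then show ?thesis using \<beta> by (simp add: powr_divide power_divide)
  qed
  have "(\<Sum>i<m. sign_avg S (\<lambda>A. \<bar>\<Sum>j\<in>S. P i j * rsign A j\<bar> powr q'))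
      \<le> (\<Sum>i<m. sign_avg S (\<lambda>A. \<beta> powr q' * (1 + (\<Sum>j\<in>S. P i j * rsign A j)\<^sup>2 / \<beta>\<^sup>2)))"
    by (intro sum_mono sign_avg_mono b)
  also have "\<dots> = \<beta> powr q' * (real m + (\<Sum>i<m. sign_avg S (\<lambda>A. (\<Sum>j\<in>S. P i j * rsign A j)\<^sup>2)) / \<beta>\<^sup>2)"
    using fS by (simp add: sign_avg_cmult sign_avg_add sign_avg_const sign_avg_divide sum.distrib
        flip: sum_distrib_left sum_divide_distrib)
  also have "\<dots> \<le> \<beta> powr q' * (real m + real m)"
  proof -
    have "real m * (\<Sum>j\<in>S. P j j) \<le> real k * N"
      using tr N k by (meson dual_order.trans mult_left_mono of_nat_0_le_iff)
    then have "(\<Sum>j\<in>S. P j j) \<le> real m * \<beta>\<^sup>2"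
      using m k N by (simp add: \<beta>_def power_divide field_simps power2_eq_square)
    then show ?thesis
      unfolding orth_proj_sign_avg_square[OF P S(1)] using \<beta>
      by (intro mult_left_mono add_left_mono) (auto simp: pos_divide_le_eq)
  qed
  also have "\<dots> = 2 * X powr q'" by (simp add: Xq)
  finally have "sign_avg S (\<lambda>A. \<Sum>i<m. \<bar>coord (sign_vec m S A) i - (\<Sum>j\<in>S. P i j * rsign A j)\<bar> powr q')
      \<le> 2 powr q' * (real (card S) + 2 * X powr q')"
    using S q' by (intro residual_moment_le) auto
  also have "\<dots> \<le> 2 powr q' * (3 powr q' * M0 powr q')"
  proof (intro mult_left_mono)
    have "3 powr 1 \<le> 3 powr q'" using q' by (intro powr_mono) auto
    then have "3 * M0 powr q' \<le> 3 powr q' * M0 powr q'" by (intro mult_right_mono) auto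
    then show "real (card S) + 2 * X powr q' \<le> 3 powr q' * M0 powr q'"
      using kM XM S by linarith
  qed auto
  also have "\<dots> = (6 * M0) powr q'" using M0 by (simp add: powr_mult flip: powr_mult)
  finally have mom: "sign_avg S (\<lambda>A. \<Sum>i<m. \<bar>coord (sign_vec m S A) i - (\<Sum>j\<in>S. P i j * rsign A j)\<bar> powr q')
      \<le> (6 * M0) powr q'" .
  define d0 where "d0 = min (real k powr (1 / q)) (real k powr (1 / 2) * (N powr (-1/2) * real m powr (1 / q)))"
  have d0: "d0 > 0" using k m N by (simp add: d0_def)
  have "d0 * M0 \<le> real k"
  proof (cases "X \<le> real k powr (1 / q')")
    case True
    then have "d0 * M0 \<le> real k powr (1 / q) * real k powr (1 / q')"
      using d0 by (intro mult_mono) (auto simp: M0_def d0_def)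
    also have "\<dots> = real k" using k q' by (simp flip: powr_add)
    finally show ?thesis .
  next
    case False
    then have "d0 * M0 \<le> (real k powr (1 / 2) * (N powr (-1/2) * real m powr (1 / q))) * X"
      using X by (intro mult_mono) (auto simp: M0_def d0_def)
    also have "\<dots> = (real k powr (1/2) * real k powr (1/2)) * (N powr (-1/2) * N powr (1/2))
        * (real m powr (1 / q) * real m powr (1 / q')) / real m"
      using k N by (simp add: X_def \<beta>_def real_sqrt_mult powr_half_sqrt)
    also have "\<dots> = real k"
      using k N m q' by (simp flip: powr_add)
    finally show ?thesis .
  qed
  \<comment> \<open>\<open>24 = 4 * 6\<close>: the 4 is demanded by
    \<open>sign_vec_far_from_subspace\<close>, and \<open>6 = 2 * 3\<close> comes from splitting
    \<open>w\<close> and from \<open>k + 2 X^q' <= 3 M0^q'\<close>.\<close>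
  then have "4 * (1 / 24 * d0) * (6 * M0) \<le> real k" by simp
  from sign_vec_far_from_subspace[OF P S tr k(1) n m q1 q'(1,2) _ mom _ this]
  show ?thesis using M0 d0 S unfolding d0_def by auto
qed

lemma orth_proj_diag_le_1:
  assumes P: "orth_proj m P L" and i: "i < m"
  shows "P i i \<le> 1" "(\<Sum>j<m. (P i j)\<^sup>2) = P i i"
proof -
  show *: "(\<Sum>j<m. (P i j)\<^sup>2) = P i i"
    unfolding orth_proj_square[OF P i i, symmetric] power2_eq_square
    by (intro sum.cong) (auto simp: orth_proj_sym[OF P])
  have "(P i i)\<^sup>2 \<le> (\<Sum>j<m. (P i j)\<^sup>2)"
    using i by (intro member_le_sum) auto
  then have "P i i * P i i \<le> P i i" using * by (simp add: power2_eq_square)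
  then show "P i i \<le> 1"
    using mult_strict_left_mono[of 1 "P i i" "P i i"] by (cases "P i i \<le> 1") auto
qed

text \<open>Here \<open>8 = 4 * 2\<close>, with 4 from \<open>sign_vec_far_from_subspace\<close> and
  2 from \<open>residual_moment_le\<close>; the bracket is 1 plus the Khintchine constant of the
  dual exponent \<open>q / (q - 1)\<close>.\<close>

definition far_const :: "real \<Rightarrow> real"
  where "far_const q = 8 * (1 + 2 * exp 1 * (q / (q - 1)) powr (q / (q - 1)))"

lemma far_const_pos: "far_const q > 0"
  by (simp add: far_const_def add_pos_nonneg)

text \<open>Now \<open>q' >= 2\<close>. Khintchine's inequality produces the power
  \<open>q'/2 >= 1\<close> of the squared row norms; these are at most 1 and so dominate that power.
  Their sum is the trace over \<open>S\<close>, at most \<open>k\<close>, and neither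
  \<open>n\<close> nor \<open>m\<close> enters the bound.\<close>

lemma sign_vec_far_q_le_2:
  fixes q :: real
  assumes L: "subspace_of_dim m n L" and q: "1 < q" "q \<le> 2" and n: "real n \<le> real m / 2"
    and k: "1 \<le> k" "k \<le> m"
  shows "\<exists>S A. S \<subseteq> {..<m} \<and> card S = k \<and> (\<forall>y\<in>L.
    real k powr (1 / q) / far_const q \<le> lnorm m (ereal q) (sign_vec m S A - y))"
proof -
  have m: "m > 0" using k by simp
  obtain P S where P: "orth_proj m P L" and S: "S \<subseteq> {..<m}" "card S = k"
    and tr: "real m * (\<Sum>j\<in>S. P j j) \<le> real k * real n"
    using exists_sign_support[OF L k(2) m] .
  define q' where "q' = q / (q - 1)"
  have q': "q' > 1" "1 / q + 1 / q' = 1" "q' \<ge> 2" using q by (auto simp: q'_def field_simps)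
  define C where "C = 2 * exp 1 * q' powr q'"
  have C: "C \<ge> 0" by (simp add: C_def)
  define M where "M = 2 * (1 + C) * real k powr (1 / q')"
  have M: "M > 0" using k C by (simp add: M_def)
  have fS: "finite S" using S finite_subset by blast
  have row: "sign_avg S (\<lambda>A. \<bar>\<Sum>j\<in>S. P i j * rsign A j\<bar> powr q') \<le> C * (\<Sum>j\<in>S. (P i j)\<^sup>2)"
    if "i < m" for i
  proof -
    have "(\<Sum>j\<in>S. (P i j)\<^sup>2) \<le> (\<Sum>j<m. (P i j)\<^sup>2)" using S by (intro sum_mono2) auto
    then have le1: "(\<Sum>j\<in>S. (P i j)\<^sup>2) \<le> 1" using orth_proj_diag_le_1[OF P that] by linarith
    have "(\<Sum>j\<in>S. (P i j)\<^sup>2) powr (q' / 2) \<le> (\<Sum>j\<in>S. (P i j)\<^sup>2) powr 1"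
      using le1 q' by (intro powr_mono') (auto intro: sum_nonneg)
    then have "C * (\<Sum>j\<in>S. (P i j)\<^sup>2) powr (q' / 2) \<le> C * (\<Sum>j\<in>S. (P i j)\<^sup>2)"
      (is "?a \<le> ?b")
      using C by (intro mult_left_mono) (auto simp: sum_nonneg)
    moreover have "sign_avg S (\<lambda>A. \<bar>\<Sum>j\<in>S. P i j * rsign A j\<bar> powr q') \<le> ?a"
      unfolding C_def using q' by (intro khintchine_upper[OF fS]) auto
    ultimately show ?thesis by linarith
  qed
  have "(\<Sum>i<m. sign_avg S (\<lambda>A. \<bar>\<Sum>j\<in>S. P i j * rsign A j\<bar> powr q')) \<le> (\<Sum>i<m. C * (\<Sum>j\<in>S. (P i j)\<^sup>2))"
    by (intro sum_mono row) auto
  also have "\<dots> = C * (\<Sum>j\<in>S. P j j)"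
    using orth_proj_sign_avg_square[OF P S(1)] fS by (simp add: sign_avg_square flip: sum_distrib_left)
  also have "\<dots> \<le> C * (\<Sum>j\<in>S. 1)"
    using C S by (intro mult_left_mono sum_mono orth_proj_diag_le_1[OF P]) auto
  finally have "sign_avg S (\<lambda>A. \<Sum>i<m. \<bar>coord (sign_vec m S A) i - (\<Sum>j\<in>S. P i j * rsign A j)\<bar> powr q')
      \<le> 2 powr q' * (real (card S) + C * real k)"
    using S q' by (intro residual_moment_le) auto
  also have "\<dots> = 2 powr q' * ((1 + C) powr 1 * real k)" using S C by (simp add: algebra_simps)
  also have "\<dots> \<le> 2 powr q' * ((1 + C) powr q' * real k)"
    using C q' by (intro mult_left_mono mult_right_mono powr_mono) auto
  also have "\<dots> = M powr q'"
    unfolding M_def powr_mult using k q' by (simp add: powr_powr mult.assoc)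
  finally have mom: "sign_avg S (\<lambda>A. \<Sum>i<m. \<bar>coord (sign_vec m S A) i - (\<Sum>j\<in>S. P i j * rsign A j)\<bar> powr q')
      \<le> M powr q'" .
  have far: "far_const q = 8 * (1 + C)" by (simp add: far_const_def C_def q'_def)
  have "4 * (real k powr (1 / q) / far_const q) * M = real k powr (1 / q) * real k powr (1 / q')"
    using C by (simp add: far M_def field_simps)
  also have "\<dots> = real k" using k q' by (simp flip: powr_add)
  finally have "4 * (real k powr (1 / q) / far_const q) * M \<le> real k" by simp
  from sign_vec_far_from_subspace[OF P S tr k(1) n m q(1) q'(1,2) M mom _ this]
  show ?thesis using k S far_const_pos by auto
qed

section \<open>Extremal functionals in the annihilator of a subspace\<close>

lemma exists_annihilator_vanishing_on:
  assumes L: "subspace_of_dim m n L" and T: "T \<subseteq> {..<m}" "card T + n < m"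
  shows "\<exists>g. (\<forall>y\<in>L. (\<Sum>j<m. g j * coord y j) = 0) \<and> (\<forall>t\<in>T. g t = 0) \<and> (\<exists>j<m. g j \<noteq> 0)"
proof -
  define e where "e t = vec_of m (\<lambda>j. if j = t then 1 else 0)" for t
  have pick: "(\<Sum>j<m. c j * coord (e t) j) = c t" if "t < m" for c t
  proof -
    have "(\<Sum>j<m. c j * coord (e t) j) = (\<Sum>j<m. if j = t then c j else 0)"
      by (intro sum.cong) (auto simp: e_def coord_simps)
    then show ?thesis using that by simp
  qed
  obtain B0 where B0: "finite B0" "span B0 = L" and L': "L \<subseteq> Rn m" "dim L \<le> n" "subspace L"
    using L unfolding subspace_of_dim_def by blast
  obtain B where B: "B \<subseteq> L" "independent B" "L \<subseteq> span B" "card B = dim L"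
    by (rule basis_exists)
  have fB: "finite B" using independent_span_bound[OF B0(1) B(2)] B B0 by simp
  have fT: "finite T" using T finite_subset by blast
  have C: "finite (B \<union> e ` T)" "B \<union> e ` T \<subseteq> Rn m"
    using fB fT B L' by (auto simp: e_def vec_of_in_Rn)
  obtain Q where Q: "orth_proj m Q (span (B \<union> e ` T))" "(\<Sum>i<m. Q i i) \<le> real (card (B \<union> e ` T))"
    using orth_proj_exists[OF C] by blast
  have "card (B \<union> e ` T) \<le> card B + card T"
    using card_Un_le[of B "e ` T"] card_image_le[OF fT, of e] by linarith
  \<comment> \<open>A trace below \<open>m\<close> means that some diagonal entry differs from 1;
    the residual of that unit vector is then nonzero at its own coordinate and annihilates both
    \<open>L\<close> and the unit vectors of \<open>T\<close>.\<close>
  then have "(\<Sum>i<m. Q i i) < real m" using Q(2) B(4) L'(2) T(2) by linarith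
  then obtain i where i: "i < m" "Q i i \<noteq> 1"
    by (metis (no_types, lifting) card_lessThan lessThan_iff less_irrefl mult.right_neutral sum.cong sum_constant)
  define g where "g j = coord (e i) j - (\<Sum>l<m. Q j l * coord (e i) l)" for j
  have g: "(\<Sum>j<m. g j * coord y j) = 0" if "y \<in> span (B \<union> e ` T)" for y
    unfolding g_def by (rule orth_proj_residual[OF Q(1) that])
  have "(\<Sum>j<m. g j * coord y j) = 0" if "y \<in> L" for y
    using g[of y] that B(3) span_mono[of B "B \<union> e ` T"] by blast
  moreover have "g t = 0" if "t \<in> T" for t
  proof -
    have "(\<Sum>j<m. g j * coord (e t) j) = 0" using that by (intro g span_base) auto
    moreover have "(\<Sum>j<m. g j * coord (e t) j) = g t" using that T by (intro pick) auto
    ultimately show ?thesis by simp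
  qed
  moreover have "g i \<noteq> 0"
  proof -
    have "(\<Sum>l<m. Q i l * coord (e i) l) = Q i i" by (rule pick[OF i(1)])
    then show ?thesis using i by (simp add: g_def e_def coord_simps)
  qed
  ultimately show ?thesis using i by blast
qed

text \<open>A functional in the annihilator of \<open>L\<close> of sup-norm at most 1 with the largest number of
  coordinates of modulus 1 (a vertex of that section of the cube): otherwise one could move along
  an annihilator vanishing on these coordinates until one more coordinate becomes \<open>\<plusminus>1\<close>.\<close>

lemma exists_extremal_annihilator:
  assumes L: "subspace_of_dim m n L"
  shows "\<exists>f. (\<forall>y\<in>L. (\<Sum>j<m. f j * coord y j) = 0) \<and> (\<forall>j<m. \<bar>f j\<bar> \<le> 1)
    \<and> m \<le> card {j. j < m \<and> \<bar>f j\<bar> = 1} + n"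
proof -
  define K :: "(nat \<Rightarrow> real) \<Rightarrow> bool"
    where "K f \<longleftrightarrow> (\<forall>y\<in>L. (\<Sum>j<m. f j * coord y j) = 0) \<and> (\<forall>j<m. \<bar>f j\<bar> \<le> 1)" for f
  define T where "T f = {j. j < m \<and> \<bar>f j\<bar> = (1::real)}" for f
  have T: "finite (T f)" "T f \<subseteq> {..<m}" "card (T f) \<le> m" for f
  proof -
    show 1: "T f \<subseteq> {..<m}" by (auto simp: T_def)
    then show "finite (T f)" using finite_subset by blast
    show "card (T f) \<le> m" using card_mono[OF _ 1] by simp
  qed
  have "K (\<lambda>_. 0)" by (simp add: K_def)
  then obtain f where f: "K f" "\<And>h. K h \<Longrightarrow> card (T h) \<le> card (T f)"
    using ex_has_greatest_nat[of K "\<lambda>_. 0" "\<lambda>f. card (T f)" "Suc m"] T(3)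
    by (auto simp: less_Suc_eq_le)
  have "m \<le> card (T f) + n"
  proof (rule ccontr)
    assume "\<not> ?thesis"
    then obtain g where g: "\<And>y. y \<in> L \<Longrightarrow> (\<Sum>j<m. g j * coord y j) = 0"
      "\<And>t. t \<in> T f \<Longrightarrow> g t = 0" "\<exists>j<m. g j \<noteq> 0"
      using exists_annihilator_vanishing_on[OF L T(2), of f] by auto
    define G where "G = {j. j < m \<and> g j \<noteq> 0}"
    \<comment> \<open>\<open>\<tau> j\<close> is the time at which coordinate \<open>j\<close> of
      \<open>f + t g\<close> reaches the face \<open>sgn (g j)\<close> of the cube; the smallest
      such time keeps all coordinates inside.\<close>
    define \<tau> where "\<tau> j = (1 - sgn (g j) * f j) / \<bar>g j\<bar>" for j
    have G: "finite G" "G \<noteq> {}" using g(3) by (auto simp: G_def)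
    obtain i where i: "i \<in> G" "\<And>j. j \<in> G \<Longrightarrow> \<tau> i \<le> \<tau> j"
      using G arg_min_if_finite[of G \<tau>] by (metis not_le)
    define h where "h j = f j + \<tau> i * g j" for j
    have lt: "\<bar>f j\<bar> < 1" if "j \<in> G" for j
      using f(1) g(2)[of j] that by (force simp: K_def G_def T_def)
    have s: "sgn (g j) * h j \<le> 1 \<and> -1 < sgn (g j) * h j" if j: "j \<in> G" for j
    proof -
      have gj: "\<bar>g j\<bar> > 0" using j by (simp add: G_def)
      have e: "sgn (g j) * h j = sgn (g j) * f j + \<tau> i * \<bar>g j\<bar>"
        by (simp add: h_def distrib_left abs_sgn mult.left_commute)
      have "\<tau> i * \<bar>g j\<bar> \<le> \<tau> j * \<bar>g j\<bar>" using i(2)[OF j] by (intro mult_right_mono) auto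
      also have "\<dots> = 1 - sgn (g j) * f j" using gj by (simp add: \<tau>_def)
      finally have 1: "sgn (g j) * h j \<le> 1" using e by linarith
      have sg: "\<bar>sgn (g l) * f l\<bar> < 1" if "l \<in> G" for l
        using lt[OF that] that by (simp add: abs_mult G_def abs_sgn_eq)
      have "sgn (g i) * f i < 1" using sg[OF i(1)] by linarith
      then have "\<tau> i \<ge> 0" by (simp add: \<tau>_def)
      then have "0 \<le> \<tau> i * \<bar>g j\<bar>" by simp
      moreover have "- 1 < sgn (g j) * f j" using sg[OF j] by linarith
      ultimately have "- 1 < sgn (g j) * h j" using e by linarith
      then show ?thesis using 1 by blast
    qed
    have hG: "\<bar>h j\<bar> \<le> 1" if "j \<in> G" for j
      using s[OF that] that by (auto simp: G_def sgn_if split: if_splits)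
    have hn: "h j = f j" if "j < m" "j \<notin> G" for j using that by (simp add: h_def G_def)
    have "K h"
      unfolding K_def
    proof (intro conjI ballI allI impI)
      fix y assume "y \<in> L"
      then show "(\<Sum>j<m. h j * coord y j) = 0"
        using f(1) g(1)[of y] by (simp add: K_def h_def distrib_right sum.distrib mult.assoc flip: sum_distrib_left)
    next
      fix j assume "j < m"
      then show "\<bar>h j\<bar> \<le> 1" using hG hn f(1) by (cases "j \<in> G") (auto simp: K_def)
    qed
    moreover have "insert i (T f) \<subseteq> T h"
    proof -
      have "sgn (g i) * h i = 1"
      proof -
        have "sgn (g i) * h i = sgn (g i) * f i + \<tau> i * \<bar>g i\<bar>"
          by (simp add: h_def distrib_left abs_sgn mult.left_commute)
        then show ?thesis using i(1) by (simp add: \<tau>_def G_def)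
      qed
      then have "\<bar>h i\<bar> = 1" using i(1) by (auto simp: G_def sgn_if split: if_splits)
      moreover have "h t = f t" if "t \<in> T f" for t using g(2)[OF that] by (simp add: h_def)
      ultimately show ?thesis using i(1) by (auto simp: T_def G_def)
    qed
    moreover have "i \<notin> T f" using lt[OF i(1)] by (auto simp: T_def)
    ultimately have "card (T f) < card (T h)"
      using card_mono[OF T(1)[of h], of "insert i (T f)"] T(1)[of f] by simp
    then show False using f(2)[OF \<open>K h\<close>] by simp
  qed
  then show ?thesis using f(1) unfolding K_def T_def by blast
qed

text \<open>The signs of the extremal \<open>f\<close> give a vector \<open>v\<close> whose pairing
  with \<open>f\<close> is at least \<open>m - n >= m/2\<close>. This covers \<open>q = 1\<close>,
  where the random sign argument would need an infinite dual exponent.\<close>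

lemma sign_vec_far_full_support:
  fixes q :: real
  assumes L: "subspace_of_dim m n L" and q: "1 \<le> q" and n: "real n \<le> real m / 2" "m > 0"
  shows "\<exists>A. \<forall>y\<in>L. real m powr (1 / q) / 4 \<le> lnorm m (ereal q) (sign_vec m {..<m} A - y)"
proof -
  obtain f where f: "\<And>y. y \<in> L \<Longrightarrow> (\<Sum>j<m. f j * coord y j) = 0" "\<And>j. j < m \<Longrightarrow> \<bar>f j\<bar> \<le> 1"
    "m \<le> card {j. j < m \<and> \<bar>f j\<bar> = 1} + n"
    using exists_extremal_annihilator[OF L] by blast
  define A where "A = {j. f j \<ge> 0}"
  define v where "v = sign_vec m {..<m} A"
  have v: "f j * coord v j = \<bar>f j\<bar>" if "j < m" for j
    using that by (auto simp: v_def coord_sign_vec rsign_def A_def)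
  have "real m powr (1 / q) / 4 \<le> lnorm m (ereal q) (v - y)" if y: "y \<in> L" for y
  proof -
    define u where "u j = coord v j - coord y j" for j
    have "real m / 2 \<le> real (card {j. j < m \<and> \<bar>f j\<bar> = 1})" using f(3) n(1) by linarith
    also have "\<dots> = (\<Sum>j | j < m \<and> \<bar>f j\<bar> = 1. \<bar>f j\<bar>)" by simp
    also have "\<dots> \<le> (\<Sum>j<m. \<bar>f j\<bar>)" by (intro sum_mono2) auto
    also have "\<dots> = (\<Sum>j<m. f j * coord v j)" by (simp add: v)
    also have "\<dots> = (\<Sum>j<m. f j * u j)"
      using f(1)[OF y] by (simp add: u_def right_diff_distrib sum_subtractf)
    \<comment> \<open>Splitting at \<open>1/4\<close>: the constant parts use up \<open>m/4\<close>,
      half of the available \<open>m/2\<close>, and larger entries satisfy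
      \<open>(4 |u|)^(q-1) >= 1\<close>.\<close>
    also have "\<dots> \<le> (\<Sum>j<m. 1/4 + 4 powr (q - 1) * \<bar>u j\<bar> powr q)"
    proof (rule sum_mono)
      fix j assume j: "j \<in> {..<m}"
      have "f j * u j \<le> \<bar>f j\<bar> * \<bar>u j\<bar>" by (metis abs_ge_self abs_mult)
      also have "\<dots> \<le> 1 * \<bar>u j\<bar>" using f(2) j by (intro mult_right_mono) auto
      also have "\<bar>u j\<bar> \<le> 1/4 + 4 powr (q - 1) * \<bar>u j\<bar> powr q"
      proof (cases "\<bar>u j\<bar> \<le> 1/4")
        case True
        then show ?thesis by (simp add: add_increasing2)
      next
        case False
        then have "1 powr (q - 1) \<le> (4 * \<bar>u j\<bar>) powr (q - 1)" using q by (intro powr_mono2) auto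
        then have "\<bar>u j\<bar> * 1 \<le> \<bar>u j\<bar> * (4 powr (q - 1) * \<bar>u j\<bar> powr (q - 1))"
          by (intro mult_left_mono) (auto simp: powr_mult)
        also have "\<dots> = 4 powr (q - 1) * \<bar>u j\<bar> powr q"
          using False powr_add[of "\<bar>u j\<bar>" "q - 1" 1] by simp
        finally show ?thesis by simp
      qed
      finally show "f j * u j \<le> 1/4 + 4 powr (q - 1) * \<bar>u j\<bar> powr q" by simp
    qed
    finally have "real m / 4 \<le> 4 powr (q - 1) * (\<Sum>j<m. \<bar>u j\<bar> powr q)"
      by (simp add: sum.distrib flip: sum_distrib_left)
    moreover have "4 powr q * (\<Sum>j<m. \<bar>u j\<bar> powr q) = 4 * (4 powr (q - 1) * (\<Sum>j<m. \<bar>u j\<bar> powr q))"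
      by (simp add: powr_diff)
    ultimately have "real m \<le> 4 powr q * (\<Sum>j<m. \<bar>u j\<bar> powr q)" by linarith
    then have "real m powr (1 / q) \<le> (4 powr q * (\<Sum>j<m. \<bar>u j\<bar> powr q)) powr (1 / q)"
      using q by (intro powr_mono2) auto
    also have "\<dots> = 4 * (\<Sum>j<m. \<bar>u j\<bar> powr q) powr (1 / q)"
      using q by (simp add: powr_mult powr_powr sum_nonneg)
    finally show ?thesis by (simp add: lnorm_ereal u_def lookup_minus)
  qed
  then show ?thesis unfolding v_def by blast
qed

section \<open>Widths of the intersection of two balls\<close>

lemma kolmogorov_width_le:
  assumes "subspace_of_dim m n L" "\<And>x. x \<in> M \<Longrightarrow> \<exists>y\<in>L. N (x - y) \<le> D"
  shows "kolmogorov_width n M (Rn m) N \<le> ereal D"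
  unfolding kolmogorov_width_def
proof (rule INF_lower2)
  show "L \<in> {L. subspace L \<and> L \<subseteq> Rn m \<and> (\<exists>B. finite B \<and> span B = L) \<and> dim L \<le> n}"
    using assms(1) by (simp add: subspace_of_dim_def)
  show "(SUP x\<in>M. INF y\<in>L. ereal (N (x - y))) \<le> ereal D"
  proof (rule SUP_least)
    fix x assume "x \<in> M"
    then obtain y where "y \<in> L" "N (x - y) \<le> D" using assms(2) by blast
    then show "(INF y\<in>L. ereal (N (x - y))) \<le> ereal D" by (auto intro: INF_lower2)
  qed
qed

lemma kolmogorov_width_ge:
  assumes "\<And>L. subspace_of_dim m n L \<Longrightarrow> \<exists>x\<in>M. \<forall>y\<in>L. D \<le> N (x - y)"
  shows "ereal D \<le> kolmogorov_width n M (Rn m) N"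
  unfolding kolmogorov_width_def
proof (rule INF_greatest)
  fix L assume "L \<in> {L. subspace L \<and> L \<subseteq> Rn m \<and> (\<exists>B. finite B \<and> span B = L) \<and> dim L \<le> n}"
  then have "subspace_of_dim m n L" by (simp add: subspace_of_dim_def)
  then obtain x where x: "x \<in> M" "\<And>y. y \<in> L \<Longrightarrow> D \<le> N (x - y)" using assms by blast
  show "ereal D \<le> (SUP x\<in>M. INF y\<in>L. ereal (N (x - y)))"
    using x by (intro SUP_upper2[OF x(1)] INF_greatest) auto
qed

lemma lnorm_scaleR:
  assumes "m > 0" "c \<ge> 0" "p \<noteq> - \<infinity>" "p \<noteq> 0"
  shows "lnorm m p (c *\<^sub>R x) = c * lnorm m p x"
proof (cases p)
  case (real r)
  then show ?thesis
    using assms by (simp add: lnorm_ereal coord_scaleR abs_mult powr_mult powr_powr sum_nonneg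
        flip: sum_distrib_left)
next
  case PInf
  have "Max ((\<lambda>j. \<bar>coord (c *\<^sub>R x) j\<bar>) ` {..<m}) = Max ((*) c ` (\<lambda>j. \<bar>coord x j\<bar>) ` {..<m})"
    using assms by (simp add: image_image coord_scaleR abs_mult)
  also have "\<dots> = c * Max ((\<lambda>j. \<bar>coord x j\<bar>) ` {..<m})"
    using assms by (intro mono_Max_commute[symmetric]) (auto simp: mono_def mult_left_mono)
  finally show ?thesis using PInf by (simp add: lnorm_def)
qed (use assms in auto)

lemma lnorm_sign_vec:
  assumes "S \<subseteq> {..<m}" "card S = l" "1 \<le> l" "1 \<le> p"
  shows "lnorm m p (sign_vec m S A) = real l powr recip p"
proof (cases p)
  case (real r)
  then have "r \<ge> 1" using assms by (simp add: one_ereal_def)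
  then show ?thesis
    using real sum_powr_sign_vec[OF assms(1)] assms by (simp add: lnorm_ereal recip_ereal)
next
  case PInf
  have "(\<lambda>j. \<bar>coord (sign_vec m S A) j\<bar>) ` {..<m} \<subseteq> {0, 1}"
    using assms(1) by (auto simp: coord_sign_vec rsign_def split: if_splits)
  moreover have "1 \<in> (\<lambda>j. \<bar>coord (sign_vec m S A) j\<bar>) ` {..<m}"
  proof -
    have "S \<noteq> {}" using assms by auto
    then obtain i where "i \<in> S" by blast
    then show ?thesis using assms(1) by (intro image_eqI[of _ _ i]) (auto simp: coord_sign_vec)
  qed
  ultimately have "Max ((\<lambda>j. \<bar>coord (sign_vec m S A) j\<bar>) ` {..<m}) = 1"
    by (intro Max_eqI) auto
  then show ?thesis using PInf assms by (simp add: lnorm_def recip_PInf)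
qed (use assms in auto)

text \<open>As \<open>p1 < p0\<close>, the exponent \<open>p1\<close> is finite and given by a real;
  \<open>p0\<close> may be infinite.\<close>

locale two_balls =
  fixes p0 :: ereal and r1 :: real and m n k :: nat
  assumes r1: "1 \<le> r1" "ereal r1 < p0" and adm: "admissible m n k"
begin

definition \<nu> :: real
  where "\<nu> = real k powr (1 / r1 - recip p0)"

definition M :: "(nat \<Rightarrow>\<^sub>0 real) set"
  where "M = lball m p0 \<inter> (\<lambda>x. \<nu> *\<^sub>R x) ` lball m (ereal r1)"

lemma k: "1 \<le> k" "k \<le> m" "real n \<le> real m / 2" "m > 0"
  using adm by (auto simp: admissible_def)

lemma inter_width_eq: "inter_width p0 (ereal r1) (ereal q) m n k = kolmogorov_width n M (Rn m) (lnorm m (ereal q))"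
  using r1 by (simp add: inter_width_def M_def \<nu>_def recip_ereal)

lemma recip_p0: "0 \<le> recip p0" "recip p0 < 1 / r1"
proof -
  have "0 \<le> recip p0 \<and> recip p0 < 1 / r1"
  proof (cases p0)
    case (real r)
    then have "r > r1" using r1 by simp
    then show ?thesis using real r1 by (simp add: recip_ereal frac_less2)
  qed (use r1 in \<open>auto simp: recip_PInf\<close>)
  then show "0 \<le> recip p0" "recip p0 < 1 / r1" by auto
qed

lemma \<nu>_pos: "\<nu> > 0"
  using k by (simp add: \<nu>_def)

lemma \<nu>_ge_1: "1 \<le> \<nu>"
  using k recip_p0 by (simp add: \<nu>_def ge_one_powr_ge_zero)

lemma sum_powr_r1:
  assumes "x \<in> M"
  shows "(\<Sum>j<m. \<bar>coord x j\<bar> powr r1) \<le> \<nu> powr r1"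
proof -
  obtain z where z: "x = \<nu> *\<^sub>R z" "lnorm m (ereal r1) z \<le> 1"
    using assms by (auto simp: M_def lball_def)
  have "(lnorm m (ereal r1) z) powr r1 \<le> 1 powr r1"
    using z(2) r1 by (intro powr_mono2) (auto simp: lnorm_ereal)
  then have "(\<Sum>j<m. \<bar>coord z j\<bar> powr r1) \<le> 1"
    using r1 by (simp add: lnorm_ereal powr_powr sum_nonneg)
  then have "\<nu> powr r1 * (\<Sum>j<m. \<bar>coord z j\<bar> powr r1) \<le> \<nu> powr r1 * 1"
    by (intro mult_left_mono) auto
  then show ?thesis
    using \<nu>_pos by (simp add: z(1) coord_scaleR abs_mult powr_mult sum_distrib_left)
qed

lemma sum_powr_p0:
  assumes "x \<in> M" "p0 = ereal r0"
  shows "(\<Sum>j<m. \<bar>coord x j\<bar> powr r0) \<le> 1"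
proof -
  have r0: "r0 > r1" using assms r1 by simp
  have "lnorm m p0 x \<le> 1" using assms(1) by (simp add: M_def lball_def)
  then have "lnorm m (ereal r0) x \<le> 1" by (simp only: assms(2))
  then have "(lnorm m (ereal r0) x) powr r0 \<le> 1 powr r0"
    using r0 r1 by (intro powr_mono2) (auto simp: lnorm_ereal)
  then show ?thesis using r0 r1 by (simp add: lnorm_ereal powr_powr sum_nonneg)
qed

lemma M_in_Rn: "x \<in> M \<Longrightarrow> x \<in> Rn m"
  by (simp add: M_def lball_def)

lemma scaled_sign_vec_in_M:
  assumes S: "S \<subseteq> {..<m}" "card S = l" "1 \<le> l"
    and c: "c > 0" "c * real l powr recip p0 \<le> 1" "c * real l powr (1 / r1) \<le> \<nu>"
  shows "c *\<^sub>R sign_vec m S A \<in> M"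
proof -
  have p: "1 \<le> p0" using r1 by (metis ereal_less_eq(3) less_imp_le one_ereal_def order_trans)
  have Rn: "t *\<^sub>R sign_vec m S A \<in> Rn m" for t
    by (auto simp: sign_vec_def vec_of_in_Rn intro: subspace_scale[OF subspace_Rn])
  have "lnorm m p0 (c *\<^sub>R sign_vec m S A) = c * real l powr recip p0"
    using k c p lnorm_sign_vec[OF S p] by (subst lnorm_scaleR) auto
  then have 1: "c *\<^sub>R sign_vec m S A \<in> lball m p0" using c Rn by (simp add: lball_def)
  have "lnorm m (ereal r1) ((c / \<nu>) *\<^sub>R sign_vec m S A) = c / \<nu> * real l powr (1 / r1)"
    using k c r1 \<nu>_pos lnorm_sign_vec[OF S, of "ereal r1"]
    by (subst lnorm_scaleR) (auto simp: recip_ereal one_ereal_def)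
  also have "\<dots> \<le> 1" using c \<nu>_pos by (simp add: field_simps)
  finally have "(c / \<nu>) *\<^sub>R sign_vec m S A \<in> lball m (ereal r1)" using Rn by (simp add: lball_def)
  moreover have "c *\<^sub>R sign_vec m S A = \<nu> *\<^sub>R ((c / \<nu>) *\<^sub>R sign_vec m S A)"
    using \<nu>_pos by simp
  ultimately show ?thesis using 1 unfolding M_def by blast
qed

lemma width_ge_sign_vec:
  assumes far: "\<And>L. subspace_of_dim m n L \<Longrightarrow> \<exists>S A. S \<subseteq> {..<m} \<and> card S = l \<and>
      (\<forall>y\<in>L. d \<le> lnorm m (ereal q) (sign_vec m S A - y))"
    and l: "1 \<le> l" and q: "q > 0"
    and c: "c > 0" "c * real l powr recip p0 \<le> 1" "c * real l powr (1 / r1) \<le> \<nu>"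
    and D: "D \<le> c * d"
  shows "ereal D \<le> inter_width p0 (ereal r1) (ereal q) m n k"
  unfolding inter_width_eq
proof (rule kolmogorov_width_ge)
  fix L assume L: "subspace_of_dim m n L"
  from far[OF L] obtain S A where SA: "S \<subseteq> {..<m}" "card S = l"
    "\<And>y. y \<in> L \<Longrightarrow> d \<le> lnorm m (ereal q) (sign_vec m S A - y)"
    by blast
  have "D \<le> lnorm m (ereal q) (c *\<^sub>R sign_vec m S A - y)" if "y \<in> L" for y
  proof -
    have y: "(1 / c) *\<^sub>R y \<in> L"
      using L that by (simp add: subspace_of_dim_def subspace_scale)
    have "c *\<^sub>R sign_vec m S A - y = c *\<^sub>R (sign_vec m S A - (1 / c) *\<^sub>R y)"
      using c by (simp add: scaleR_diff_right)
    then have "lnorm m (ereal q) (c *\<^sub>R sign_vec m S A - y) = c * lnorm m (ereal q) (sign_vec m S A - (1 / c) *\<^sub>R y)"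
      using k c q by (simp add: lnorm_scaleR)
    moreover have "c * d \<le> c * lnorm m (ereal q) (sign_vec m S A - (1 / c) *\<^sub>R y)"
      using SA(3)[OF y] c by simp
    ultimately show ?thesis using D by linarith
  qed
  moreover have "c *\<^sub>R sign_vec m S A \<in> M" by (rule scaled_sign_vec_in_M[OF SA(1,2) l c])
  ultimately show "\<exists>x\<in>M. \<forall>y\<in>L. D \<le> lnorm m (ereal q) (x - y)" by blast
qed

section \<open>Upper bounds for the width of the intersection\<close>

lemma width_le_zero_subspace:
  assumes "\<And>x. x \<in> M \<Longrightarrow> (\<Sum>j<m. \<bar>coord x j\<bar> powr q) \<le> B" "q > 0" "B powr (1 / q) \<le> D"
  shows "inter_width p0 (ereal r1) (ereal q) m n k \<le> ereal D"
  unfolding inter_width_eq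
proof (rule kolmogorov_width_le)
  \<comment> \<open>Approximation by 0 has the right order in those regimes where the width is
    comparable to the \<open>l_q\<close>-radius of the set.\<close>
  show "subspace_of_dim m n {0}"
    unfolding subspace_of_dim_def
    using dim_le_card[of "{0 :: nat \<Rightarrow>\<^sub>0 real}" "{}"] subspace_0[OF subspace_Rn]
    by (auto intro!: exI[of _ "{}"])
  fix x assume "x \<in> M"
  then have "lnorm m (ereal q) (x - 0) \<le> B powr (1 / q)"
    unfolding lnorm_ereal using assms by (intro powr_mono2) (auto intro: sum_nonneg)
  then show "\<exists>y\<in>{0}. lnorm m (ereal q) (x - y) \<le> D" using assms(3) by auto
qed

text \<open>After scaling by \<open>a = k\<^sup>-\<^sup>1\<^sup>/\<^sup>p\<^sup>0\<close> the \<open>r1\<close>- and \<open>p0\<close>-sums are both at most \<open>k\<close>, and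
  \<open>t\<^sup>q \<le> t\<^sup>r\<^sup>1 + t\<^sup>p\<^sup>0\<close>; this replaces Hoelder's inequality at the cost of a factor 2.\<close>

lemma sum_powr_interpolate:
  assumes x: "x \<in> M" and q: "r1 \<le> q" "ereal q \<le> p0"
  shows "(\<Sum>j<m. \<bar>coord x j\<bar> powr q) \<le> 2 * real k powr (1 - q * recip p0)"
proof -
  define a where "a = real k powr (- recip p0)"
  have a: "a > 0" using k by (simp add: a_def)
  have "(\<Sum>j<m. (\<bar>coord x j\<bar> / a) powr r1) = (\<Sum>j<m. \<bar>coord x j\<bar> powr r1) / a powr r1"
    using a by (simp add: powr_divide flip: sum_divide_distrib)
  also have "\<dots> \<le> \<nu> powr r1 / a powr r1"
    using sum_powr_r1[OF x] by (intro divide_right_mono) auto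
  also have "\<dots> = real k"
    using k r1 by (simp add: \<nu>_def a_def powr_powr left_diff_distrib flip: powr_diff)
  finally have le1: "(\<Sum>j<m. (\<bar>coord x j\<bar> / a) powr r1) \<le> real k" .
  have "(\<Sum>j<m. (\<bar>coord x j\<bar> / a) powr q) \<le> 2 * real k"
  proof (cases p0)
    case (real r0)
    have r0: "r1 < r0" "q \<le> r0" using real r1 q by auto
    have "(\<Sum>j<m. (\<bar>coord x j\<bar> / a) powr r0) = (\<Sum>j<m. \<bar>coord x j\<bar> powr r0) / a powr r0"
      using a by (simp add: powr_divide flip: sum_divide_distrib)
    also have "\<dots> \<le> 1 / a powr r0"
      using sum_powr_p0[OF x real] by (intro divide_right_mono) auto
    also have "a powr r0 = real k powr (- 1)"
      using r0 r1 by (simp add: a_def real recip_ereal powr_powr)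
    also have "1 / real k powr (- 1) = real k" using k by (simp add: powr_minus_divide)
    finally have le0: "(\<Sum>j<m. (\<bar>coord x j\<bar> / a) powr r0) \<le> real k" .
    have "t powr q \<le> t powr r1 + t powr r0" if "t \<ge> 0" for t :: real
    proof (cases "t \<le> 1")
      case True
      then have "t powr q \<le> t powr r1" using q that by (intro powr_mono') auto
      then show ?thesis by (simp add: add_increasing2)
    next
      case False
      then have "t powr q \<le> t powr r0" using r0 by (intro powr_mono) auto
      then show ?thesis by (simp add: add_increasing)
    qed
    then have "(\<Sum>j<m. (\<bar>coord x j\<bar> / a) powr q) \<le> (\<Sum>j<m. (\<bar>coord x j\<bar> / a) powr r1 + (\<bar>coord x j\<bar> / a) powr r0)"
      using a by (intro sum_mono) auto
    then show ?thesis using le0 le1 by (simp add: sum.distrib)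
  next
    case PInf
    have "\<bar>coord x j\<bar> \<le> 1" if "j < m" for j
    proof -
      have "\<bar>coord x j\<bar> \<le> Max ((\<lambda>j. \<bar>coord x j\<bar>) ` {..<m})" using that by (intro Max_ge) auto
      moreover have "lnorm m p0 x \<le> 1" using x by (simp add: M_def lball_def)
      ultimately show ?thesis using PInf by (simp add: lnorm_def)
    qed
    then have "(\<bar>coord x j\<bar> / a) powr q \<le> (\<bar>coord x j\<bar> / a) powr r1" if "j < m" for j
      using that q PInf k by (intro powr_mono') (auto simp: a_def recip_PInf)
    then have "(\<Sum>j<m. (\<bar>coord x j\<bar> / a) powr q) \<le> (\<Sum>j<m. (\<bar>coord x j\<bar> / a) powr r1)"
      by (intro sum_mono) auto
    then show ?thesis using le1 by linarith
  qed (use r1 in auto)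
  moreover have "(\<Sum>j<m. (\<bar>coord x j\<bar> / a) powr q) = (\<Sum>j<m. \<bar>coord x j\<bar> powr q) / a powr q"
    using a by (simp add: powr_divide flip: sum_divide_distrib)
  ultimately have "(\<Sum>j<m. \<bar>coord x j\<bar> powr q) \<le> 2 * real k * a powr q"
    using a by (simp add: pos_divide_le_eq)
  also have "a powr q = real k powr (- (q * recip p0))" by (simp add: a_def powr_powr mult.commute)
  also have "2 * real k * real k powr (- (q * recip p0)) = 2 * real k powr (1 - q * recip p0)"
    using k by (simp add: powr_diff powr_minus_divide)
  finally show ?thesis .
qed

lemma width_le_interpolate:
  assumes q: "r1 \<le> q" "ereal q \<le> p0"
  shows "inter_width p0 (ereal r1) (ereal q) m n k \<le> ereal (2 * real k powr (1 / q - recip p0))"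
proof (rule width_le_zero_subspace[OF sum_powr_interpolate])
  have q1: "q \<ge> 1" using q r1 by simp
  have "2 powr (1 / q) \<le> 2 powr (1::real)" using q1 by (intro powr_mono) auto
  then have "2 powr (1 / q) * real k powr (1 / q - recip p0) \<le> 2 * real k powr (1 / q - recip p0)"
    by (intro mult_right_mono) auto
  moreover have "(2 * real k powr (1 - q * recip p0)) powr (1 / q) = 2 powr (1 / q) * real k powr (1 / q - recip p0)"
    using q1 by (simp add: powr_mult powr_powr left_diff_distrib diff_divide_distrib)
  ultimately show "(2 * real k powr (1 - q * recip p0)) powr (1 / q) \<le> 2 * real k powr (1 / q - recip p0)"
    by simp
qed (use q r1 in auto)

lemma width_le_1:
  assumes "p0 = ereal r0" "r0 \<le> q"
  shows "inter_width p0 (ereal r1) (ereal q) m n k \<le> ereal 1"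
proof (rule width_le_zero_subspace)
  have r0: "r0 > r1" using assms r1 by simp
  then show "q > 0" using assms r1 by simp
  fix x assume x: "x \<in> M"
  have "\<bar>coord x j\<bar> powr q \<le> \<bar>coord x j\<bar> powr r0" if "j < m" for j
  proof -
    have "\<bar>coord x j\<bar> powr r0 \<le> (\<Sum>j<m. \<bar>coord x j\<bar> powr r0)" using that by (intro member_le_sum) auto
    then have "\<bar>coord x j\<bar> powr r0 \<le> 1" using sum_powr_p0[OF x assms(1)] by linarith
    then have "(\<bar>coord x j\<bar> powr r0) powr (1 / r0) \<le> 1 powr (1 / r0)"
      using r0 r1 by (intro powr_mono2) auto
    then have "\<bar>coord x j\<bar> \<le> 1" using r0 r1 by (simp add: powr_powr)
    then show ?thesis using assms by (intro powr_mono') auto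
  qed
  then have "(\<Sum>j<m. \<bar>coord x j\<bar> powr q) \<le> (\<Sum>j<m. \<bar>coord x j\<bar> powr r0)"
    by (intro sum_mono) auto
  then show "(\<Sum>j<m. \<bar>coord x j\<bar> powr q) \<le> 1" using sum_powr_p0[OF x assms(1)] by linarith
qed simp

text \<open>At exponent 2, \<open>sum_powr_interpolate\<close> places the set in a Euclidean ball of
  radius \<open>2 k^(1/2 - 1/p0)\<close>, to which \<open>exists_subspace_l2_lq\<close>
  applies.\<close>

lemma width_le_l2:
  assumes q: "q > 1" and n: "n > 0" and p: "r1 \<le> 2" "ereal 2 \<le> p0"
  shows "inter_width p0 (ereal r1) (ereal q) m n k
    \<le> ereal (2 * width_const q * (real k powr (1 / 2 - recip p0) * (real n powr (-1/2) * real m powr (1 / q))))"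
proof -
  obtain L where L: "subspace_of_dim m n L" "\<And>x. x \<in> Rn m \<Longrightarrow> \<exists>y\<in>L.
    (\<Sum>j<m. \<bar>coord x j - coord y j\<bar> powr q) powr (1 / q)
      \<le> width_const q * (real n powr (-1/2) * real m powr (1 / q)) * sqrt (\<Sum>j<m. (coord x j)\<^sup>2)"
    using exists_subspace_l2_lq[OF q n k(4)] by blast
  show ?thesis
    unfolding inter_width_eq
  proof (rule kolmogorov_width_le[OF L(1)])
    fix x assume x: "x \<in> M"
    have "sqrt (\<Sum>j<m. (coord x j)\<^sup>2) \<le> 2 * real k powr (1 / 2 - recip p0)"
    proof -
      have "(\<Sum>j<m. (coord x j)\<^sup>2) = (\<Sum>j<m. \<bar>coord x j\<bar> powr 2)" by simp
      also have "\<dots> \<le> 2 * real k powr (1 - 2 * recip p0)"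
        using p by (intro sum_powr_interpolate[OF x])
      also have "\<dots> \<le> (2 * real k powr (1 / 2 - recip p0))\<^sup>2"
      proof -
        have "(real k powr (1 / 2 - recip p0))\<^sup>2 = real k powr ((1 / 2 - recip p0) + (1 / 2 - recip p0))"
          by (simp only: power2_eq_square powr_add)
        also have "(1 / 2 - recip p0) + (1 / 2 - recip p0) = 1 - 2 * recip p0" by simp
        finally show ?thesis by (simp add: power_mult_distrib)
      qed
      finally show ?thesis by (intro real_le_lsqrt) (auto simp: sum_nonneg)
    qed
    then have "width_const q * (real n powr (-1/2) * real m powr (1 / q)) * sqrt (\<Sum>j<m. (coord x j)\<^sup>2)
        \<le> width_const q * (real n powr (-1/2) * real m powr (1 / q)) * (2 * real k powr (1 / 2 - recip p0))"
      using width_const_pos[of q] by (intro mult_left_mono) auto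
    also have "\<dots> = 2 * width_const q * (real k powr (1 / 2 - recip p0) * (real n powr (-1/2) * real m powr (1 / q)))"
      by (simp add: mult_ac)
    finally show "\<exists>y\<in>L. lnorm m (ereal q) (x - y)
        \<le> 2 * width_const q * (real k powr (1 / 2 - recip p0) * (real n powr (-1/2) * real m powr (1 / q)))"
      using L(2)[OF M_in_Rn[OF x]] by (auto simp: lnorm_ereal lookup_minus intro: order_trans)
  qed
qed

end

text \<open>The factor 2 is the cost of adding two errors by \<open>abs_diff_powr_le\<close>;
  \<open>width_const q\<close> and 1 are the errors from the large and the small coordinates, in
  units of their common order.\<close>

definition split_const :: "real \<Rightarrow> real"
  where "split_const q = 2 * (width_const q powr q + 1) powr (1 / q)"

lemma split_const_pos: "split_const q > 0"
proof -
  have "width_const q powr q + 1 > 0" by (simp add: add_nonneg_pos)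
  then have "width_const q powr q + 1 \<noteq> 0" by linarith
  then show ?thesis by (simp add: split_const_def)
qed

text \<open>Coordinates above the threshold \<open>c\<tau>\<close> form a vector of small Euclidean norm, the others one of
  small \<open>l\<^sub>q\<close>-norm; the exponent of \<open>\<tau>\<close> is chosen so that both errors agree.\<close>

lemma threshold_split:
  fixes p q c s :: real
  assumes p: "2 \<le> p" "p \<le> q" "2 < q" and c: "c > 0" and s: "s > 0"
    and L: "\<And>x. x \<in> Rn m \<Longrightarrow> \<exists>y\<in>L. (\<Sum>j<m. \<bar>coord x j - coord y j\<bar> powr q) powr (1 / q)
      \<le> width_const q * s * sqrt (\<Sum>j<m. (coord x j)\<^sup>2)"
    and x: "(\<Sum>j<m. \<bar>coord x j\<bar> powr p) \<le> c powr p"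
  shows "\<exists>y\<in>L. lnorm m (ereal q) (x - y) \<le> split_const q * (c * s powr ((1 / p - 1 / q) / (1 / 2 - 1 / q)))"
proof -
  define \<theta> where "\<theta> = 1 / 2 - 1 / q"
  have \<theta>: "\<theta> > 0" using p by (simp add: \<theta>_def field_simps)
  define e where "e = (1 / p - 1 / q) / \<theta>"
  \<comment> \<open>Equal errors mean \<open>s \<tau>^(1 - p/2) = \<tau>^(1 - p/q)\<close>, that is,
    \<open>\<tau>^(p \<theta>) = s\<close>.\<close>
  define \<tau> where "\<tau> = s powr (1 / (p * \<theta>))"
  have \<tau>: "\<tau> > 0" using s by (simp add: \<tau>_def)
  have \<tau>q: "\<tau> powr (1 - p / q) = s powr e"
    using p by (simp add: \<tau>_def powr_powr e_def field_simps)
  have \<tau>2: "s * \<tau> powr (1 - p / 2) = s powr e"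
  proof -
    have "s * \<tau> powr (1 - p / 2) = s powr (1 + 1 / (p * \<theta>) * (1 - p / 2))"
      using s by (simp add: \<tau>_def powr_powr powr_add)
    also have "1 + 1 / (p * \<theta>) * (1 - p / 2) = (p * \<theta> + (1 - p / 2)) / (p * \<theta>)"
      using p \<theta> by (simp add: field_simps)
    also have "p * \<theta> + (1 - p / 2) = p * (1 / p - 1 / q)"
      using p by (simp add: \<theta>_def right_diff_distrib)
    also have "p * (1 / p - 1 / q) / (p * \<theta>) = e" using p by (simp add: e_def)
    finally show ?thesis .
  qed
  define T where "T = c * \<tau>"
  have T: "T > 0" using c \<tau> by (simp add: T_def)
  define x1 where "x1 = vec_of m (\<lambda>j. if T < \<bar>coord x j\<bar> then coord x j else 0)"
  define x2 where "x2 j = (if T < \<bar>coord x j\<bar> then 0 else coord x j)" for j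
  define G where "G = c * s powr e"
  have G: "G > 0" using c s by (simp add: G_def)
  have "sqrt (\<Sum>j<m. (coord x1 j)\<^sup>2) \<le> c * \<tau> powr (1 - p / 2)"
  proof (rule real_le_lsqrt)
    have "(\<Sum>j<m. (coord x1 j)\<^sup>2) \<le> (\<Sum>j<m. T powr (2 - p) * \<bar>coord x j\<bar> powr p)"
    proof (rule sum_mono)
      fix j assume j: "j \<in> {..<m}"
      show "(coord x1 j)\<^sup>2 \<le> T powr (2 - p) * \<bar>coord x j\<bar> powr p"
      proof (cases "T < \<bar>coord x j\<bar>")
        case True
        have "(coord x1 j)\<^sup>2 = \<bar>coord x j\<bar> powr (2 - p) * \<bar>coord x j\<bar> powr p"
          using True T j by (simp add: x1_def coord_simps flip: powr_add)
        also have "\<dots> \<le> T powr (2 - p) * \<bar>coord x j\<bar> powr p"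
          using True T p by (intro mult_right_mono powr_mono2') auto
        finally show ?thesis .
      qed (use j in \<open>simp add: x1_def coord_simps\<close>)
    qed
    also have "\<dots> \<le> T powr (2 - p) * c powr p"
      using x by (simp add: mult_left_mono flip: sum_distrib_left)
    also have "\<dots> = c powr (2 - p + p) * \<tau> powr (2 - p)"
      unfolding T_def powr_mult powr_add by simp
    also have "\<dots> = (c * \<tau> powr (1 - p / 2))\<^sup>2"
    proof -
      have "2 - p = (1 - p / 2) + (1 - p / 2)" by simp
      then have "\<tau> powr (2 - p) = \<tau> powr (1 - p / 2) * \<tau> powr (1 - p / 2)" by (metis powr_add)
      then show ?thesis using c by (simp add: power2_eq_square)
    qed
    finally show "(\<Sum>j<m. (coord x1 j)\<^sup>2) \<le> (c * \<tau> powr (1 - p / 2))\<^sup>2" .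
  qed (use c in \<open>auto simp: sum_nonneg\<close>)
  then have "width_const q * s * sqrt (\<Sum>j<m. (coord x1 j)\<^sup>2) \<le> width_const q * s * (c * \<tau> powr (1 - p / 2))"
    using s width_const_pos[of q] by (intro mult_left_mono) auto
  also have "\<dots> = width_const q * c * (s * \<tau> powr (1 - p / 2))" by simp
  also have "\<dots> = width_const q * G" unfolding \<tau>2 G_def by simp
  finally obtain y where y: "y \<in> L" "(\<Sum>j<m. \<bar>coord x1 j - coord y j\<bar> powr q) powr (1 / q) \<le> width_const q * G"
    using L[of x1] by (auto simp: x1_def vec_of_in_Rn intro: order_trans)
  have "((\<Sum>j<m. \<bar>coord x1 j - coord y j\<bar> powr q) powr (1 / q)) powr q \<le> (width_const q * G) powr q"
    using p by (intro powr_mono2 y) auto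
  then have y1: "(\<Sum>j<m. \<bar>coord x1 j - coord y j\<bar> powr q) \<le> width_const q powr q * G powr q"
    using p by (simp add: powr_powr sum_nonneg powr_mult)
  have y2: "(\<Sum>j<m. \<bar>x2 j\<bar> powr q) \<le> G powr q"
  proof -
    have "(\<Sum>j<m. \<bar>x2 j\<bar> powr q) \<le> (\<Sum>j<m. T powr (q - p) * \<bar>coord x j\<bar> powr p)"
    proof (rule sum_mono)
      fix j
      show "\<bar>x2 j\<bar> powr q \<le> T powr (q - p) * \<bar>coord x j\<bar> powr p"
      proof (cases "T < \<bar>coord x j\<bar>")
        case False
        have "\<bar>x2 j\<bar> powr q = \<bar>coord x j\<bar> powr (q - p) * \<bar>coord x j\<bar> powr p"
          using False by (simp add: x2_def flip: powr_add)
        also have "\<dots> \<le> T powr (q - p) * \<bar>coord x j\<bar> powr p"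
          using False p by (intro mult_right_mono powr_mono2) auto
        finally show ?thesis .
      qed (simp add: x2_def)
    qed
    also have "\<dots> \<le> T powr (q - p) * c powr p"
      using x by (simp add: mult_left_mono flip: sum_distrib_left)
    also have "\<dots> = c powr (q - p + p) * \<tau> powr (q - p)"
      unfolding T_def powr_mult powr_add by simp
    also have "\<dots> = c powr q * (\<tau> powr (1 - p / q)) powr q"
      using p by (simp add: powr_powr left_diff_distrib)
    also have "\<dots> = G powr q" unfolding \<tau>q G_def powr_mult ..
    finally show ?thesis .
  qed
  have "(\<Sum>j<m. \<bar>coord x j - coord y j\<bar> powr q)
      \<le> (\<Sum>j<m. 2 powr q * (\<bar>coord x1 j - coord y j\<bar> powr q + \<bar>- x2 j\<bar> powr q))"
  proof (rule sum_mono)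
    fix j assume "j \<in> {..<m}"
    then have "coord x j - coord y j = (coord x1 j - coord y j) - (- x2 j)"
      by (simp add: x1_def x2_def coord_simps)
    then show "\<bar>coord x j - coord y j\<bar> powr q \<le> 2 powr q * (\<bar>coord x1 j - coord y j\<bar> powr q + \<bar>- x2 j\<bar> powr q)"
      using abs_diff_powr_le[of q "coord x1 j - coord y j" "- x2 j"] p by (simp only:)
  qed
  also have "\<dots> = 2 powr q * ((\<Sum>j<m. \<bar>coord x1 j - coord y j\<bar> powr q) + (\<Sum>j<m. \<bar>x2 j\<bar> powr q))"
    by (simp add: sum.distrib flip: sum_distrib_left)
  also have "\<dots> \<le> 2 powr q * (width_const q powr q * G powr q + G powr q)"
    by (intro mult_left_mono add_mono y1 y2) auto
  also have "\<dots> = 2 powr q * (width_const q powr q + 1) * G powr q" by (simp add: algebra_simps)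
  finally have "(\<Sum>j<m. \<bar>coord x j - coord y j\<bar> powr q) powr (1 / q)
      \<le> (2 powr q * (width_const q powr q + 1) * G powr q) powr (1 / q)"
    using p by (intro powr_mono2) (auto simp: sum_nonneg)
  also have "\<dots> = split_const q * G"
    using p G by (simp add: split_const_def powr_mult powr_powr)
  finally show ?thesis using y(1) by (auto simp: lnorm_ereal lookup_minus G_def e_def \<theta>_def)
qed

context two_balls
begin

text \<open>Applied with \<open>p0\<close> and \<open>c = 1\<close> in the middle regime, and with
  \<open>r1\<close> and \<open>c = \<nu>\<close> for large \<open>n\<close>; each time one of the
  two balls already gives the right order.\<close>

lemma width_le_split:
  assumes p: "2 \<le> p" "p \<le> q" "2 < q" and n: "n > 0" and c: "c > 0"
    and x: "\<And>x. x \<in> M \<Longrightarrow> (\<Sum>j<m. \<bar>coord x j\<bar> powr p) \<le> c powr p"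
  shows "inter_width p0 (ereal r1) (ereal q) m n k
    \<le> ereal (split_const q * (c * (real n powr (-1/2) * real m powr (1 / q)) powr ((1 / p - 1 / q) / (1 / 2 - 1 / q))))"
proof -
  have q: "q > 1" using p by simp
  obtain L where L: "subspace_of_dim m n L" "\<And>x. x \<in> Rn m \<Longrightarrow> \<exists>y\<in>L.
    (\<Sum>j<m. \<bar>coord x j - coord y j\<bar> powr q) powr (1 / q)
      \<le> width_const q * (real n powr (-1/2) * real m powr (1 / q)) * sqrt (\<Sum>j<m. (coord x j)\<^sup>2)"
    using exists_subspace_l2_lq[OF q n k(4)] by blast
  have s: "real n powr (-1/2) * real m powr (1 / q) > 0" using n k by simp
  show ?thesis
    unfolding inter_width_eq
    by (rule kolmogorov_width_le[OF L(1)], rule threshold_split[OF p c s L(2) x])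
qed

end

text \<open>Square roots turn a threshold on \<open>N\<close> into a comparison of \<open>K\<close>
  with the critical support size. \<open>K = 1\<close> and \<open>K = k\<close> yield the thresholds
  of the theorem, \<open>K = m\<close> the condition \<open>N <= m\<close>.\<close>

lemma
  fixes K N m q :: real
  assumes pos: "K > 0" "N > 0" "m > 0"
  shows powr_scale_ge: "N \<le> K powr (1 - 2 * (1 / q)) * m powr (2 * (1 / q))
      \<Longrightarrow> K powr (1 / q - 1 / 2) \<le> N powr (-1/2) * m powr (1 / q)"
    and powr_scale_le: "K powr (1 - 2 * (1 / q)) * m powr (2 * (1 / q)) \<le> N
      \<Longrightarrow> N powr (-1/2) * m powr (1 / q) \<le> K powr (1 / q - 1 / 2)"
proof -
  define a where "a = K powr (1 / q - 1 / 2)"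
  define b where "b = K powr (1 / 2 - 1 / q)"
  define c where "c = m powr (1 / q)"
  define u where "u = N powr (1 / 2)"
  define w where "w = N powr (-1/2)"
  have ab: "a * b = 1" and uw: "u * w = 1"
    using pos by (simp_all add: a_def b_def u_def w_def flip: powr_add)
  have aw: "a * w \<ge> 0" by (simp add: a_def w_def)
  have "a * w * u = a * (u * w)" "a * w * (b * c) = (a * b) * (w * c)" by (simp_all only: mult_ac)
  then have eq: "a * w * u = a" "a * w * (b * c) = w * c" by (simp_all add: ab uw)
  have bc: "(K powr (1 - 2 * (1 / q)) * m powr (2 * (1 / q))) powr (1 / 2) = b * c"
    by (simp add: powr_mult powr_powr diff_divide_distrib b_def c_def)
  show "K powr (1 / q - 1 / 2) \<le> N powr (-1/2) * m powr (1 / q)"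
    if "N \<le> K powr (1 - 2 * (1 / q)) * m powr (2 * (1 / q))"
  proof -
    have "u \<le> b * c" unfolding u_def bc[symmetric] using that pos by (intro powr_mono2) auto
    from mult_left_mono[OF this aw] have "a \<le> w * c" unfolding eq .
    then show ?thesis by (simp only: a_def w_def c_def)
  qed
  show "N powr (-1/2) * m powr (1 / q) \<le> K powr (1 / q - 1 / 2)"
    if "K powr (1 - 2 * (1 / q)) * m powr (2 * (1 / q)) \<le> N"
  proof -
    have "b * c \<le> u" unfolding u_def bc[symmetric] using that pos by (intro powr_mono2) auto
    from mult_left_mono[OF this aw] have "w * c \<le> a" unfolding eq .
    then show ?thesis by (simp only: a_def w_def c_def)
  qed
qed

text \<open>Price of rounding the support size down: the exponents \<open>1/q\<close> and
  \<open>1/2\<close> cost at most a factor 2, which turns \<open>1/24\<close> into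
  \<open>1/48\<close>.\<close>

lemma half_powr_le_powr:
  fixes x y a :: real
  assumes "0 < x" "x \<le> 2 * y" "0 < a" "a \<le> 1"
  shows "x powr a / 2 \<le> y powr a"
proof -
  have "x powr a \<le> (2 * y) powr a" using assms by (intro powr_mono2) auto
  also have "\<dots> = 2 powr a * y powr a" by (simp add: powr_mult)
  also have "\<dots> \<le> 2 powr 1 * y powr a" using assms by (intro mult_right_mono powr_mono) auto
  finally show ?thesis by simp
qed

lemma between_multiplesI:
  assumes "ereal (c0 * g) \<le> f" "f \<le> ereal (C0 * g)" "c \<le> c0" "C0 \<le> C" "0 \<le> g"
  shows "between_multiples c C f g"
  unfolding between_multiples_def
proof
  have "c * g \<le> c0 * g" "C0 * g \<le> C * g" using assms by (simp_all add: mult_right_mono)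
  then show "ereal (c * g) \<le> f" "f \<le> ereal (C * g)"
    using assms(1,2) by (metis ereal_less_eq(3) order_trans)+
qed

section \<open>Lower bounds in each regime\<close>

context two_balls
begin

text \<open>For \<open>l = k\<close> the scale \<open>k^(-1/p0)\<close> turns both ball constraints
  into equalities: this is how \<open>\<nu>\<close> is normalized.\<close>

lemma width_ge_k:
  assumes "\<And>L. subspace_of_dim m n L \<Longrightarrow> \<exists>S A. S \<subseteq> {..<m} \<and> card S = k \<and>
      (\<forall>y\<in>L. d \<le> lnorm m (ereal q) (sign_vec m S A - y))"
    and "q > 0" "D \<le> real k powr (- recip p0) * d"
  shows "ereal D \<le> inter_width p0 (ereal r1) (ereal q) m n k"
  by (rule width_ge_sign_vec[OF assms(1) k(1) assms(2) _ _ _ assms(3)])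
     (use k in \<open>auto simp: \<nu>_def simp flip: powr_add\<close>)

text \<open>Signed unit vectors suffice, as both terms of the minimum are at least 1 for
  \<open>l = 1\<close>. Replacing \<open>n = 0\<close> by 1 respects the threshold, since
  \<open>m^(2/q) >= 1\<close>.\<close>

lemma width_ge_small_n:
  assumes q: "2 \<le> q" and n: "real n \<le> real m powr (2 * (1 / q))"
  shows "ereal (1 / 24) \<le> inter_width p0 (ereal r1) (ereal q) m n k"
proof (rule width_ge_sign_vec[where c = 1 and d = "1 / 24" and l = 1])
  define N where "N = max 1 (real n)"
  have N: "real n \<le> N" "1 \<le> N" "N \<le> 1 powr (1 - 2 * (1 / q)) * real m powr (2 * (1 / q))"
    using n k q by (auto simp: N_def ge_one_powr_ge_zero)
  have s: "1 \<le> N powr (-1/2) * real m powr (1 / q)"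
    using powr_scale_ge[of 1 N "real m" q] N k by simp
  show "\<exists>S A. S \<subseteq> {..<m} \<and> card S = 1 \<and> (\<forall>y\<in>L. 1 / 24 \<le> lnorm m (ereal q) (sign_vec m S A - y))"
    if "subspace_of_dim m n L" for L
    using sign_vec_far_q_ge_2[OF that q k(3) N(1,2), of 1] k s by (simp add: min_def)
qed (use \<nu>_ge_1 q in auto)

lemma width_ge_moderate_n:
  assumes q: "2 \<le> q" and n: "real n \<le> real k powr (1 - 2 * (1 / q)) * real m powr (2 * (1 / q))"
  shows "ereal (1 / 24 * real k powr (1 / q - recip p0)) \<le> inter_width p0 (ereal r1) (ereal q) m n k"
proof (rule width_ge_k)
  define N where "N = max 1 (real n)"
  have "1 \<le> real k powr (1 - 2 * (1 / q))" "1 \<le> real m powr (2 * (1 / q))"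
    using k q by (auto intro!: ge_one_powr_ge_zero)
  then have "1 * 1 \<le> real k powr (1 - 2 * (1 / q)) * real m powr (2 * (1 / q))"
    by (intro mult_mono) auto
  then have N: "real n \<le> N" "1 \<le> N" "N \<le> real k powr (1 - 2 * (1 / q)) * real m powr (2 * (1 / q))"
    using n by (auto simp: N_def)
  have "real k powr (1 / 2) * real k powr (1 / q - 1 / 2)
      \<le> real k powr (1 / 2) * (N powr (-1/2) * real m powr (1 / q))"
    using powr_scale_ge[of "real k" N "real m" q] N k by (intro mult_left_mono) auto
  then have *: "real k powr (1 / q) \<le> real k powr (1 / 2) * (N powr (-1/2) * real m powr (1 / q))"
    by (simp flip: powr_add)
  show "\<exists>S A. S \<subseteq> {..<m} \<and> card S = k \<and> (\<forall>y\<in>L. 1 / 24 * real k powr (1 / q) \<le> lnorm m (ereal q) (sign_vec m S A - y))"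
    if "subspace_of_dim m n L" for L
    using sign_vec_far_q_ge_2[OF that q k(3) N(1,2) k(1,2)] by (simp only: min_absorb1[OF *])
  show "1 / 24 * real k powr (1 / q - recip p0) \<le> real k powr (- recip p0) * (1 / 24 * real k powr (1 / q))"
    by (simp flip: powr_add)
qed (use q in auto)

lemma n_pos_if_large:
  assumes "2 \<le> q" "real k powr (1 - 2 * (1 / q)) * real m powr (2 * (1 / q)) \<le> real n"
  shows "n > 0"
proof (rule ccontr)
  have "0 < real k powr (1 - 2 * (1 / q)) * real m powr (2 * (1 / q))" using k by simp
  moreover assume "\<not> n > 0"
  ultimately show False using assms(2) by simp
qed

lemma width_ge_large_n:
  assumes q: "2 \<le> q" and n: "real k powr (1 - 2 * (1 / q)) * real m powr (2 * (1 / q)) \<le> real n"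
  shows "ereal (1 / 24 * (real k powr (1 / 2 - recip p0) * (real n powr (-1/2) * real m powr (1 / q))))
    \<le> inter_width p0 (ereal r1) (ereal q) m n k"
proof (rule width_ge_k)
  have n0: "n > 0" by (rule n_pos_if_large[OF q n])
  let ?s = "real n powr (-1/2) * real m powr (1 / q)"
  have "real k powr (1 / 2) * ?s \<le> real k powr (1 / 2) * real k powr (1 / q - 1 / 2)"
    using powr_scale_le[of "real k" "real n" "real m" q] n k n0 by (intro mult_left_mono) auto
  then have *: "real k powr (1 / 2) * ?s \<le> real k powr (1 / q)" by (simp flip: powr_add)
  have N: "real n \<le> real n" "1 \<le> real n" using n0 by auto
  show "\<exists>S A. S \<subseteq> {..<m} \<and> card S = k \<and> (\<forall>y\<in>L. 1 / 24 * (real k powr (1 / 2) * ?s) \<le> lnorm m (ereal q) (sign_vec m S A - y))"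
    if "subspace_of_dim m n L" for L
    using sign_vec_far_q_ge_2[OF that q k(3) N k(1,2)] by (simp only: min_absorb2[OF *])
  have "real k powr (1 / 2 - recip p0) = real k powr (- recip p0) * real k powr (1 / 2)"
    by (simp flip: powr_add)
  then show "1 / 24 * (real k powr (1 / 2 - recip p0) * ?s) \<le> real k powr (- recip p0) * (1 / 24 * (real k powr (1 / 2) * ?s))"
    by simp
qed (use q in auto)

text \<open>The number \<open>l\<^sub>0\<close> of nonzero coordinates balancing both terms of the minimum in
  \<open>sign_vec_far_q_ge_2\<close> need not be an integer, so it is rounded down.\<close>

lemma width_ge_floor:
  fixes q \<kappa> \<alpha> :: real
  defines "s \<equiv> real n powr (-1/2) * real m powr (1 / q)"
  defines "l0 \<equiv> s powr (- 1 / (1 / 2 - 1 / q))"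
  defines "l \<equiv> nat \<lfloor>l0\<rfloor>"
  assumes q: "2 < q" and n: "n > 0" and \<kappa>: "\<kappa> > 0" and \<alpha>: "\<alpha> \<ge> 0" and s: "s \<le> 1"
    and c: "\<kappa> * real l powr (- \<alpha>) * real l powr recip p0 \<le> 1"
      "\<kappa> * real l powr (- \<alpha>) * real l powr (1 / r1) \<le> \<nu>"
  shows "ereal (1 / 48 * (\<kappa> * s powr ((\<alpha> - 1 / q) / (1 / 2 - 1 / q)))) \<le> inter_width p0 (ereal r1) (ereal q) m n k"
proof -
  define \<theta> where "\<theta> = 1 / 2 - 1 / q"
  have \<theta>: "\<theta> > 0" using q by (simp add: \<theta>_def field_simps)
  have s0: "s > 0" using n k by (simp add: s_def)
  have l0_pow: "l0 powr a = s powr (- a / \<theta>)" for a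
    by (simp add: l0_def \<theta>_def powr_powr)
  have l0: "1 \<le> l0"
  proof -
    have "1 powr (- 1 / \<theta>) \<le> s powr (- 1 / \<theta>)"
      using s s0 \<theta> by (intro powr_mono2') auto
    then show ?thesis by (simp add: l0_def \<theta>_def)
  qed
  have l: "1 \<le> l" "real l \<le> l0" "l0 \<le> 2 * real l"
  proof -
    have e: "real l = of_int \<lfloor>l0\<rfloor>" using l0 by (simp add: l_def)
    show 1: "1 \<le> l" using l0 by (simp add: l_def le_nat_iff le_floor_iff)
    show "real l \<le> l0" unfolding e by (rule of_int_floor_le)
    have "l0 < real l + 1" unfolding e by linarith
    then show "l0 \<le> 2 * real l" using 1 by linarith
  qed
  \<comment> \<open>A support of this size fits because \<open>n <= m\<close>: compare scales at
    \<open>K = m\<close>.\<close>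
  have "l0 \<le> real m"
  proof -
    have "real n \<le> real m powr (1 - 2 * (1 / q)) * real m powr (2 * (1 / q))"
      using k by (simp flip: powr_add)
    then have "real m powr (- \<theta>) \<le> s"
      using powr_scale_ge[of "real m" "real n" "real m" q] n k by (simp add: s_def \<theta>_def)
    then have "s powr (- 1 / \<theta>) \<le> (real m powr (- \<theta>)) powr (- 1 / \<theta>)"
      using k \<theta> by (intro powr_mono2') auto
    then show ?thesis using k \<theta> by (simp add: l0_def \<theta>_def[symmetric] powr_powr)
  qed
  then have lm: "l \<le> m" using l by linarith
  define d where "d = 1 / 24 * min (real l powr (1 / q)) (real l powr (1 / 2) * s)"
  have d: "l0 powr (1 / q) / 48 \<le> d"
  proof -
    have "l0 powr (1 / q) / 2 \<le> real l powr (1 / q)"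
      using q l l0 by (intro half_powr_le_powr) auto
    moreover have "l0 powr (1 / q) / 2 \<le> real l powr (1 / 2) * s"
    proof -
      have "- (1 / q - 1 / 2) / \<theta> = 1" using q \<theta> by (simp add: \<theta>_def)
      then have "l0 powr (1 / q - 1 / 2) = s" using s0 by (simp only: l0_pow) simp
      then have "l0 powr (1 / q) = l0 powr (1 / 2) * s" by (metis add.commute diff_add_cancel powr_add)
      then have "l0 powr (1 / q) / 2 = (l0 powr (1 / 2) / 2) * s" by simp
      also have "\<dots> \<le> real l powr (1 / 2) * s"
        using s0 l l0 by (intro mult_right_mono half_powr_le_powr) auto
      finally show ?thesis .
    qed
    ultimately show ?thesis by (simp add: d_def)
  qed
  have far: "\<exists>S A. S \<subseteq> {..<m} \<and> card S = l \<and> (\<forall>y\<in>L. d \<le> lnorm m (ereal q) (sign_vec m S A - y))"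
    if "subspace_of_dim m n L" for L
    using sign_vec_far_q_ge_2[OF that _ k(3) order_refl _ l(1) lm, of q] q n by (simp add: d_def s_def)
  have "1 / 48 * (\<kappa> * s powr ((\<alpha> - 1 / q) / \<theta>)) = \<kappa> * l0 powr (- \<alpha>) * (l0 powr (1 / q) / 48)"
  proof -
    have "s powr ((\<alpha> - 1 / q) / \<theta>) = l0 powr (- \<alpha> + 1 / q)" by (simp add: l0_pow)
    also have "\<dots> = l0 powr (- \<alpha>) * l0 powr (1 / q)" by (rule powr_add)
    finally show ?thesis by simp
  qed
  \<comment> \<open>Rounding down does not decrease the factor with exponent
    \<open>- \<alpha>\<close>, so the whole loss lies in \<open>d\<close>.\<close>
  also have "\<dots> \<le> \<kappa> * real l powr (- \<alpha>) * d"
    using \<kappa> \<alpha> d l by (intro mult_mono mult_left_mono powr_mono2') auto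
  finally have D: "1 / 48 * (\<kappa> * s powr ((\<alpha> - 1 / q) / \<theta>)) \<le> \<kappa> * real l powr (- \<alpha>) * d" .
  have pos: "\<kappa> * real l powr (- \<alpha>) > 0" using \<kappa> l by simp
  have "q > 0" using q by simp
  from width_ge_sign_vec[OF far l(1) this pos c D] show ?thesis by (simp add: \<theta>_def)
qed

text \<open>Here \<open>1 <= l0 <= k\<close>. For supports of size at most \<open>k\<close> the
  \<open>p0\<close>-ball is the binding constraint, so the scale is
  \<open>l^(-1/p0)\<close>.\<close>

lemma width_ge_middle:
  assumes q: "2 < q" and n: "real m powr (2 * (1 / q)) \<le> real n"
    "real n \<le> real k powr (1 - 2 * (1 / q)) * real m powr (2 * (1 / q))"
  shows "ereal (1 / 48 * (real n powr (-1/2) * real m powr (1 / q)) powr ((recip p0 - 1 / q) / (1 / 2 - 1 / q)))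
    \<le> inter_width p0 (ereal r1) (ereal q) m n k"
proof -
  define s where "s = real n powr (-1/2) * real m powr (1 / q)"
  define l0 where "l0 = s powr (- 1 / (1 / 2 - 1 / q))"
  define l where "l = nat \<lfloor>l0\<rfloor>"
  define \<theta> where "\<theta> = 1 / 2 - 1 / q"
  have \<theta>: "\<theta> > 0" using q by (simp add: \<theta>_def field_simps)
  have "0 < real m powr (2 * (1 / q))" using k by simp
  then have n0: "n > 0" using n(1) by linarith
  have s: "s \<le> 1" using powr_scale_le[of 1 "real n" "real m" q] n n0 k by (simp add: s_def)
  have s0: "s > 0" using n0 k by (simp add: s_def)
  have l0: "1 \<le> l0"
  proof -
    have "1 powr (- 1 / \<theta>) \<le> s powr (- 1 / \<theta>)" using s s0 \<theta> by (intro powr_mono2') auto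
    then show ?thesis by (simp add: l0_def \<theta>_def)
  qed
  have "real k powr (- \<theta>) \<le> s"
    using powr_scale_ge[of "real k" "real n" "real m" q] n n0 k by (simp add: s_def \<theta>_def)
  then have "s powr (- 1 / \<theta>) \<le> (real k powr (- \<theta>)) powr (- 1 / \<theta>)"
    using k \<theta> by (intro powr_mono2') auto
  then have "l0 \<le> real k" using k \<theta> by (simp add: l0_def \<theta>_def[symmetric] powr_powr)
  then have l: "1 \<le> l" "l \<le> k" using l0 unfolding l_def by linarith+
  have "ereal (1 / 48 * (1 * s powr ((recip p0 - 1 / q) / (1 / 2 - 1 / q)))) \<le> inter_width p0 (ereal r1) (ereal q) m n k"
    unfolding s_def
  proof (rule width_ge_floor[OF q n0], unfold s_def[symmetric], unfold l0_def[symmetric], unfold l_def[symmetric])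
    show "1 * real l powr (- recip p0) * real l powr (1 / r1) \<le> \<nu>"
    proof -
      have "real l powr (1 / r1 - recip p0) \<le> \<nu>"
        unfolding \<nu>_def using l recip_p0 by (intro powr_mono2) auto
      then show ?thesis by (simp flip: powr_add)
    qed
  qed (use s l recip_p0 in \<open>auto simp flip: powr_add\<close>)
  then show ?thesis by (simp add: s_def)
qed

text \<open>Here \<open>l0 >= k\<close> and, \<open>k\<close> being an integer, also
  \<open>l >= k\<close>. The \<open>r1\<close>-ball is now binding, so the scale is
  \<open>\<nu> l^(-1/r1)\<close>.\<close>

lemma width_ge_large_n_r1:
  assumes q: "2 < q" and n: "real k powr (1 - 2 * (1 / q)) * real m powr (2 * (1 / q)) \<le> real n"
  shows "ereal (1 / 48 * (real k powr (1 / r1 - recip p0)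
      * (real n powr (-1/2) * real m powr (1 / q)) powr ((1 / r1 - 1 / q) / (1 / 2 - 1 / q))))
    \<le> inter_width p0 (ereal r1) (ereal q) m n k"
proof -
  define s where "s = real n powr (-1/2) * real m powr (1 / q)"
  define l0 where "l0 = s powr (- 1 / (1 / 2 - 1 / q))"
  define l where "l = nat \<lfloor>l0\<rfloor>"
  define \<theta> where "\<theta> = 1 / 2 - 1 / q"
  have \<theta>: "\<theta> > 0" using q by (simp add: \<theta>_def field_simps)
  have n0: "n > 0" using n_pos_if_large[OF _ n] q by simp
  have s0: "s > 0" using n0 k by (simp add: s_def)
  have sk: "s \<le> real k powr (- \<theta>)"
    using powr_scale_le[of "real k" "real n" "real m" q] n n0 k by (simp add: s_def \<theta>_def)
  also have "\<dots> \<le> 1 powr (- \<theta>)" using k \<theta> by (intro powr_mono2') auto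
  finally have s: "s \<le> 1" by simp
  have "(real k powr (- \<theta>)) powr (- 1 / \<theta>) \<le> s powr (- 1 / \<theta>)"
    using sk s0 \<theta> by (intro powr_mono2') auto
  then have "real k \<le> l0" using k \<theta> by (simp add: l0_def \<theta>_def[symmetric] powr_powr)
  then have l: "1 \<le> l" "k \<le> l" using k unfolding l_def by (auto simp: le_nat_iff le_floor_iff)
  have "ereal (1 / 48 * (\<nu> * s powr ((1 / r1 - 1 / q) / (1 / 2 - 1 / q)))) \<le> inter_width p0 (ereal r1) (ereal q) m n k"
    unfolding s_def
  proof (rule width_ge_floor[OF q n0], unfold s_def[symmetric], unfold l0_def[symmetric], unfold l_def[symmetric])
    show "\<nu> * real l powr (- (1 / r1)) * real l powr recip p0 \<le> 1"
    proof -
      have "\<nu> \<le> real l powr (1 / r1 - recip p0)"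
        unfolding \<nu>_def using l k recip_p0 by (intro powr_mono2) auto
      then have "\<nu> * real l powr (- (1 / r1)) * real l powr recip p0
          \<le> real l powr (1 / r1 - recip p0) * real l powr (- (1 / r1)) * real l powr recip p0"
        by (intro mult_right_mono) auto
      also have "\<dots> = 1" using l by (simp flip: powr_add)
      finally show ?thesis .
    qed
    show "\<nu> * real l powr (- (1 / r1)) * real l powr (1 / r1) \<le> \<nu>"
      using l by (simp add: mult.assoc flip: powr_add)
  qed (use s r1 \<nu>_pos in auto)
  then show ?thesis by (simp add: s_def \<nu>_def)
qed

lemma width_ge_q_le_2:
  assumes q: "1 < q" "q \<le> 2"
  shows "ereal (1 / far_const q * real k powr (1 / q - recip p0)) \<le> inter_width p0 (ereal r1) (ereal q) m n k"
proof (rule width_ge_k)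
  show "\<exists>S A. S \<subseteq> {..<m} \<and> card S = k \<and> (\<forall>y\<in>L. real k powr (1 / q) / far_const q \<le> lnorm m (ereal q) (sign_vec m S A - y))"
    if "subspace_of_dim m n L" for L
    by (rule sign_vec_far_q_le_2[OF that q k(3) k(1,2)])
  have "real k powr (1 / q - recip p0) = real k powr (- recip p0) * real k powr (1 / q)"
    by (simp flip: powr_add)
  then show "1 / far_const q * real k powr (1 / q - recip p0) \<le> real k powr (- recip p0) * (real k powr (1 / q) / far_const q)"
    by simp
qed (use q in auto)

text \<open>For \<open>q <= r1\<close> the power \<open>l^(1/q - 1/r1)\<close> does not decrease
  with \<open>l\<close>, so full support is taken.\<close>

lemma width_ge_q_le_r1:
  assumes q: "1 \<le> q" "q \<le> r1"
  shows "ereal (1 / 4 * (real k powr (1 / r1 - recip p0) * real m powr (1 / q - 1 / r1))) \<le> inter_width p0 (ereal r1) (ereal q) m n k"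
proof (rule width_ge_sign_vec)
  show "\<exists>S A. S \<subseteq> {..<m} \<and> card S = m \<and> (\<forall>y\<in>L. real m powr (1 / q) / 4 \<le> lnorm m (ereal q) (sign_vec m S A - y))"
    if L: "subspace_of_dim m n L" for L
  proof -
    obtain A where "\<forall>y\<in>L. real m powr (1 / q) / 4 \<le> lnorm m (ereal q) (sign_vec m {..<m} A - y)"
      using sign_vec_far_full_support[OF L q(1) k(3,4)] by blast
    then show ?thesis by (intro exI[of _ "{..<m}"] exI[of _ A]) auto
  qed
  show "\<nu> * real m powr (- (1 / r1)) > 0" using k \<nu>_pos by simp
  have "\<nu> \<le> real m powr (1 / r1 - recip p0)"
    unfolding \<nu>_def using k recip_p0 by (intro powr_mono2) auto
  then have "\<nu> * real m powr (- (1 / r1)) * real m powr recip p0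
      \<le> real m powr (1 / r1 - recip p0) * real m powr (- (1 / r1)) * real m powr recip p0"
    by (intro mult_right_mono) auto
  also have "\<dots> = 1" using k by (simp flip: powr_add)
  finally show "\<nu> * real m powr (- (1 / r1)) * real m powr recip p0 \<le> 1" .
  show "\<nu> * real m powr (- (1 / r1)) * real m powr (1 / r1) \<le> \<nu>"
    using k by (simp add: mult.assoc flip: powr_add)
  have "real m powr (1 / q - 1 / r1) = real m powr (- (1 / r1)) * real m powr (1 / q)"
    by (simp flip: powr_add)
  then show "1 / 4 * (real k powr (1 / r1 - recip p0) * real m powr (1 / q - 1 / r1))
      \<le> \<nu> * real m powr (- (1 / r1)) * (real m powr (1 / q) / 4)"
    by (simp add: \<nu>_def)
qed (use k q in auto)

lemma width_le_q_le_r1: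
  assumes q: "1 \<le> q" "q \<le> r1"
  shows "inter_width p0 (ereal r1) (ereal q) m n k \<le> ereal (2 * (real k powr (1 / r1 - recip p0) * real m powr (1 / q - 1 / r1)))"
proof -
  \<comment> \<open>The common modulus of \<open>m\<close> equal coordinates with
    \<open>l_r1\<close>-norm \<open>\<nu>\<close>; at this scale \<open>t^q <= 1 + t^r1\<close>
    costs only a factor 2.\<close>
  define a where "a = \<nu> * real m powr (- (1 / r1))"
  have a: "a > 0" using k \<nu>_pos by (simp add: a_def)
  have "(real m powr (- (1 / r1))) powr r1 = real m powr (- 1)" using r1 by (simp add: powr_powr)
  then have ar: "a powr r1 = \<nu> powr r1 / real m"
    using k unfolding a_def powr_mult by (simp add: powr_minus_divide)
  have tq: "t powr q \<le> 1 + t powr r1" if "t \<ge> 0" for t :: real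
  proof (cases "t \<le> 1")
    case True
    then have "t powr q \<le> 1 powr q" using q that by (intro powr_mono2) auto
    then show ?thesis by (simp add: add_increasing2)
  next
    case False
    then have "t powr q \<le> t powr r1" using q by (intro powr_mono) auto
    then show ?thesis by simp
  qed
  have B: "(\<Sum>j<m. \<bar>coord x j\<bar> powr q) \<le> 2 * real m * a powr q" if x: "x \<in> M" for x
  proof -
    have "(\<Sum>j<m. (\<bar>coord x j\<bar> / a) powr q) \<le> (\<Sum>j<m. 1 + (\<bar>coord x j\<bar> / a) powr r1)"
      using a by (intro sum_mono tq) auto
    also have "\<dots> = real m + (\<Sum>j<m. \<bar>coord x j\<bar> powr r1) / a powr r1"
      using a by (simp add: sum.distrib powr_divide flip: sum_divide_distrib)
    also have "\<dots> \<le> real m + \<nu> powr r1 / a powr r1"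
      using sum_powr_r1[OF x] by (intro add_left_mono divide_right_mono) auto
    also have "\<dots> = 2 * real m" using \<nu>_pos by (simp add: ar)
    finally have "(\<Sum>j<m. \<bar>coord x j\<bar> powr q) / a powr q \<le> 2 * real m"
      using a by (simp add: powr_divide flip: sum_divide_distrib)
    then show ?thesis
      using a by (simp add: pos_divide_le_eq)
  qed
  have "2 powr (1 / q) \<le> 2 powr (1::real)" using q by (intro powr_mono) auto
  then have "2 powr (1 / q) * (real m powr (1 / q) * a) \<le> 2 * (real m powr (1 / q) * a)"
    using a by (intro mult_right_mono) auto
  moreover have "(2 * real m * a powr q) powr (1 / q) = 2 powr (1 / q) * (real m powr (1 / q) * a)"
    using q a by (simp add: powr_mult powr_powr)
  moreover have "real m powr (1 / q) * a = real k powr (1 / r1 - recip p0) * real m powr (1 / q - 1 / r1)"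
  proof -
    have "real m powr (1 / q - 1 / r1) = real m powr (1 / q) * real m powr (- (1 / r1))"
      by (simp flip: powr_add)
    then show ?thesis by (simp add: a_def \<nu>_def)
  qed
  ultimately have "(2 * real m * a powr q) powr (1 / q)
      \<le> 2 * (real k powr (1 / r1 - recip p0) * real m powr (1 / q - 1 / r1))" by simp
  then show ?thesis using q by (intro width_le_zero_subspace[OF B]) auto
qed

end

section \<open>The asymptotic formulas\<close>

lemma ex_constantsI:
  fixes c C :: real
  assumes "0 < c" "0 < C" "\<And>m n k. admissible m n k \<Longrightarrow> P c C m n k"
  shows "\<exists>c>0. \<exists>C>0. \<forall>m n k. admissible m n k \<longrightarrow> P c C m n k"
  using assms by blast

lemma width_asymptotics_r1_lt_2_p0_lt_q:
  assumes "1 \<le> r1" "r1 < 2" "2 < r0" "r0 < q"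
  shows "\<exists>c>0. \<exists>C>0. \<forall>m n k. admissible m n k \<longrightarrow>
        (real n \<le> real m powr (2 * (1 / q)) \<longrightarrow>
           between_multiples c C (inter_width (ereal r0) (ereal r1) (ereal q) m n k) 1) \<and>
        (real m powr (2 * (1 / q)) \<le> real n \<and>
           real n \<le> real k powr (1 - 2 * (1 / q)) * real m powr (2 * (1 / q)) \<longrightarrow>
           between_multiples c C (inter_width (ereal r0) (ereal r1) (ereal q) m n k)
          ((real n powr (-1/2) * real m powr (1 / q)) powr
             ((1 / r0 - 1 / q) / (1/2 - 1 / q)))) \<and>
        (real k powr (1 - 2 * (1 / q)) * real m powr (2 * (1 / q)) \<le> real n \<longrightarrow>
           between_multiples c C (inter_width (ereal r0) (ereal r1) (ereal q) m n k)
          (real k powr (1/2 - 1 / r0) * real n powr (-1/2) * real m powr (1 / q)))"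
\<comment> \<open>One pair of constants has to serve all three regimes: the smallest lower constant
  and a sum dominating the upper ones.\<close>
proof (rule ex_constantsI[where c = "1 / 48" and C = "1 + 2 * width_const q + split_const q"]; (intro conjI impI)?)
  show "0 < 1 + 2 * width_const q + split_const q"
    using width_const_pos[of q] split_const_pos[of q] by simp
  fix m n k assume "admissible m n k"
  then interpret two_balls "ereal r0" r1 m n k using assms by unfold_locales auto
  have rec: "recip (ereal r0) = 1 / r0" using assms by (simp add: recip_ereal)
  have W: "0 < width_const q" "0 < split_const q" by (rule width_const_pos split_const_pos)+
  have q: "2 \<le> q" "2 < q" "2 \<le> r0" "r0 \<le> q" "1 < q" "r1 \<le> 2" "ereal 2 \<le> ereal r0" using assms by auto
  show "between_multiples (1 / 48) (1 + 2 * width_const q + split_const q)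
      (inter_width (ereal r0) (ereal r1) (ereal q) m n k) 1"
    if "real n \<le> real m powr (2 * (1 / q))"
    using width_ge_small_n[OF q(1) that] width_le_1[OF refl q(4)] W
    by (intro between_multiplesI[where ?c0.0 = "1 / 24" and ?C0.0 = 1]) auto
  show "between_multiples (1 / 48) (1 + 2 * width_const q + split_const q)
      (inter_width (ereal r0) (ereal r1) (ereal q) m n k)
      ((real n powr (-1/2) * real m powr (1 / q)) powr ((1 / r0 - 1 / q) / (1/2 - 1 / q)))"
    if n: "real m powr (2 * (1 / q)) \<le> real n \<and>
      real n \<le> real k powr (1 - 2 * (1 / q)) * real m powr (2 * (1 / q))"
  proof (rule between_multiplesI[OF width_ge_middle[OF q(2), unfolded rec]])
    have "0 < real m powr (2 * (1 / q))" using k by simp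
    then have "n > 0" using n by linarith
    from width_le_split[OF q(3,4,2) this zero_less_one] sum_powr_p0
    show "inter_width (ereal r0) (ereal r1) (ereal q) m n k \<le> ereal (split_const q *
        (real n powr (-1/2) * real m powr (1 / q)) powr ((1 / r0 - 1 / q) / (1/2 - 1 / q)))"
      by simp
  qed (use n W in auto)
  show "between_multiples (1 / 48) (1 + 2 * width_const q + split_const q)
      (inter_width (ereal r0) (ereal r1) (ereal q) m n k)
      (real k powr (1/2 - 1 / r0) * real n powr (-1/2) * real m powr (1 / q))"
    if n: "real k powr (1 - 2 * (1 / q)) * real m powr (2 * (1 / q)) \<le> real n"
    unfolding mult.assoc[of _ "real n powr _"]
    using width_ge_large_n[OF q(1) n, unfolded rec] W
      width_le_l2[OF q(5) n_pos_if_large[OF q(1) n] q(6,7), unfolded rec]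
    by (intro between_multiplesI[where ?c0.0 = "1 / 24" and ?C0.0 = "2 * width_const q"]) auto
qed simp

lemma width_asymptotics_2_le_r1_p0_lt_q:
  assumes "2 \<le> r1" "r1 < r0" "r0 < q"
  shows "\<exists>c>0. \<exists>C>0. \<forall>m n k. admissible m n k \<longrightarrow>
        (real n \<le> real m powr (2 * (1 / q)) \<longrightarrow>
           between_multiples c C (inter_width (ereal r0) (ereal r1) (ereal q) m n k) 1) \<and>
        (real m powr (2 * (1 / q)) \<le> real n \<and>
           real n \<le> real k powr (1 - 2 * (1 / q)) * real m powr (2 * (1 / q)) \<longrightarrow>
           between_multiples c C (inter_width (ereal r0) (ereal r1) (ereal q) m n k)
          ((real n powr (-1/2) * real m powr (1 / q)) powr
             ((1 / r0 - 1 / q) / (1/2 - 1 / q)))) \<and>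
        (real k powr (1 - 2 * (1 / q)) * real m powr (2 * (1 / q)) \<le> real n \<longrightarrow>
           between_multiples c C (inter_width (ereal r0) (ereal r1) (ereal q) m n k)
          (real k powr (1 / r1 - 1 / r0) *
           (real n powr (-1/2) * real m powr (1 / q)) powr
             ((1 / r1 - 1 / q) / (1/2 - 1 / q))))"
proof (rule ex_constantsI[where c = "1 / 48" and C = "1 + split_const q"]; (intro conjI impI)?)
  show "0 < 1 + split_const q" using split_const_pos[of q] by simp
  fix m n k assume "admissible m n k"
  then interpret two_balls "ereal r0" r1 m n k using assms by unfold_locales auto
  have rec: "recip (ereal r0) = 1 / r0" using assms by (simp add: recip_ereal)
  have W: "0 < split_const q" by (rule split_const_pos)
  have q: "2 \<le> q" "2 < q" "2 \<le> r0" "r0 \<le> q" "r1 \<le> q" using assms by auto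
  show "between_multiples (1 / 48) (1 + split_const q)
      (inter_width (ereal r0) (ereal r1) (ereal q) m n k) 1"
    if "real n \<le> real m powr (2 * (1 / q))"
    using width_ge_small_n[OF q(1) that] width_le_1[OF refl q(4)] W
    by (intro between_multiplesI[where ?c0.0 = "1 / 24" and ?C0.0 = 1]) auto
  show "between_multiples (1 / 48) (1 + split_const q)
      (inter_width (ereal r0) (ereal r1) (ereal q) m n k)
      ((real n powr (-1/2) * real m powr (1 / q)) powr ((1 / r0 - 1 / q) / (1/2 - 1 / q)))"
    if n: "real m powr (2 * (1 / q)) \<le> real n \<and>
      real n \<le> real k powr (1 - 2 * (1 / q)) * real m powr (2 * (1 / q))"
  proof (rule between_multiplesI[OF width_ge_middle[OF q(2), unfolded rec]])
    have "0 < real m powr (2 * (1 / q))" using k by simp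
    then have "n > 0" using n by linarith
    from width_le_split[OF q(3,4,2) this zero_less_one] sum_powr_p0
    show "inter_width (ereal r0) (ereal r1) (ereal q) m n k \<le> ereal (split_const q *
        (real n powr (-1/2) * real m powr (1 / q)) powr ((1 / r0 - 1 / q) / (1/2 - 1 / q)))"
      by simp
  qed (use n W in auto)
  show "between_multiples (1 / 48) (1 + split_const q)
      (inter_width (ereal r0) (ereal r1) (ereal q) m n k)
      (real k powr (1 / r1 - 1 / r0) * (real n powr (-1/2) * real m powr (1 / q)) powr
             ((1 / r1 - 1 / q) / (1/2 - 1 / q)))"
    if n: "real k powr (1 - 2 * (1 / q)) * real m powr (2 * (1 / q)) \<le> real n"
    using width_ge_large_n_r1[OF q(2) n, unfolded rec] W
      width_le_split[OF assms(1) q(5,2) n_pos_if_large[OF q(1) n] \<nu>_pos sum_powr_r1, unfolded \<nu>_def rec]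
    by (intro between_multiplesI[where ?c0.0 = "1 / 48" and ?C0.0 = "split_const q"]) auto
qed simp

lemma width_asymptotics_2_le_r1_le_q_le_p0:
  fixes r1 q :: real and p0 :: ereal
  assumes "2 \<le> r1" "r1 \<le> q" "ereal q \<le> p0" "ereal r1 < p0"
  shows "\<exists>c>0. \<exists>C>0. \<forall>m n k. admissible m n k \<longrightarrow>
        (real n \<le> real k powr (1 - 2 * (1 / q)) * real m powr (2 * (1 / q)) \<longrightarrow>
           between_multiples c C (inter_width p0 (ereal r1) (ereal q) m n k)
          (real k powr (1 / q - recip p0))) \<and>
        (real k powr (1 - 2 * (1 / q)) * real m powr (2 * (1 / q)) \<le> real n \<longrightarrow>
           between_multiples c C (inter_width p0 (ereal r1) (ereal q) m n k)
          (real k powr (1 / r1 - recip p0) *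
           (real n powr (-1/2) * real m powr (1 / q)) powr
             ((1 / r1 - 1 / q) / (1/2 - 1 / q))))"
proof (rule ex_constantsI[where c = "1 / 48" and C = "2 + split_const q"]; (intro conjI impI)?)
  show "0 < 2 + split_const q" using split_const_pos[of q] by simp
  fix m n k assume "admissible m n k"
  then interpret two_balls p0 r1 m n k using assms by unfold_locales auto
  have W: "0 < split_const q" by (rule split_const_pos)
  have q: "2 \<le> q" using assms by auto
  show "between_multiples (1 / 48) (2 + split_const q) (inter_width p0 (ereal r1) (ereal q) m n k)
      (real k powr (1 / q - recip p0))"
    if n: "real n \<le> real k powr (1 - 2 * (1 / q)) * real m powr (2 * (1 / q))"
    using width_ge_moderate_n[OF q n] width_le_interpolate[OF assms(2,3)] W
    by (intro between_multiplesI[where ?c0.0 = "1 / 24" and ?C0.0 = 2]) auto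
  show "between_multiples (1 / 48) (2 + split_const q) (inter_width p0 (ereal r1) (ereal q) m n k)
      (real k powr (1 / r1 - recip p0) * (real n powr (-1/2) * real m powr (1 / q)) powr
             ((1 / r1 - 1 / q) / (1/2 - 1 / q)))"
    if n: "real k powr (1 - 2 * (1 / q)) * real m powr (2 * (1 / q)) \<le> real n"
  proof (cases "q = 2")
    \<comment> \<open>For \<open>q = 2\<close> the threshold equals \<open>m\<close>, so no
      \<open>n <= m/2\<close> lies in this regime and the division by \<open>1/2 - 1/q = 0\<close>
      does not arise.\<close>
    case True
    then show ?thesis using n k by simp
  next
    case False
    then have q2: "2 < q" using q by simp
    show ?thesis
      using width_ge_large_n_r1[OF q2 n] W
        width_le_split[OF assms(1,2) q2 n_pos_if_large[OF q n] \<nu>_pos sum_powr_r1, unfolded \<nu>_def]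
      by (intro between_multiplesI[where ?c0.0 = "1 / 48" and ?C0.0 = "split_const q"]) auto
  qed
qed simp

lemma width_asymptotics_r1_lt_2_lt_q_le_p0:
  fixes r1 q :: real and p0 :: ereal
  assumes "1 \<le> r1" "r1 < 2" "2 < q" "ereal q \<le> p0"
  shows "\<exists>c>0. \<exists>C>0. \<forall>m n k. admissible m n k \<longrightarrow>
        (real n \<le> real k powr (1 - 2 * (1 / q)) * real m powr (2 * (1 / q)) \<longrightarrow>
           between_multiples c C (inter_width p0 (ereal r1) (ereal q) m n k)
          (real k powr (1 / q - recip p0))) \<and>
        (real k powr (1 - 2 * (1 / q)) * real m powr (2 * (1 / q)) \<le> real n \<longrightarrow>
           between_multiples c C (inter_width p0 (ereal r1) (ereal q) m n k)
          (real k powr (1/2 - recip p0) * real n powr (-1/2) * real m powr (1 / q)))"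
proof (rule ex_constantsI[where c = "1 / 48" and C = "2 + 2 * width_const q"]; (intro conjI impI)?)
  show "0 < 2 + 2 * width_const q" using width_const_pos[of q] by simp
  fix m n k assume "admissible m n k"
  moreover have "ereal r1 < ereal q" using assms by simp
  then have "ereal r1 < p0" using assms(4) by (rule less_le_trans)
  ultimately interpret two_balls p0 r1 m n k using assms by unfold_locales auto
  have W: "0 < width_const q" by (rule width_const_pos)
  have q: "2 \<le> q" "1 < q" "r1 \<le> q" "r1 \<le> 2" using assms by auto
  have p0: "ereal 2 \<le> p0" using assms(3) by (intro order_trans[OF _ assms(4)]) simp
  show "between_multiples (1 / 48) (2 + 2 * width_const q) (inter_width p0 (ereal r1) (ereal q) m n k)
      (real k powr (1 / q - recip p0))"
    if n: "real n \<le> real k powr (1 - 2 * (1 / q)) * real m powr (2 * (1 / q))"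
    using width_ge_moderate_n[OF q(1) n] width_le_interpolate[OF q(3) assms(4)] W
    by (intro between_multiplesI[where ?c0.0 = "1 / 24" and ?C0.0 = 2]) auto
  show "between_multiples (1 / 48) (2 + 2 * width_const q) (inter_width p0 (ereal r1) (ereal q) m n k)
      (real k powr (1/2 - recip p0) * real n powr (-1/2) * real m powr (1 / q))"
    if n: "real k powr (1 - 2 * (1 / q)) * real m powr (2 * (1 / q)) \<le> real n"
    unfolding mult.assoc[of _ "real n powr _"]
    using width_ge_large_n[OF q(1) n] W width_le_l2[OF q(2) n_pos_if_large[OF q(1) n] q(4) p0]
    by (intro between_multiplesI[where ?c0.0 = "1 / 24" and ?C0.0 = "2 * width_const q"]) auto
qed simp

text \<open>\<open>r1 < q\<close> forces \<open>q > 1\<close>, hence a finite dual exponent in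
  \<open>far_const\<close>; the zero subspace gives the matching upper bound.\<close>

lemma width_asymptotics_q_le_2:
  fixes r1 q :: real and p0 :: ereal
  assumes "1 \<le> r1" "r1 < q" "q \<le> 2" "ereal q < p0"
  shows "\<exists>c>0. \<exists>C>0. \<forall>m n k. admissible m n k \<longrightarrow>
    between_multiples c C (inter_width p0 (ereal r1) (ereal q) m n k) (real k powr (1 / q - recip p0))"
proof (rule ex_constantsI[where c = "1 / far_const q" and C = "2"]; (intro conjI impI)?)
  show "0 < 1 / far_const q" using far_const_pos[of q] by simp
  fix m n k assume "admissible m n k"
  moreover have "ereal r1 < ereal q" using assms by simp
  then have "ereal r1 < p0" using assms(4) by (rule less_trans)
  ultimately interpret two_balls p0 r1 m n k using assms by unfold_locales auto
  show "between_multiples (1 / far_const q) 2 (inter_width p0 (ereal r1) (ereal q) m n k)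
      (real k powr (1 / q - recip p0))"
    using assms by (intro between_multiplesI[OF width_ge_q_le_2 width_le_interpolate]) auto
qed simp

lemma width_asymptotics_q_le_r1:
  fixes r1 q :: real and p0 :: ereal
  assumes "1 \<le> q" "q \<le> r1" "ereal r1 < p0"
  shows "\<exists>c>0. \<exists>C>0. \<forall>m n k. admissible m n k \<longrightarrow>
    between_multiples c C (inter_width p0 (ereal r1) (ereal q) m n k)
      (real k powr (1 / r1 - recip p0) * real m powr (1 / q - 1 / r1))"
proof (rule ex_constantsI[where c = "1 / 4" and C = "2"]; (intro conjI impI)?)
  fix m n k assume "admissible m n k"
  then interpret two_balls p0 r1 m n k using assms by unfold_locales auto
  show "between_multiples (1 / 4) 2 (inter_width p0 (ereal r1) (ereal q) m n k)
      (real k powr (1 / r1 - recip p0) * real m powr (1 / q - 1 / r1))"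
    using assms by (intro between_multiplesI[OF width_ge_q_le_r1 width_le_q_le_r1]) auto
qed simp_all

lemma ereal_ge_1_finite_cases:
  fixes x :: ereal
  assumes "1 \<le> x" "x < \<infinity>"
  obtains r where "x = ereal r" "1 \<le> r" "recip x = 1 / r"
proof (cases x)
  case (real r)
  then have "1 \<le> r" using assms by (simp add: one_ereal_def)
  then show ?thesis using that real by (simp add: recip_ereal)
qed (use assms in auto)

theorem theorem1:
  fixes p0 p1 q :: ereal
  assumes "1 \<le> p1" and "p1 < p0"
  shows
   "(p1 < 2 \<and> 2 < p0 \<and> p0 < q \<and> q < \<infinity> \<longrightarrow>
      (\<exists>c>0. \<exists>C>0. \<forall>m n k. admissible m n k \<longrightarrow>
        (real n \<le> real m powr (2 * recip q) \<longrightarrow>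
           between_multiples c C (inter_width p0 p1 q m n k) 1) \<and>
        (real m powr (2 * recip q) \<le> real n \<and>
           real n \<le> real k powr (1 - 2 * recip q) * real m powr (2 * recip q) \<longrightarrow>
           between_multiples c C (inter_width p0 p1 q m n k)
          ((real n powr (-1/2) * real m powr recip q) powr
             ((recip p0 - recip q) / (1/2 - recip q)))) \<and>
        (real k powr (1 - 2 * recip q) * real m powr (2 * recip q) \<le> real n \<longrightarrow>
           between_multiples c C (inter_width p0 p1 q m n k)
          (real k powr (1/2 - recip p0) * real n powr (-1/2) * real m powr recip q)))) \<and>
    (2 \<le> p1 \<and> p0 < q \<and> q < \<infinity> \<longrightarrow>
      (\<exists>c>0. \<exists>C>0. \<forall>m n k. admissible m n k \<longrightarrow>
        (real n \<le> real m powr (2 * recip q) \<longrightarrow>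
           between_multiples c C (inter_width p0 p1 q m n k) 1) \<and>
        (real m powr (2 * recip q) \<le> real n \<and>
           real n \<le> real k powr (1 - 2 * recip q) * real m powr (2 * recip q) \<longrightarrow>
           between_multiples c C (inter_width p0 p1 q m n k)
          ((real n powr (-1/2) * real m powr recip q) powr
             ((recip p0 - recip q) / (1/2 - recip q)))) \<and>
        (real k powr (1 - 2 * recip q) * real m powr (2 * recip q) \<le> real n \<longrightarrow>
           between_multiples c C (inter_width p0 p1 q m n k)
          (real k powr (recip p1 - recip p0) *
           (real n powr (-1/2) * real m powr recip q) powr
             ((recip p1 - recip q) / (1/2 - recip q)))))) \<and>
    (2 \<le> p1 \<and> p1 \<le> q \<and> q \<le> p0 \<and> q < \<infinity> \<longrightarrow>
      (\<exists>c>0. \<exists>C>0. \<forall>m n k. admissible m n k \<longrightarrow>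
        (real n \<le> real k powr (1 - 2 * recip q) * real m powr (2 * recip q) \<longrightarrow>
           between_multiples c C (inter_width p0 p1 q m n k)
          (real k powr (recip q - recip p0))) \<and>
        (real k powr (1 - 2 * recip q) * real m powr (2 * recip q) \<le> real n \<longrightarrow>
           between_multiples c C (inter_width p0 p1 q m n k)
          (real k powr (recip p1 - recip p0) *
           (real n powr (-1/2) * real m powr recip q) powr
             ((recip p1 - recip q) / (1/2 - recip q)))))) \<and>
    (p1 < 2 \<and> 2 < q \<and> q \<le> p0 \<and> q < \<infinity> \<longrightarrow>
      (\<exists>c>0. \<exists>C>0. \<forall>m n k. admissible m n k \<longrightarrow>
        (real n \<le> real k powr (1 - 2 * recip q) * real m powr (2 * recip q) \<longrightarrow>
           between_multiples c C (inter_width p0 p1 q m n k)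
          (real k powr (recip q - recip p0))) \<and>
        (real k powr (1 - 2 * recip q) * real m powr (2 * recip q) \<le> real n \<longrightarrow>
           between_multiples c C (inter_width p0 p1 q m n k)
          (real k powr (1/2 - recip p0) * real n powr (-1/2) * real m powr recip q)))) \<and>
    (q \<le> 2 \<and> p1 < q \<and> q < p0 \<longrightarrow>
      (\<exists>c>0. \<exists>C>0. \<forall>m n k. admissible m n k \<longrightarrow>
        (between_multiples c C (inter_width p0 p1 q m n k)
          (real k powr (recip q - recip p0))))) \<and>
    (1 \<le> q \<and> q \<le> p1 \<longrightarrow>
      (\<exists>c>0. \<exists>C>0. \<forall>m n k. admissible m n k \<longrightarrow>
        (between_multiples c C (inter_width p0 p1 q m n k)
          (real k powr (recip p1 - recip p0) * real m powr (recip q - recip p1)))))"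
proof -
  have "p1 < \<infinity>" using assms(2) by (cases p0) auto
  then obtain r1 where r1: "p1 = ereal r1" "1 \<le> r1" "recip p1 = 1 / r1"
    using ereal_ge_1_finite_cases[OF assms(1)] by blast
  have p0_ge: "1 \<le> p0" using assms by (meson less_imp_le order_trans)
  show ?thesis
  proof (intro conjI impI; elim conjE)
    assume a: "p1 < 2" "2 < p0" "p0 < q" "q < \<infinity>"
    obtain r0 where r0: "p0 = ereal r0" "recip p0 = 1 / r0"
      using ereal_ge_1_finite_cases[OF p0_ge] less_trans[OF a(3,4)] by blast
    obtain s where s: "q = ereal s" "recip q = 1 / s"
      using ereal_ge_1_finite_cases[OF order_trans[OF p0_ge less_imp_le[OF a(3)]] a(4)] by blast
    show "\<exists>c>0. \<exists>C>0. \<forall>m n k. admissible m n k \<longrightarrow>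
        (real n \<le> real m powr (2 * recip q) \<longrightarrow>
           between_multiples c C (inter_width p0 p1 q m n k) 1) \<and>
        (real m powr (2 * recip q) \<le> real n \<and>
           real n \<le> real k powr (1 - 2 * recip q) * real m powr (2 * recip q) \<longrightarrow>
           between_multiples c C (inter_width p0 p1 q m n k)
          ((real n powr (-1/2) * real m powr recip q) powr
             ((recip p0 - recip q) / (1/2 - recip q)))) \<and>
        (real k powr (1 - 2 * recip q) * real m powr (2 * recip q) \<le> real n \<longrightarrow>
           between_multiples c C (inter_width p0 p1 q m n k)
          (real k powr (1/2 - recip p0) * real n powr (-1/2) * real m powr recip q))"
      unfolding r0(2) s(2) unfolding r0(1) s(1) r1(1)
      using a r1 r0 s by (intro width_asymptotics_r1_lt_2_p0_lt_q) auto
  next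
    assume a: "2 \<le> p1" "p0 < q" "q < \<infinity>"
    obtain r0 where r0: "p0 = ereal r0" "recip p0 = 1 / r0"
      using ereal_ge_1_finite_cases[OF p0_ge] less_trans[OF a(2,3)] by blast
    obtain s where s: "q = ereal s" "recip q = 1 / s"
      using ereal_ge_1_finite_cases[OF order_trans[OF p0_ge less_imp_le[OF a(2)]] a(3)] by blast
    show "\<exists>c>0. \<exists>C>0. \<forall>m n k. admissible m n k \<longrightarrow>
        (real n \<le> real m powr (2 * recip q) \<longrightarrow>
           between_multiples c C (inter_width p0 p1 q m n k) 1) \<and>
        (real m powr (2 * recip q) \<le> real n \<and>
           real n \<le> real k powr (1 - 2 * recip q) * real m powr (2 * recip q) \<longrightarrow>
           between_multiples c C (inter_width p0 p1 q m n k)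
          ((real n powr (-1/2) * real m powr recip q) powr
             ((recip p0 - recip q) / (1/2 - recip q)))) \<and>
        (real k powr (1 - 2 * recip q) * real m powr (2 * recip q) \<le> real n \<longrightarrow>
           between_multiples c C (inter_width p0 p1 q m n k)
          (real k powr (recip p1 - recip p0) *
           (real n powr (-1/2) * real m powr recip q) powr
             ((recip p1 - recip q) / (1/2 - recip q))))"
      unfolding r1(3) r0(2) s(2) unfolding r0(1) s(1) r1(1)
      using a r1 r0 s assms by (intro width_asymptotics_2_le_r1_p0_lt_q) auto
  next
    assume a: "2 \<le> p1" "p1 \<le> q" "q \<le> p0" "q < \<infinity>"
    obtain s where s: "q = ereal s" "recip q = 1 / s"
      using ereal_ge_1_finite_cases[OF order_trans[OF assms(1) a(2)] a(4)] by blast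
    show "\<exists>c>0. \<exists>C>0. \<forall>m n k. admissible m n k \<longrightarrow>
        (real n \<le> real k powr (1 - 2 * recip q) * real m powr (2 * recip q) \<longrightarrow>
           between_multiples c C (inter_width p0 p1 q m n k)
          (real k powr (recip q - recip p0))) \<and>
        (real k powr (1 - 2 * recip q) * real m powr (2 * recip q) \<le> real n \<longrightarrow>
           between_multiples c C (inter_width p0 p1 q m n k)
          (real k powr (recip p1 - recip p0) *
           (real n powr (-1/2) * real m powr recip q) powr
             ((recip p1 - recip q) / (1/2 - recip q))))"
      unfolding r1(3) s(2) unfolding s(1) r1(1)
      using a r1 s assms by (intro width_asymptotics_2_le_r1_le_q_le_p0) auto
  next
    assume a: "p1 < 2" "2 < q" "q \<le> p0" "q < \<infinity>"
    obtain s where s: "q = ereal s" "recip q = 1 / s"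
      using ereal_ge_1_finite_cases[OF order_trans[OF assms(1) less_imp_le[OF less_trans[OF a(1,2)]]] a(4)] by blast
    show "\<exists>c>0. \<exists>C>0. \<forall>m n k. admissible m n k \<longrightarrow>
        (real n \<le> real k powr (1 - 2 * recip q) * real m powr (2 * recip q) \<longrightarrow>
           between_multiples c C (inter_width p0 p1 q m n k)
          (real k powr (recip q - recip p0))) \<and>
        (real k powr (1 - 2 * recip q) * real m powr (2 * recip q) \<le> real n \<longrightarrow>
           between_multiples c C (inter_width p0 p1 q m n k)
          (real k powr (1/2 - recip p0) * real n powr (-1/2) * real m powr recip q))"
      unfolding s(2) unfolding s(1) r1(1)
      using a r1 s by (intro width_asymptotics_r1_lt_2_lt_q_le_p0) auto
  next
    assume a: "q \<le> 2" "p1 < q" "q < p0"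
    have "q < \<infinity>" using a(1) by (cases q) auto
    then obtain s where s: "q = ereal s" "recip q = 1 / s"
      using ereal_ge_1_finite_cases[OF order_trans[OF assms(1) less_imp_le[OF a(2)]]] by blast
    show "\<exists>c>0. \<exists>C>0. \<forall>m n k. admissible m n k \<longrightarrow>
        (between_multiples c C (inter_width p0 p1 q m n k)
          (real k powr (recip q - recip p0)))"
      unfolding s(2) unfolding s(1) r1(1)
      using a r1 s by (intro width_asymptotics_q_le_2) auto
  next
    assume a: "1 \<le> q" "q \<le> p1"
    obtain s where s: "q = ereal s" "1 \<le> s" "recip q = 1 / s"
      using ereal_ge_1_finite_cases[OF a(1) le_less_trans[OF a(2) \<open>p1 < \<infinity>\<close>]] by blast
    show "\<exists>c>0. \<exists>C>0. \<forall>m n k. admissible m n k \<longrightarrow>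
        (between_multiples c C (inter_width p0 p1 q m n k)
          (real k powr (recip p1 - recip p0) * real m powr (recip q - recip p1)))"
      unfolding r1(3) s(3) unfolding s(1) r1(1)
      using a r1 s assms by (intro width_asymptotics_q_le_r1) auto
  qed
qed

end
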